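(* Let $g \in L^2(\mathbb{R}^d)$ be nonzero. For every $\varepsilon > 0$, there exists a countable set $\Lambda \subseteq \mathbb{R}^d \times \mathbb{R}^d$ satisfying $D^-(\Lambda) \ge 1 - \varepsilon$ and such that the family of functions $\big\{ t \mapsto e^{2\pi i \lambda_1 \cdot t} g(t - \lambda_2) \big\}_{(\lambda_1,\lambda_2) \in \Lambda}$ is a Riesz sequence in $L^2(\mathbb{R}^d)$.
   Context: The lower Beurling density of $\Lambda \subseteq \mathbb{R}^{2d} = \mathbb{R}^d\times\mathbb{R}^d$ is $$D^-(\Lambda) = \liminf_{r\to\infty} \inf_{z \in \mathbb{R}^{2d}} \frac{\#(\Lambda \cap B_r(z))}{|B_r(z)|},$$ where $B_r(z)$ is the open Euclidean ball in $\mathbb{R}^{2d}$ and $|\cdot|$ is Lebesgue measure. A countable family $\{g_i\}_{i\in I}$ in a Hilbert space is a Riesz sequence if there are $A,B>0$ with $A\|c\|^2 \le \|\sum_{i\in I} c_i g_i\|^2 \le B\|c\|^2$ for all $c \in \ell^2(I)$. *)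

theory Defs
  imports "HOL-Analysis.Analysis"
begin

(* Square-integrable functions are not identified modulo null sets; L2_norm is therefore only a
   seminorm, and "nonzero in L^2" has to be expressed by an almost-everywhere statement. *)

definition L2 :: "'a measure \<Rightarrow> ('a \<Rightarrow> complex) set" where
  "L2 M = {f \<in> borel_measurable M. integrable M (\<lambda>t. (cmod (f t))\<^sup>2)}"

definition L2_norm :: "'a measure \<Rightarrow> ('a \<Rightarrow> complex) \<Rightarrow> real" where
  "L2_norm M f = sqrt (LINT t|M. (cmod (f t))\<^sup>2)"

(* Unconditional convergence of a series in L^2; the sum f is determined up to a null set. *)

definition L2_has_sum :: "'a measure \<Rightarrow> ('i \<Rightarrow> 'a \<Rightarrow> complex) \<Rightarrow> ('a \<Rightarrow> complex) \<Rightarrow> 'i set \<Rightarrow> bool" where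
  "L2_has_sum M u f I \<longleftrightarrow> f \<in> L2 M \<and>
     ((\<lambda>F. L2_norm M (\<lambda>t. f t - (\<Sum>i\<in>F. u i t))) \<longlongrightarrow> 0) (finite_subsets_at_top I)"

(* Convergence of the series for every square-summable c is part of the requirement. *)

definition riesz_sequence :: "'a measure \<Rightarrow> ('i \<Rightarrow> 'a \<Rightarrow> complex) \<Rightarrow> 'i set \<Rightarrow> bool" where
  "riesz_sequence M G I \<longleftrightarrow> countable I \<and> (\<forall>i\<in>I. G i \<in> L2 M) \<and>
     (\<exists>A>0. \<exists>B>0. \<forall>c :: 'i \<Rightarrow> complex. (\<lambda>i. (cmod (c i))\<^sup>2) summable_on I \<longrightarrow>
        (\<exists>f. L2_has_sum M (\<lambda>i t. c i * G i t) f I \<and>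
             A * (\<Sum>\<^sub>\<infinity>i\<in>I. (cmod (c i))\<^sup>2) \<le> (L2_norm M f)\<^sup>2 \<and>
             (L2_norm M f)\<^sup>2 \<le> B * (\<Sum>\<^sub>\<infinity>i\<in>I. (cmod (c i))\<^sup>2)))"

(* Points are counted with the counting measure rather than card, so that an infinite
   intersection with a ball counts as infinity and not as 0. *)

definition lower_beurling_density :: "'a::euclidean_space set \<Rightarrow> ennreal" where
  "lower_beurling_density \<Lambda> =
     Liminf at_top (\<lambda>r::real. INF z. emeasure (count_space UNIV) (\<Lambda> \<inter> ball z r)
                                       / emeasure lebesgue (ball z r))"

definition time_freq_shift ::
    "(real^'n) \<times> (real^'n) \<Rightarrow> (real^'n \<Rightarrow> complex) \<Rightarrow> real^'n \<Rightarrow> complex" where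
  "time_freq_shift l g t =
     exp (2 * complex_of_real pi * \<i> * complex_of_real (fst l \<bullet> t)) * g (t - snd l)"

end

theory Submission
  imports Defs "HOL-Computational_Algebra.Fundamental_Theorem_Algebra" "HOL-Real_Asymp.Real_Asymp"
    "HOL-Complex_Analysis.Great_Picard" "Jordan_Normal_Form.Determinant"
begin

text \<open>
  The time-frequency shifts of \<open>g\<close> over the fine lattice
  \<open>(1/P)\<int>\<^sup>d \<times> (1/p)\<int>\<^sup>d\<close> form a Bessel family whose bound is essentially
  \<open>(Pp)\<^sup>d \<parallel>g\<parallel>\<^sup>2\<close>: for step functions supported in a cube of side \<open>P\<close> this follows from the
  orthogonality of exponentials, and \<open>g\<close> is approximated by such functions. So the Gram matrix,
  divided by its norm, is a contraction with a small constant diagonal. A selection theorem in the spirit of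
  Marcus, Spielman and Srivastava picks a prescribed number of lattice points in every cell of side \<open>L\<close>
  such that the norm of the compressed matrix is hardly larger than the proportion of selected points. A first
  application to the Gram matrix \<open>G\<close> leaves a large multiple of \<open>L\<^sup>2\<^sup>d\<close> points
  per cell and an upper bound \<open>\<gamma>D\<close>; a second one, to \<open>1 - G / (\<gamma>D)\<close>, leaves \<open>(1 - \<epsilon>) L\<^sup>2\<^sup>d\<close>
  points per cell and a lower bound. The bounds do not depend on the number of cells, and the points
  stay in their compact cells, so a limit of finite configurations is a Riesz sequence with the same
  number of points in every cell.

  The selection theorem comes from the polynomials \<open>det (diag z - M)\<close> of the principal submatrices: deleting
  points from a block averages to a directional derivative in that block. Along lines these
  polynomials are real-rooted with common interlacing, so some deletion has its largest root at most that
  of the average, and a barrier argument bounds the largest root of the derivatives.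
\<close>

hide_const (open) module.smult

section \<open>Quadratic forms and principal minors\<close>

text \<open>For general \<open>g\<close> no Bessel bound over a whole fine lattice is at hand. The
  bound \<open>\<gamma> N (1 + t)\<close>, with \<open>N = (P p)\<^sup>d\<close>, rests on
  approximating \<open>g\<close> by a step function, the more closely the more points occur, so
  \<open>N\<close> may grow with the number of cells. Selecting at once from
  \<open>1 - G / (\<gamma> N (1 + t))\<close> would yield the density and the lower bound, but leave
  an upper bound of order \<open>N\<close>. The first selection removes \<open>N\<close>: with cell
  volume \<open>V\<close> its norm is at most about (1 + t) (1 / (t N) + s1 / (N V)), and the factor
  1 / N cancels the \<open>N\<close> of the normalisation. The second one starts from the diagonal 1
  - 1 / D and ends with a norm below 1 exactly when (s2 + 1) / s1 * (1 + t) < 1 / D. As s1 = d V,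
  and D is close to d when t is small and d is large compared with 1 / t, s2 / V can come close to
  1. The s + 1 instead of s arises because removing r - s points from a block takes r - s
  derivatives but shifts the barrier only r - s - 1 times.\<close>

definition mat_app :: "'i set \<Rightarrow> ('i \<Rightarrow> 'i \<Rightarrow> complex) \<Rightarrow> ('i \<Rightarrow> complex) \<Rightarrow> 'i \<Rightarrow> complex" where
  "mat_app S M c i = (\<Sum>j\<in>S. M i j * c j)"

definition sesq :: "'i set \<Rightarrow> ('i \<Rightarrow> complex) \<Rightarrow> ('i \<Rightarrow> complex) \<Rightarrow> complex" where
  "sesq S u v = (\<Sum>i\<in>S. cnj (u i) * v i)"

definition herm_on :: "'i set \<Rightarrow> ('i \<Rightarrow> 'i \<Rightarrow> complex) \<Rightarrow> bool" where
  "herm_on S M \<longleftrightarrow> (\<forall>i\<in>S. \<forall>j\<in>S. M j i = cnj (M i j))"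

definition quad_form :: "'i set \<Rightarrow> ('i \<Rightarrow> 'i \<Rightarrow> complex) \<Rightarrow> ('i \<Rightarrow> complex) \<Rightarrow> real" where
  "quad_form S M c = Re (sesq S c (mat_app S M c))"

definition sq_norm :: "'i set \<Rightarrow> ('i \<Rightarrow> complex) \<Rightarrow> real" where
  "sq_norm S c = (\<Sum>i\<in>S. (cmod (c i))\<^sup>2)"

lemma sq_norm_eq_sesq: "sq_norm S c = Re (sesq S c c)"
  by (simp add: sq_norm_def sesq_def cmod_def power2_eq_square)

lemma sq_norm_nonneg: "sq_norm S c \<ge> 0"
  by (simp add: sq_norm_def sum_nonneg)

lemma sesq_cnj: "sesq S v u = cnj (sesq S u v)"
  by (simp add: sesq_def mult.commute)

lemma Re_sesq_commute: "Re (sesq S v u) = Re (sesq S u v)"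
  by (subst sesq_cnj) simp

lemma herm_mat_app:
  assumes "herm_on S M"
  shows "sesq S u (mat_app S M v) = sesq S (mat_app S M u) v"
proof -
  have "sesq S u (mat_app S M v) = (\<Sum>i\<in>S. \<Sum>j\<in>S. cnj (u i) * M i j * v j)"
    by (simp add: sesq_def mat_app_def sum_distrib_left mult.assoc)
  also have "\<dots> = (\<Sum>j\<in>S. \<Sum>i\<in>S. cnj (u i) * M i j * v j)"
    by (rule sum.swap)
  also have "\<dots> = sesq S (mat_app S M u) v"
  proof -
    have "cnj (u i) * M i j * v j = cnj (M j i * u i) * v j" if "i \<in> S" "j \<in> S" for i j
      using assms[unfolded herm_on_def, rule_format, OF that(2,1)] by simp
    then show ?thesis
      unfolding sesq_def mat_app_def cnj_sum sum_distrib_right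
      by (intro sum.cong refl) simp
  qed
  finally show ?thesis .
qed

lemma sesq_combine:
  "sesq S (\<lambda>i. a * u i + b * v i) w = cnj a * sesq S u w + cnj b * sesq S v w"
  "sesq S w (\<lambda>i. a * u i + b * v i) = a * sesq S w u + b * sesq S w v"
  "mat_app S M (\<lambda>i. a * u i + b * v i) = (\<lambda>i. a * mat_app S M u i + b * mat_app S M v i)"
  unfolding sesq_def mat_app_def sum_distrib_left
  by (simp_all add: algebra_simps flip: sum.distrib)

lemma quad_form_combine:
  assumes "herm_on S M"
  shows "quad_form S M (\<lambda>i. of_real a * u i + of_real b * v i) =
    a\<^sup>2 * quad_form S M u + 2 * a * b * Re (sesq S v (mat_app S M u)) + b\<^sup>2 * quad_form S M v"
proof -
  have "Re (sesq S u (mat_app S M v)) = Re (sesq S v (mat_app S M u))"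
    using herm_mat_app[OF assms, of u v] Re_sesq_commute by metis
  then show ?thesis
    by (simp add: quad_form_def sesq_combine power2_eq_square algebra_simps)
qed

lemma sq_norm_combine:
  "sq_norm S (\<lambda>i. of_real a * u i + of_real b * v i) =
    a\<^sup>2 * sq_norm S u + 2 * a * b * Re (sesq S v u) + b\<^sup>2 * sq_norm S v"
  using Re_sesq_commute[of S u v]
  by (simp add: sq_norm_eq_sesq sesq_combine power2_eq_square algebra_simps)

section \<open>Forms between 0 and a multiple of the identity, and their resolvents\<close>

lemma psd_app_bound:
  assumes h: "herm_on S A" and psd: "\<And>c. 0 \<le> quad_form S A c"
    and le: "\<And>c. quad_form S A c \<le> K * sq_norm S c" and K: "K > 0"
  shows "sq_norm S (mat_app S A c) \<le> K * quad_form S A c"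
proof -
  let ?v = "mat_app S A c"
  \<comment> \<open>Testing positivity on \<open>K c - A c\<close> gives the operator inequality A^2
    <= K A without a spectral decomposition.\<close>
  have "0 \<le> quad_form S A (\<lambda>i. of_real K * c i + of_real (-1) * ?v i)"
    by (rule psd)
  also have "\<dots> = K\<^sup>2 * quad_form S A c - 2 * K * sq_norm S ?v + quad_form S A ?v"
    by (subst quad_form_combine[OF h]) (simp add: sq_norm_eq_sesq)
  also have "\<dots> \<le> K\<^sup>2 * quad_form S A c - 2 * K * sq_norm S ?v + K * sq_norm S ?v"
    using le[of ?v] by simp
  finally have "K * sq_norm S ?v \<le> K * (K * quad_form S A c)"
    by (simp add: power2_eq_square algebra_simps)
  then show ?thesis using K by simp
qed

text \<open>\<open>y k\<close> is a diagonal entry of the resolvent of \<open>M\<close> at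
  \<open>x\<close>. On [0, 1] the convex function 1 / (x - s) of s lies below its chord 1 / x + s /
  (x (x - 1)); inserting \<open>M\<close> for s and evaluating at the k-th unit vector gives the
  claim. The proof checks this on vectors, without eigenvalues.\<close>

lemma psd_resolvent_bound:
  assumes fin: "finite S" and k: "k \<in> S"
    and h: "herm_on S M" and psd: "\<And>c. 0 \<le> quad_form S M c"
    and le: "\<And>c. quad_form S M c \<le> sq_norm S c" and x: "x > 1"
    and y: "\<And>i. i \<in> S \<Longrightarrow> of_real x * y i - mat_app S M y i = (if i = k then 1 else 0)"
  shows "x * (x - 1) * Re (y k) \<le> x - 1 + Re (M k k)"
proof -
  define e :: "'a \<Rightarrow> complex" where "e = (\<lambda>i. of_real x * y i + of_real (-1) * mat_app S M y i)"
  have e: "e i = (if i = k then 1 else 0)" if "i \<in> S" for i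
    using y[OF that] by (simp add: e_def)
  define m where "m = mat_app S M y"
  have q: "quad_form S M y = Re (sesq S m y)"
    using herm_mat_app[OF h, of y y] by (simp add: quad_form_def m_def)
  have ne: "sq_norm S e = 1"
    using fin k by (simp add: sq_norm_def e if_distrib [of cmod] if_distrib[of "\<lambda>x. x^2"] cong: if_cong)
  have qe: "quad_form S M e = Re (M k k)"
    using fin k by (simp add: quad_form_def sesq_def mat_app_def e if_distrib[of cnj] if_distrib[of "\<lambda>x. _ * x"] if_distrib[of "\<lambda>x. x * _"] cong: if_cong)
  have ye: "Re (sesq S e y) = Re (y k)"
    using fin k by (simp add: sesq_def e if_distrib[of cnj] if_distrib[of "\<lambda>x. x * _"] cong: if_cong)
  have ne2: "sq_norm S e = x\<^sup>2 * sq_norm S y - 2 * x * quad_form S M y + sq_norm S m"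
    unfolding e_def m_def[symmetric] by (subst sq_norm_combine) (simp add: q)
  have qe2: "quad_form S M e = x\<^sup>2 * quad_form S M y - 2 * x * sq_norm S m + quad_form S M m"
    unfolding e_def m_def[symmetric]
    by (subst quad_form_combine[OF h]) (simp add: sq_norm_eq_sesq m_def)
  have ye2: "Re (sesq S e y) = x * sq_norm S y - quad_form S M y"
    unfolding e_def m_def[symmetric] sesq_combine by (simp add: q sq_norm_eq_sesq)
  have a: "sq_norm S m \<le> quad_form S M y"
    using psd_app_bound[OF h psd, of 1 y] le by (simp add: m_def)
  have "0 \<le> quad_form S M (\<lambda>i. of_real 1 * y i + of_real (-1) * m i)"
    by (rule psd)
  then have b: "0 \<le> quad_form S M y - 2 * sq_norm S m + quad_form S M m"
    by (subst (asm) quad_form_combine[OF h]) (simp add: sq_norm_eq_sesq m_def)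
  \<comment> \<open>After multiplication by (x - s)^2 the chord inequality has the remainder s (1 -
    s) (x - s) = (x - 1) s (1 - s) + s (1 - s)^2. The two summands are this line and
    \<open>b\<close>; the powers s, s^2, s^3 stand for \<open>quad_form S M y\<close>,
    \<open>sq_norm S m\<close> and \<open>quad_form S M m\<close>.\<close>
  have "(x - 1) * (quad_form S M y - sq_norm S m) \<ge> 0" using a x by simp
  with b have "0 \<le> x * quad_form S M y - (x + 1) * sq_norm S m + quad_form S M m"
    by (simp add: algebra_simps)
  also have "\<dots> = (x - 1) * sq_norm S e + quad_form S M e - x * (x - 1) * Re (sesq S e y)"
    unfolding ne2 qe2 ye2 by (simp add: algebra_simps power2_eq_square)
  finally show ?thesis by (simp add: ne qe ye)
qed

text \<open>H = x - M is positive semidefinite. Expanding its form at y - y' gives Re (y k) - 2 Re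
  (y' k) + <y', H y'>, and the last term is at most Re (y' k) because the diagonal
  \<open>\<xi>\<close> dominates \<open>x\<close>.\<close>

lemma resolvent_antimono:
  assumes fin: "finite S" and k: "k \<in> S"
    and h: "herm_on S M" and le: "\<And>c. quad_form S M c \<le> sq_norm S c" and x: "x \<ge> 1"
    and y: "\<And>i. i \<in> S \<Longrightarrow> of_real x * y i - mat_app S M y i = (if i = k then 1 else 0)"
    and y': "\<And>i. i \<in> S \<Longrightarrow> of_real (\<xi> i) * y' i - mat_app S M y' i = (if i = k then 1 else 0)"
    and ge: "\<And>i. i \<in> S \<Longrightarrow> \<xi> i \<ge> x"
  shows "Re (y' k) \<le> Re (y k)"
proof -
  have s: "sesq S u (\<lambda>i. if i = k then 1 else 0) = cnj (u k)" for u
    using fin k by (simp add: sesq_def if_distrib[of "\<lambda>x. _ * x"] cong: if_cong)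
  have "sesq S u (\<lambda>i. of_real x * y i + of_real (-1) * mat_app S M y i) = sesq S u (\<lambda>i. if i = k then 1 else 0)" for u
    using y by (simp add: sesq_def)
  then have 1: "of_real x * sesq S u y - sesq S u (mat_app S M y) = cnj (u k)" for u
    by (simp only: s sesq_combine) simp
  have 2: "sesq S y' (\<lambda>i. of_real (\<xi> i) * y' i + of_real (-1) * mat_app S M y' i) = sesq S y' (\<lambda>i. if i = k then 1 else 0)"
    using y' by (simp add: sesq_def)
  have s2: "sesq S y' (\<lambda>i. of_real (\<xi> i) * y' i) - sesq S y' (mat_app S M y') = cnj (y' k)"
    using 2[unfolded s] by (simp add: sesq_def ring_distribs sum_subtractf)
  then have 3: "Re (sesq S y' (\<lambda>i. of_real (\<xi> i) * y' i)) - quad_form S M y' = Re (y' k)"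
    by (simp add: complex_eq_iff quad_form_def)
  have 4: "x * sq_norm S y' \<le> Re (sesq S y' (\<lambda>i. of_real (\<xi> i) * y' i))"
  proof -
    have "x * sq_norm S y' = (\<Sum>i\<in>S. x * (cmod (y' i))\<^sup>2)" by (simp add: sq_norm_def sum_distrib_left)
    also have "\<dots> \<le> (\<Sum>i\<in>S. \<xi> i * (cmod (y' i))\<^sup>2)"
      using ge by (intro sum_mono mult_right_mono) auto
    also have "\<dots> = Re (sesq S y' (\<lambda>i. of_real (\<xi> i) * y' i))"
      by (simp add: sesq_def cmod_def power2_eq_square algebra_simps)
    finally show ?thesis .
  qed
  have 5: "x * sq_norm S y - quad_form S M y = Re (y k)"
    using arg_cong[OF 1[of y], of Re] by (simp add: quad_form_def sq_norm_eq_sesq)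
  have 6: "x * Re (sesq S y' y) - Re (sesq S y' (mat_app S M y)) = Re (y' k)"
    using arg_cong[OF 1[of y'], of Re] by simp
  let ?d = "\<lambda>i. of_real 1 * y i + of_real (-1) * y' i"
  have "quad_form S M ?d \<le> 1 * sq_norm S ?d" using le by simp
  also have "\<dots> \<le> x * sq_norm S ?d" using x sq_norm_nonneg by (intro mult_right_mono)
  finally have "0 \<le> x * (sq_norm S y - 2 * Re (sesq S y' y) + sq_norm S y')
       - (quad_form S M y - 2 * Re (sesq S y' (mat_app S M y)) + quad_form S M y')"
    unfolding sq_norm_combine quad_form_combine[OF h] by simp
  with 3 4 5 6 show ?thesis by (simp add: algebra_simps)
qed

text \<open>Outside \<open>T\<close> the matrix is the identity, so \<open>char_minor N M T z\<close> is the determinant of the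
  principal submatrix of \<open>diag z - M\<close> on \<open>T\<close>.\<close>

definition minor_mat :: "nat \<Rightarrow> (nat \<Rightarrow> nat \<Rightarrow> complex) \<Rightarrow> nat set \<Rightarrow> (nat \<Rightarrow> complex) \<Rightarrow> complex mat" where
  "minor_mat N M T z = mat N N (\<lambda>(i, j).
     if i \<in> T \<and> j \<in> T then (if i = j then z i else 0) - M i j else if i = j then 1 else 0)"

definition char_minor :: "nat \<Rightarrow> (nat \<Rightarrow> nat \<Rightarrow> complex) \<Rightarrow> nat set \<Rightarrow> (nat \<Rightarrow> complex) \<Rightarrow> complex" where
  "char_minor N M T z = Determinant.det (minor_mat N M T z)"

lemma minor_mat_carrier [simp]: "minor_mat N M T z \<in> carrier_mat N N"
  by (simp add: minor_mat_def)

lemma minor_mat_index: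
  "i < N \<Longrightarrow> j < N \<Longrightarrow> minor_mat N M T z $$ (i, j) =
    (if i \<in> T \<and> j \<in> T then (if i = j then z i else 0) - M i j else if i = j then 1 else 0)"
  by (simp add: minor_mat_def)

section \<open>Expansion of principal minors, Cramer's rule, zeros\<close>

lemma char_minor_expand:
  "char_minor N M T z = (\<Sum>p | p permutes {0..<N}. of_int (sign p) * (\<Prod>i = 0..<N. minor_mat N M T z $$ (i, p i)))"
  unfolding char_minor_def by (rule det_def'[OF minor_mat_carrier])

lemma permutes_fix_prod:
  assumes p: "p permutes {0..<N}" and k: "k < N" "p k = k"
    and A: "\<And>i j. i < N \<Longrightarrow> j < N \<Longrightarrow> i \<noteq> k \<Longrightarrow> j \<noteq> k \<Longrightarrow> A i j = B i j"
  shows "(\<Prod>i\<in>{0..<N} - {k}. A i (p i)) = (\<Prod>i\<in>{0..<N} - {k}. B i (p i))"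
proof (rule prod.cong)
  fix i assume i: "i \<in> {0..<N} - {k}"
  have "p i \<noteq> k" using i k(2) p by (metis DiffD2 insertI1 permutes_inverses(2))
  moreover have "p i < N" using p i by (metis DiffD1 atLeastLessThan_iff permutes_in_image)
  ultimately show "A i (p i) = B i (p i)" using i A by auto
qed simp

text \<open>Deleting \<open>k\<close> replaces row and column \<open>k\<close> by those of the
  identity, so only permutations fixing \<open>k\<close> survive in the Leibniz expansion.\<close>

lemma char_minor_remove:
  assumes k: "k \<in> T" "k < N"
  shows "char_minor N M (T - {k}) z = (\<Sum>p | p permutes {0..<N} \<and> p k = k.
     of_int (sign p) * (\<Prod>i\<in>{0..<N} - {k}. minor_mat N M T z $$ (i, p i)))"
proof -
  have fin: "finite {p. p permutes {0..<N}}" by (simp add: finite_permutations)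
  have "char_minor N M (T - {k}) z =
     (\<Sum>p | p permutes {0..<N} \<and> p k = k. of_int (sign p) * (\<Prod>i = 0..<N. minor_mat N M (T - {k}) z $$ (i, p i)))"
    unfolding char_minor_expand
  proof (rule sum.mono_neutral_right[OF fin], force, safe)
    fix p assume p: "p permutes {0..<N}"
      and nz: "of_int (sign p) * (\<Prod>i = 0..<N. minor_mat N M (T - {k}) z $$ (i, p i)) \<noteq> 0"
    have "p k < N" using p k(2) by (metis atLeastLessThan_iff permutes_in_image zero_le)
    moreover have "minor_mat N M (T - {k}) z $$ (k, p k) \<noteq> 0"
      using nz k by auto
    ultimately show "p k = k" using k by (auto simp: minor_mat_index split: if_splits)
  qed
  also have "\<dots> = (\<Sum>p | p permutes {0..<N} \<and> p k = k.
     of_int (sign p) * (\<Prod>i\<in>{0..<N} - {k}. minor_mat N M T z $$ (i, p i)))"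
  proof (rule sum.cong[OF refl])
    fix p assume "p \<in> {p. p permutes {0..<N} \<and> p k = k}"
    then have p: "p permutes {0..<N}" "p k = k" by auto
    have "(\<Prod>i = 0..<N. minor_mat N M (T - {k}) z $$ (i, p i)) =
        minor_mat N M (T - {k}) z $$ (k, p k) * (\<Prod>i\<in>{0..<N} - {k}. minor_mat N M (T - {k}) z $$ (i, p i))"
      using k by (intro prod.remove) auto
    also have "minor_mat N M (T - {k}) z $$ (k, p k) = 1"
      using k p by (simp add: minor_mat_index)
    also have "(\<Prod>i\<in>{0..<N} - {k}. minor_mat N M (T - {k}) z $$ (i, p i)) =
       (\<Prod>i\<in>{0..<N} - {k}. minor_mat N M T z $$ (i, p i))"
      by (rule permutes_fix_prod[OF p(1) k(2) p(2), of "\<lambda>i j. minor_mat N M (T - {k}) z $$ (i, j)" "\<lambda>i j. minor_mat N M T z $$ (i, j)"])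
         (simp add: minor_mat_index)
    finally show "of_int (sign p) * (\<Prod>i = 0..<N. minor_mat N M (T - {k}) z $$ (i, p i)) =
      of_int (sign p) * (\<Prod>i\<in>{0..<N} - {k}. minor_mat N M T z $$ (i, p i))" by simp
  qed
  finally show ?thesis .
qed

text \<open>The variable \<open>z k\<close> occurs in one diagonal entry only, hence only in the
  terms of permutations fixing \<open>k\<close>. Deleting an index is therefore the partial
  derivative in its variable; the abstract families below rest on this.\<close>

lemma char_minor_affine:
  assumes k: "k \<in> T" "k < N"
  shows "char_minor N M T (z(k := z k + t)) = char_minor N M T z + t * char_minor N M (T - {k}) z"
proof -
  have fin: "finite {p. p permutes {0..<N}}" by (simp add: finite_permutations)
  let ?P = "\<lambda>z p. \<Prod>i\<in>{0..<N} - {k}. minor_mat N M T z $$ (i, p i)"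
  have "of_int (sign p) * (\<Prod>i = 0..<N. minor_mat N M T (z(k := z k + t)) $$ (i, p i)) =
     of_int (sign p) * (\<Prod>i = 0..<N. minor_mat N M T z $$ (i, p i))
     + (if p k = k then t * (of_int (sign p) * ?P z p) else 0)" (is "?L p = ?R p")
    if p: "p permutes {0..<N}" for p
  proof -
    have pN: "p i < N" if "i < N" for i using p that by (metis atLeastLessThan_iff permutes_in_image zero_le)
    have 1: "(\<Prod>i = 0..<N. minor_mat N M T z $$ (i, p i)) = minor_mat N M T z $$ (k, p k) * ?P z p" for z
      using k by (intro prod.remove) auto
    have 2: "?P (z(k := z k + t)) p = ?P z p"
      by (rule prod.cong) (auto simp: minor_mat_index pN)
    have 3: "minor_mat N M T (z(k := z k + t)) $$ (k, p k) = minor_mat N M T z $$ (k, p k) + (if p k = k then t else 0)"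
      using k pN[of k] by (auto simp: minor_mat_index)
    show ?thesis unfolding 1 2 3 by (simp add: algebra_simps)
  qed
  then have "char_minor N M T (z(k := z k + t)) = (\<Sum>p | p permutes {0..<N}. ?R p)"
    unfolding char_minor_expand by (intro sum.cong) auto
  also have "\<dots> = char_minor N M T z + (\<Sum>p | p permutes {0..<N}. if p k = k then t * (of_int (sign p) * ?P z p) else 0)"
    unfolding char_minor_expand by (rule sum.distrib)
  also have "(\<Sum>p | p permutes {0..<N}. if p k = k then t * (of_int (sign p) * ?P z p) else 0) =
     (\<Sum>p\<in>{p. p permutes {0..<N}} \<inter> {p. p k = k}. t * (of_int (sign p) * ?P z p))"
    using fin by (subst sum.inter_restrict) auto
  also have "{p. p permutes {0..<N}} \<inter> {p. p k = k} = {p. p permutes {0..<N} \<and> p k = k}" by auto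
  finally show ?thesis
    by (simp only: char_minor_remove[OF k] sum_distrib_left)
qed

lemma char_minor_empty: "char_minor N M {} z = 1"
proof -
  have "minor_mat N M {} z = 1\<^sub>m N" by (rule eq_matI) (auto simp: minor_mat_def)
  then show ?thesis by (simp add: char_minor_def)
qed

text \<open>Conjugating the entries of a hermitian matrix transposes it, which does not change the
  determinant.\<close>

lemma char_minor_real:
  assumes h: "herm_on T M" and T: "T \<subseteq> {..<N}" and z: "\<And>i. i \<in> T \<Longrightarrow> z i \<in> \<real>"
  shows "char_minor N M T z \<in> \<real>"
proof -
  have "cnj (char_minor N M T z) = (\<Sum>p | p permutes {0..<N}. of_int (sign p) * (\<Prod>i = 0..<N. cnj (minor_mat N M T z $$ (i, p i))))"
    unfolding char_minor_expand by simp
  also have "\<dots> = (\<Sum>p | p permutes {0..<N}. of_int (sign p) * (\<Prod>j<N. minor_mat N M T z $$ (p j, j)))"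
  proof (rule sum.cong[OF refl], rule arg_cong2[where f = "(*)"], simp)
    fix p assume "p \<in> {p. p permutes {0..<N}}"
    then have pN: "p i < N" if "i < N" for i using that by (metis atLeastLessThan_iff mem_Collect_eq permutes_in_image zero_le)
    show "(\<Prod>i = 0..<N. cnj (minor_mat N M T z $$ (i, p i))) = (\<Prod>j<N. minor_mat N M T z $$ (p j, j))"
    proof (rule prod.cong)
      fix i assume "i \<in> {..<N}"
      then have i: "i < N" by simp
      have "M (p i) i = cnj (M i (p i))" if "i \<in> T" "p i \<in> T"
        using h[unfolded herm_on_def, rule_format, OF that] .
      then show "cnj (minor_mat N M T z $$ (i, p i)) = minor_mat N M T z $$ (p i, i)"
        using z[of i] i pN[OF i] by (auto simp: minor_mat_index Reals_cnj_iff)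
    qed auto
  qed
  also have "\<dots> = char_minor N M T z"
    unfolding char_minor_def by (rule det_col[OF minor_mat_carrier, symmetric])
  finally show ?thesis by (simp add: Reals_cnj_iff)
qed

lemma minor_mat_mult_vec:
  assumes T: "T \<subseteq> {..<N}" and i: "i < N" and v: "v \<in> carrier_vec N"
  shows "(minor_mat N M T z *\<^sub>v v) $ i =
    (if i \<in> T then z i * v $ i - mat_app T M (\<lambda>j. v $ j) i else v $ i)"
proof -
  have "(minor_mat N M T z *\<^sub>v v) $ i = (\<Sum>j = 0..<N. minor_mat N M T z $$ (i, j) * v $ j)"
    using i v by (simp add: scalar_prod_def minor_mat_def)
  also have "\<dots> = (\<Sum>j = 0..<N. if i \<in> T then (if j = i then z i * v $ i else 0) - (if j \<in> T then M i j * v $ j else 0)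
      else if j = i then v $ i else 0)"
    using i by (intro sum.cong) (auto simp: minor_mat_index algebra_simps)
  also have "\<dots> = (if i \<in> T then z i * v $ i - (\<Sum>j\<in>{0..<N} \<inter> T. M i j * v $ j) else v $ i)"
    using i by (auto simp: sum_subtractf sum.inter_restrict)
  also have "{0..<N} \<inter> T = T" using T by auto
  finally show ?thesis by (simp add: mat_app_def)
qed

lemma char_minor_zeroE:
  assumes T: "T \<subseteq> {..<N}" and 0: "char_minor N M T z = 0"
  obtains c where "\<exists>i\<in>T. c i \<noteq> 0" "\<And>i. i \<in> T \<Longrightarrow> z i * c i = mat_app T M c i"
proof -
  from 0 obtain v where v: "v \<in> carrier_vec N" "v \<noteq> 0\<^sub>v N" "minor_mat N M T z *\<^sub>v v = 0\<^sub>v N"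
    unfolding char_minor_def using det_0_iff_vec_prod_zero_field[OF minor_mat_carrier] by blast
  have *: "(if i \<in> T then z i * v $ i - mat_app T M (\<lambda>j. v $ j) i else v $ i) = 0" if "i < N" for i
    using minor_mat_mult_vec[OF T that v(1), of M z] v(3) that by simp
  from v(1,2) obtain i where i: "i < N" "v $ i \<noteq> 0" by (metis carrier_vecD eq_vecI index_zero_vec)
  with *[of i] have "i \<in> T" by (auto split: if_splits)
  show ?thesis
  proof (rule that[of "\<lambda>j. v $ j"])
    show "\<exists>i\<in>T. v $ i \<noteq> 0" using i \<open>i \<in> T\<close> by blast
    show "z i * v $ i = mat_app T M (($) v) i" if "i \<in> T" for i
      using *[of i] that T by auto
  qed
qed

text \<open>Cramer's rule for the k-th unit vector: the ratio of the two minors is the diagonal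
  entry \<open>y k\<close> of the inverse. This links logarithmic derivatives of minors to the
  resolvent.\<close>

lemma char_minor_nonzero_solve:
  assumes T: "T \<subseteq> {..<N}" and nz: "char_minor N M T z \<noteq> 0" and k: "k \<in> T"
  obtains y where "\<And>i. i \<in> T \<Longrightarrow> z i * y i - mat_app T M y i = (if i = k then 1 else 0)"
    "char_minor N M (T - {k}) z = y k * char_minor N M T z"
proof -
  let ?A = "minor_mat N M T z"
  have kN: "k < N" using T k by auto
  have "?A \<in> Units (ring_mat TYPE(complex) N ())"
    using nz unfolding char_minor_def by (rule det_non_zero_imp_unit[OF minor_mat_carrier])
  then obtain B where B: "B \<in> carrier_mat N N" "?A * B = 1\<^sub>m N"
    by (auto simp: Units_def ring_mat_def)
  define v where "v = B *\<^sub>v unit_vec N k"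
  have v: "v \<in> carrier_vec N" using B by (simp add: v_def)
  have Av: "?A *\<^sub>v v = unit_vec N k"
    unfolding v_def using B by (subst assoc_mult_mat_vec[symmetric, of _ N N _ N]) auto
  have 1: "z i * v $ i - mat_app T M (($) v) i = (if i = k then 1 else 0)" if "i \<in> T" for i
    using minor_mat_mult_vec[OF T _ v, of i M z] that T kN unfolding Av by auto
  have 2: "Determinant.det (replace_col ?A (unit_vec N k) k) = v $ k * char_minor N M T z"
    using cramer_lemma_mat[OF minor_mat_carrier[of N M T z] v kN] unfolding Av char_minor_def .
  let ?C = "replace_col ?A (unit_vec N k) k"
  have C: "?C \<in> carrier_mat N N" by (auto simp: replace_col_def minor_mat_def)
  have Cij: "?C $$ (i, j) = (if j = k then (if i = k then 1 else 0) else ?A $$ (i, j))" if "i < N" "j < N" for i j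
    using that kN by (auto simp: replace_col_def minor_mat_def)
  have fin: "finite {p. p permutes {0..<N}}" by (simp add: finite_permutations)
  have "Determinant.det ?C = (\<Sum>p | p permutes {0..<N}. of_int (sign p) * (\<Prod>i = 0..<N. ?C $$ (i, p i)))"
    by (rule det_def'[OF C])
  also have "\<dots> = (\<Sum>p | p permutes {0..<N} \<and> p k = k. of_int (sign p) * (\<Prod>i = 0..<N. ?C $$ (i, p i)))"
  proof (rule sum.mono_neutral_right[OF fin], force, safe)
    fix p assume p: "p permutes {0..<N}" and nz: "of_int (sign p) * (\<Prod>i = 0..<N. ?C $$ (i, p i)) \<noteq> 0"
    have "k \<in> p ` {0..<N}" using permutes_image[OF p] kN by simp
    then obtain i where i: "i < N" "p i = k" by auto
    have "?C $$ (i, p i) \<noteq> 0" using nz i by auto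
    then show "p k = k" using i kN by (auto simp: Cij split: if_splits)
  qed
  also have "\<dots> = (\<Sum>p | p permutes {0..<N} \<and> p k = k.
     of_int (sign p) * (\<Prod>i\<in>{0..<N} - {k}. ?A $$ (i, p i)))"
  proof (rule sum.cong[OF refl])
    fix p assume "p \<in> {p. p permutes {0..<N} \<and> p k = k}"
    then have p: "p permutes {0..<N}" "p k = k" by auto
    have "(\<Prod>i = 0..<N. ?C $$ (i, p i)) = ?C $$ (k, p k) * (\<Prod>i\<in>{0..<N} - {k}. ?C $$ (i, p i))"
      using kN by (intro prod.remove) auto
    also have "?C $$ (k, p k) = 1" using kN p by (simp add: Cij)
    also have "(\<Prod>i\<in>{0..<N} - {k}. ?C $$ (i, p i)) = (\<Prod>i\<in>{0..<N} - {k}. ?A $$ (i, p i))"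
      by (rule permutes_fix_prod[OF p(1) kN p(2), of "\<lambda>i j. ?C $$ (i, j)" "\<lambda>i j. ?A $$ (i, j)"]) (simp add: Cij)
    finally show "of_int (sign p) * (\<Prod>i = 0..<N. ?C $$ (i, p i)) =
      of_int (sign p) * (\<Prod>i\<in>{0..<N} - {k}. ?A $$ (i, p i))" by simp
  qed
  also have "\<dots> = char_minor N M (T - {k}) z" using char_minor_remove[OF k kN] by simp
  finally have 3: "char_minor N M (T - {k}) z = v $ k * char_minor N M T z" using 2 by simp
  show ?thesis by (rule that[OF 1 3])
qed

lemma herm_on_subset: "herm_on S M \<Longrightarrow> T \<subseteq> S \<Longrightarrow> herm_on T M"
  by (auto simp: herm_on_def)

lemma quad_form_restrict:
  assumes "finite S" "T \<subseteq> S"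
  shows "quad_form T M c = quad_form S M (\<lambda>i. if i \<in> T then c i else 0)"
    "sq_norm T c = sq_norm S (\<lambda>i. if i \<in> T then c i else 0)"
proof -
  have *: "mat_app S M (\<lambda>i. if i \<in> T then c i else 0) j = mat_app T M c j" for j
    unfolding mat_app_def using assms by (intro sum.mono_neutral_cong_right) auto
  show "quad_form T M c = quad_form S M (\<lambda>i. if i \<in> T then c i else 0)"
    unfolding quad_form_def sesq_def * using assms
    by (intro arg_cong[where f = Re] sum.mono_neutral_cong_left) auto
  show "sq_norm T c = sq_norm S (\<lambda>i. if i \<in> T then c i else 0)"
    unfolding sq_norm_def using assms by (intro sum.mono_neutral_cong_left) auto
qed

text \<open>A kernel vector of diag z - M, paired with itself, gives a weighted sum of the
  \<open>z i\<close> on one side and the real number <c, M c> on the other; real and imaginary parts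
  are compared separately.\<close>

lemma char_minor_zero_form:
  assumes T: "T \<subseteq> {..<N}" and h: "herm_on T M" and 0: "char_minor N M T z = 0"
  obtains c where "\<exists>i\<in>T. c i \<noteq> 0"
    "(\<Sum>i\<in>T. Re (z i) * (cmod (c i))\<^sup>2) = quad_form T M c"
    "(\<Sum>i\<in>T. Im (z i) * (cmod (c i))\<^sup>2) = 0"
proof -
  obtain c where c: "\<exists>i\<in>T. c i \<noteq> 0" "\<And>i. i \<in> T \<Longrightarrow> z i * c i = mat_app T M c i"
    by (rule char_minor_zeroE[OF T 0]) blast
  have "sesq T c (mat_app T M c) = sesq T (mat_app T M c) c"
    by (rule herm_mat_app[OF h])
  also have "\<dots> = cnj (sesq T c (mat_app T M c))"
    by (rule sesq_cnj)
  finally have im: "Im (sesq T c (mat_app T M c)) = 0"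
    by (simp add: complex_eq_iff)
  have "sesq T c (mat_app T M c) = (\<Sum>i\<in>T. z i * of_real ((cmod (c i))\<^sup>2))"
    unfolding sesq_def by (intro sum.cong refl)
      (simp add: c(2)[symmetric] complex_norm_square mult_ac del: of_real_power)
  then have eq: "sesq T c (mat_app T M c) = (\<Sum>i\<in>T. z i * of_real ((cmod (c i))\<^sup>2))" .
  show ?thesis
    by (rule that[OF c(1)]) (use arg_cong[OF eq, of Re] arg_cong[OF eq, of Im] im in \<open>simp_all add: quad_form_def\<close>)
qed

text \<open>A nontrivial weighted sum of positive imaginary parts is not 0. This stability is the
  source of all real-rootedness of the line polynomials.\<close>

lemma char_minor_upper_half:
  assumes T: "T \<subseteq> {..<N}" and h: "herm_on T M" and z: "\<And>i. i \<in> T \<Longrightarrow> Im (z i) > 0"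
  shows "char_minor N M T z \<noteq> 0"
proof
  assume "char_minor N M T z = 0"
  then obtain c where c: "\<exists>i\<in>T. c i \<noteq> 0" "(\<Sum>i\<in>T. Im (z i) * (cmod (c i))\<^sup>2) = 0"
    by (rule char_minor_zero_form[OF T h])
  then obtain i where i: "i \<in> T" "c i \<noteq> 0" by blast
  have "finite T" using T finite_subset by blast
  then have "(\<Sum>i\<in>T. Im (z i) * (cmod (c i))\<^sup>2) > 0"
    using i z by (intro sum_pos2[of _ i]) (auto simp: zero_le_mult_iff less_imp_le)
  with c show False by simp
qed

section \<open>Positivity and ratios of minors for matrices between 0 and 1\<close>

locale contraction =
  fixes N :: nat and M :: "nat \<Rightarrow> nat \<Rightarrow> complex"
  assumes herm: "herm_on {..<N} M"
    and psd: "0 \<le> quad_form {..<N} M c"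
    and le1: "quad_form {..<N} M c \<le> sq_norm {..<N} c"
begin

lemma sub:
  assumes "T \<subseteq> {..<N}"
  shows "finite T" "herm_on T M" "0 \<le> quad_form T M c" "quad_form T M c \<le> sq_norm T c"
  using assms herm finite_subset herm_on_subset psd le1
  by (auto simp: quad_form_restrict[OF _ assms])

lemma char_minor_nonzero:
  assumes T: "T \<subseteq> {..<N}" and z: "\<And>i. i \<in> T \<Longrightarrow> \<xi> i > 1"
  shows "char_minor N M T (\<lambda>i. of_real (\<xi> i)) \<noteq> 0"
proof
  assume "char_minor N M T (\<lambda>i. of_real (\<xi> i)) = 0"
  then obtain c where c: "\<exists>i\<in>T. c i \<noteq> 0"
    "(\<Sum>i\<in>T. Re (of_real (\<xi> i)) * (cmod (c i))\<^sup>2) = quad_form T M c"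
    by (rule char_minor_zero_form[OF T sub(2)[OF T]])
  then obtain i where i: "i \<in> T" "c i \<noteq> 0" by blast
  have "(\<Sum>i\<in>T. (\<xi> i - 1) * (cmod (c i))\<^sup>2) > 0"
    using i z sub(1)[OF T] by (intro sum_pos2[of _ i]) (auto simp: zero_le_mult_iff less_imp_le)
  then show False using c(2) sub(4)[OF T, of c]
    by (simp add: sq_norm_def algebra_simps sum_subtractf)
qed

text \<open>The minor is affine in \<open>\<xi> k\<close>, with a slope that is positive by
  induction. A value <= 0 would become 0 after increasing \<open>\<xi> k\<close>, against
  \<open>char_minor_nonzero\<close>.\<close>

lemma char_minor_pos:
  assumes "T \<subseteq> {..<N}" and "\<And>i. i \<in> T \<Longrightarrow> \<xi> i > 1"
  shows "Re (char_minor N M T (\<lambda>i. of_real (\<xi> i))) > 0"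
  using sub(1)[OF assms(1)] assms
proof (induction T arbitrary: \<xi> rule: finite_induct)
  case empty
  then show ?case by (simp add: char_minor_empty)
next
  case (insert k T)
  let ?T = "insert k T"
  have T: "?T \<subseteq> {..<N}" and "T \<subseteq> {..<N}" using insert by auto
  then have k: "k \<in> ?T" "k < N" and Tk: "?T - {k} = T" using insert by auto
  let ?a = "Re (char_minor N M ?T (\<lambda>i. of_real (\<xi> i)))"
  let ?b = "Re (char_minor N M T (\<lambda>i. of_real (\<xi> i)))"
  have b: "?b > 0" using insert \<open>T \<subseteq> {..<N}\<close> by auto
  show ?case
  proof (rule ccontr)
    assume "\<not> ?a > 0"
    define \<tau> where "\<tau> = - ?a / ?b"
    have "\<tau> \<ge> 0" unfolding \<tau>_def using b \<open>\<not> ?a > 0\<close> by (intro divide_nonneg_pos) linarith+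
    have upd: "(\<lambda>i. of_real ((\<xi>(k := \<xi> k + \<tau>)) i)) = (\<lambda>i. complex_of_real (\<xi> i))(k := (\<lambda>i. complex_of_real (\<xi> i)) k + of_real \<tau>)"
      by auto
    have "char_minor N M ?T (\<lambda>i. of_real ((\<xi>(k := \<xi> k + \<tau>)) i)) =
      char_minor N M ?T (\<lambda>i. of_real (\<xi> i)) + of_real \<tau> * char_minor N M T (\<lambda>i. of_real (\<xi> i))"
      unfolding upd by (subst char_minor_affine[OF k]) (simp add: Tk)
    moreover have "char_minor N M ?T (\<lambda>i. of_real (\<xi> i)) = of_real ?a"
      by (rule of_real_Re[symmetric, OF char_minor_real[OF sub(2)[OF T] T]]) auto
    moreover have "char_minor N M T (\<lambda>i. of_real (\<xi> i)) = of_real ?b"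
      by (rule of_real_Re[symmetric, OF char_minor_real[OF sub(2) \<open>T \<subseteq> {..<N}\<close>]]) (use \<open>T \<subseteq> {..<N}\<close> in auto)
    ultimately have "char_minor N M ?T (\<lambda>i. of_real ((\<xi>(k := \<xi> k + \<tau>)) i)) = of_real (?a + \<tau> * ?b)"
      by simp
    also have "?a + \<tau> * ?b = 0" using b by (simp add: \<tau>_def)
    finally have "char_minor N M ?T (\<lambda>i. of_real ((\<xi>(k := \<xi> k + \<tau>)) i)) = 0" by simp
    moreover have "\<And>i. i \<in> ?T \<Longrightarrow> (\<xi>(k := \<xi> k + \<tau>)) i > 1"
      using insert.prems(2) \<open>\<tau> \<ge> 0\<close> by (auto simp: add_pos_nonneg intro: less_le_trans[of 1 "\<xi> k"])
    ultimately show False using char_minor_nonzero[OF T] by blast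
  qed
qed

text \<open>The quotient of the minors is a resolvent entry; \<open>resolvent_antimono\<close> moves
  it from \<open>\<xi>\<close> to the constant diagonal \<open>x\<close>, where
  \<open>psd_resolvent_bound\<close> applies. This supplies the initial value of the
  barrier.\<close>

lemma char_minor_ratio:
  assumes T: "T \<subseteq> {..<N}" and k: "k \<in> T" and x: "x > 1" and \<xi>: "\<And>i. i \<in> T \<Longrightarrow> \<xi> i \<ge> x"
  shows "x * (x - 1) * Re (char_minor N M (T - {k}) (\<lambda>i. of_real (\<xi> i))) \<le>
    (x - 1 + Re (M k k)) * Re (char_minor N M T (\<lambda>i. of_real (\<xi> i)))"
proof -
  have nz: "char_minor N M T (\<lambda>i. of_real (\<xi> i)) \<noteq> 0" "char_minor N M T (\<lambda>i. of_real x) \<noteq> 0"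
    by (rule char_minor_nonzero[OF T]; use x \<xi> in force)+
  obtain y' where y': "\<And>i. i \<in> T \<Longrightarrow> of_real (\<xi> i) * y' i - mat_app T M y' i = (if i = k then 1 else 0)"
    "char_minor N M (T - {k}) (\<lambda>i. of_real (\<xi> i)) = y' k * char_minor N M T (\<lambda>i. of_real (\<xi> i))"
    using char_minor_nonzero_solve[OF T nz(1) k] by metis
  obtain y where y: "\<And>i. i \<in> T \<Longrightarrow> of_real x * y i - mat_app T M y i = (if i = k then 1 else 0)"
    using char_minor_nonzero_solve[OF T nz(2) k] by metis
  have 1: "x * (x - 1) * Re (y k) \<le> x - 1 + Re (M k k)"
    by (rule psd_resolvent_bound[OF sub(1)[OF T] k sub(2,3,4)[OF T] x y])
  have 2: "Re (y' k) \<le> Re (y k)"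
    by (rule resolvent_antimono[OF sub(1)[OF T] k sub(2,4)[OF T] _ y y'(1) \<xi>]) (use x in auto)
  have re: "char_minor N M T (\<lambda>i. of_real (\<xi> i)) = of_real (Re (char_minor N M T (\<lambda>i. of_real (\<xi> i))))"
    by (rule of_real_Re[symmetric, OF char_minor_real[OF sub(2)[OF T] T]]) auto
  have 3: "Re (char_minor N M (T - {k}) (\<lambda>i. of_real (\<xi> i))) = Re (y' k) * Re (char_minor N M T (\<lambda>i. of_real (\<xi> i)))"
    unfolding y'(2) by (subst re) simp
  have pos: "Re (char_minor N M T (\<lambda>i. of_real (\<xi> i))) > 0"
    by (rule char_minor_pos[OF T]) (use x \<xi> in force)
  have "x * (x - 1) * Re (y' k) \<le> x * (x - 1) * Re (y k)"
    using 2 x by (intro mult_left_mono) auto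
  then have "x * (x - 1) * Re (y' k) \<le> x - 1 + Re (M k k)" using 1 by simp
  then show ?thesis unfolding 3 mult.assoc[symmetric]
    using pos by (intro mult_right_mono) auto
qed

lemma sesq_cauchy_schwarz: "(cmod (sesq S u v))\<^sup>2 \<le> sq_norm S u * sq_norm S v"
proof -
  have "cmod (sesq S u v) \<le> (\<Sum>i\<in>S. cmod (u i) * cmod (v i))"
    unfolding sesq_def by (rule order.trans[OF norm_sum]) (simp add: norm_mult)
  then have "(cmod (sesq S u v))\<^sup>2 \<le> (\<Sum>i\<in>S. cmod (u i) * cmod (v i))\<^sup>2"
    by (intro power_mono) auto
  also have "\<dots> \<le> sq_norm S u * sq_norm S v"
    unfolding sq_norm_def by (rule Cauchy_Schwarz_ineq_sum)
  finally show ?thesis .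
qed

text \<open>The optimal constant \<open>l\<close> stands in for the largest eigenvalue. If it
  exceeded \<open>\<rho>\<close>, then l - M would be positive semidefinite and invertible, hence
  bounded below, and \<open>l\<close> could be lowered.\<close>

lemma quad_form_le_of_char_minor:
  assumes T: "T \<subseteq> {..<N}" and \<rho>: "\<rho> \<ge> 0"
    and nz: "\<And>x. x > \<rho> \<Longrightarrow> char_minor N M T (\<lambda>i. of_real x) \<noteq> 0"
  shows "quad_form T M c \<le> \<rho> * sq_norm T c"
proof (rule ccontr)
  assume neg: "\<not> quad_form T M c \<le> \<rho> * sq_norm T c"
  note s = sub[OF T]
  define R where "R = {l. \<forall>c. quad_form T M c \<le> l * sq_norm T c}"
  define l where "l = Inf R"
  have R1: "1 \<in> R" using s(4) by (simp add: R_def)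
  have Rge: "r \<ge> \<rho>" if "r \<in> R" for r
  proof (rule ccontr)
    assume "\<not> r \<ge> \<rho>"
    then have "r * sq_norm T c \<le> \<rho> * sq_norm T c" using sq_norm_nonneg by (intro mult_right_mono) auto
    moreover have "quad_form T M c \<le> r * sq_norm T c" using that by (simp add: R_def)
    ultimately show False using neg by linarith
  qed
  have bdd: "bdd_below R" using Rge by (intro bdd_belowI[of _ \<rho>])
  have lR: "l \<in> R" unfolding R_def
  proof safe
    fix c
    show "quad_form T M c \<le> l * sq_norm T c"
    proof (rule field_le_epsilon)
      fix e :: real assume e: "e > 0"
      have "l < l + e / (sq_norm T c + 1)" using e sq_norm_nonneg[of T c] by (simp add: add_nonneg_pos)
      then obtain r where r: "r \<in> R" "r < l + e / (sq_norm T c + 1)"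
        unfolding l_def using cInf_lessD[of R] R1 by blast
      have "quad_form T M c \<le> r * sq_norm T c" using r by (simp add: R_def)
      also have "\<dots> \<le> (l + e / (sq_norm T c + 1)) * sq_norm T c"
        using r sq_norm_nonneg by (intro mult_right_mono) auto
      also have "\<dots> = l * sq_norm T c + e * (sq_norm T c / (sq_norm T c + 1))" by (simp add: algebra_simps)
      also have "\<dots> \<le> l * sq_norm T c + e * 1"
        using e sq_norm_nonneg[of T c] by (intro add_left_mono mult_left_mono) auto
      finally show "quad_form T M c \<le> l * sq_norm T c + e" by simp
    qed
  qed
  have "l \<ge> \<rho>" using Rge lR by blast
  moreover have "l \<noteq> \<rho>" using neg lR by (auto simp: R_def)
  ultimately have l\<rho>: "l > \<rho>" by simp
  then have l0: "l > 0" using \<rho> by simp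
  define A where "A = (\<lambda>i j. (if i = j then of_real l else 0) - M i j)"
  have app: "mat_app T A c i = of_real l * c i - mat_app T M c i" if "i \<in> T" for c i
    using that s(1) by (simp add: mat_app_def A_def left_diff_distrib sum_subtractf if_distrib[of "\<lambda>x. x * _"] cong: if_cong)
  have qA: "quad_form T A c = l * sq_norm T c - quad_form T M c" for c
  proof -
    have "sesq T c (mat_app T A c) = of_real l * sesq T c c - sesq T c (mat_app T M c)"
      by (simp add: sesq_def app right_diff_distrib sum_subtractf sum_distrib_left mult_ac)
    then show ?thesis by (simp add: quad_form_def sq_norm_eq_sesq)
  qed
  have hA: "herm_on T A" unfolding herm_on_def
  proof safe
    fix i j assume "i \<in> T" "j \<in> T"
    then have "M j i = cnj (M i j)" using s(2) unfolding herm_on_def by blast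
    then show "A j i = cnj (A i j)" by (simp add: A_def)
  qed
  have Abound: "sq_norm T (mat_app T A c) \<le> l * quad_form T A c" for c
    by (rule psd_app_bound[OF hA _ _ l0]) (use lR s(3) in \<open>auto simp: qA R_def\<close>)
  have "\<exists>y. \<forall>i\<in>T. mat_app T A y i = (if i = k then 1 else 0)" if k: "k \<in> T" for k
    using char_minor_nonzero_solve[OF T nz[OF l\<rho>] k] by (metis app)
  then obtain Y where Y: "\<And>k i. k \<in> T \<Longrightarrow> i \<in> T \<Longrightarrow> mat_app T A (Y k) i = (if i = k then 1 else 0)"
    by metis
  \<comment> \<open>The \<open>Y k\<close> are the columns of the inverse of \<open>A\<close>, so
    the sum is its squared Frobenius norm; the summand 1 makes \<open>C\<close> positive.\<close>
  define C where "C = (\<Sum>k\<in>T. sq_norm T (Y k)) + 1"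
  have C: "C > 0" unfolding C_def by (intro add_nonneg_pos sum_nonneg sq_norm_nonneg) simp
  have "sq_norm T c \<le> C * sq_norm T (mat_app T A c)" for c
  proof -
    have "(cmod (c k))\<^sup>2 \<le> sq_norm T (Y k) * sq_norm T (mat_app T A c)" if k: "k \<in> T" for k
    proof -
      have "sesq T (Y k) (mat_app T A c) = sesq T (mat_app T A (Y k)) c"
        by (rule herm_mat_app[OF hA])
      also have "\<dots> = (\<Sum>i\<in>T. if i = k then c i else 0)"
        unfolding sesq_def by (intro sum.cong refl) (simp add: Y k)
      also have "\<dots> = c k" using s(1) k by simp
      finally show ?thesis using sesq_cauchy_schwarz by metis
    qed
    then have "sq_norm T c \<le> (\<Sum>k\<in>T. sq_norm T (Y k) * sq_norm T (mat_app T A c))"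
      unfolding sq_norm_def[of T c] by (intro sum_mono) auto
    also have "\<dots> = (C - 1) * sq_norm T (mat_app T A c)" by (simp add: C_def sum_distrib_right)
    also have "\<dots> \<le> C * sq_norm T (mat_app T A c)" by (intro mult_right_mono sq_norm_nonneg) simp
    finally show ?thesis .
  qed
  then have *: "sq_norm T c \<le> C * (l * (l * sq_norm T c - quad_form T M c))" for c
    using Abound[of c] C mult_left_mono[of "sq_norm T (mat_app T A c)" "l * quad_form T A c" C]
    unfolding qA by (meson less_imp_le order.trans)
  \<comment> \<open>From |c|^2 <= C |A c|^2 <= C l <c, A c>, the form of \<open>A\<close> is at
    least \<open>1 / (C * l)\<close> times the squared norm, so this amount can be taken off
    \<open>l\<close>.\<close>
  have "l - 1 / (C * l) \<in> R" unfolding R_def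
  proof safe
    fix c
    have "(C * l) * (quad_form T M c) \<le> (C * l) * ((l - 1 / (C * l)) * sq_norm T c)"
    proof -
      have "(C * l) * ((l - 1 / (C * l)) * sq_norm T c) = C * (l * (l * sq_norm T c)) - (C * l) * (1 / (C * l)) * sq_norm T c"
        by (simp add: algebra_simps)
      also have "(C * l) * (1 / (C * l)) = 1" using C l0 by simp
      finally show ?thesis using *[of c] by (simp add: algebra_simps)
    qed
    then show "quad_form T M c \<le> (l - 1 / (C * l)) * sq_norm T c"
      using C l0 by (meson mult_le_cancel_left_pos mult_pos_pos)
  qed
  then have "l \<le> l - 1 / (C * l)" unfolding l_def using bdd by (simp add: cInf_lower)
  then show False using C l0 by (simp add: field_simps)
qed

end

section \<open>Barriers and interlacing for real-rooted polynomials\<close>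

text \<open>With S1 = p'/p, whose derivative is - S2, the second formula is p''/p = S1^2 -
  S2.\<close>

lemma poly_pderiv_log_aux:
  fixes A :: "'a::field multiset"
  assumes "t \<notin># A"
  shows "poly (pderiv (\<Prod>x\<in>#A. [:-x, 1:])) t = poly (\<Prod>x\<in>#A. [:-x, 1:]) t * (\<Sum>x\<in>#A. 1 / (t - x)) \<and>
    poly (pderiv (pderiv (\<Prod>x\<in>#A. [:-x, 1:]))) t =
      poly (\<Prod>x\<in>#A. [:-x, 1:]) t * ((\<Sum>x\<in>#A. 1 / (t - x))\<^sup>2 - (\<Sum>x\<in>#A. (1 / (t - x))\<^sup>2))"
  using assms
proof (induction A)
  case (add a A)
  define q where "q = (\<Prod>x\<in>#A. [:-x, 1:])"
  define S1 where "S1 = (\<Sum>x\<in>#A. 1 / (t - x))"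
  define S2 where "S2 = (\<Sum>x\<in>#A. (1 / (t - x))\<^sup>2)"
  have nz: "t - a \<noteq> 0" using add.prems by auto
  have IH: "poly (pderiv q) t = poly q t * S1" "poly (pderiv (pderiv q)) t = poly q t * (S1\<^sup>2 - S2)"
    using add by (auto simp: q_def S1_def S2_def)
  have p': "pderiv ([:-a, 1:] * q) = [:-a, 1:] * pderiv q + q"
    by (simp add: pderiv_mult pderiv_pCons del: mult_pCons_left)
  have p'': "pderiv (pderiv ([:-a, 1:] * q)) = [:-a, 1:] * pderiv (pderiv q) + pderiv q + pderiv q"
    unfolding p' by (simp add: pderiv_mult pderiv_pCons pderiv_add del: mult_pCons_left)
  have "poly (pderiv ([:-a, 1:] * q)) t = (t - a) * (poly q t * S1) + poly q t"
    unfolding p' by (simp add: IH algebra_simps)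
  moreover have "\<dots> = (t - a) * poly q t * (1 / (t - a) + S1)"
    using nz by (simp add: field_simps)
  moreover have "poly (pderiv (pderiv ([:-a, 1:] * q))) t = (t - a) * (poly q t * (S1\<^sup>2 - S2)) + poly q t * S1 + poly q t * S1"
    unfolding p'' by (simp add: IH algebra_simps)
  moreover have "\<dots> = (t - a) * poly q t * ((1 / (t - a) + S1)\<^sup>2 - ((1 / (t - a))\<^sup>2 + S2))"
  proof -
    have "h * Q * ((w + S1)\<^sup>2 - (w\<^sup>2 + S2)) = h * (Q * (S1\<^sup>2 - S2)) + (h * w) * (Q * S1) + (h * w) * (Q * S1)" for h w Q
      by (simp add: power2_eq_square algebra_simps)
    from this[of "t - a" "poly q t" "1 / (t - a)"] show ?thesis using nz by simp
  qed
  ultimately show ?case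
    by (simp add: q_def[symmetric] S1_def[symmetric] S2_def[symmetric] left_diff_distrib del: mult_pCons_left)
qed simp

lemmas poly_pderiv_log = poly_pderiv_log_aux[THEN conjunct1] poly_pderiv_log_aux[THEN conjunct2]

lemma poly_prod_linear_eq_0_iff:
  fixes A :: "'a::idom multiset"
  shows "poly (\<Prod>x\<in>#A. [:-x, 1:]) t = 0 \<longleftrightarrow> t \<in># A"
  by (induction A) auto

lemma sum_mset_pos:
  fixes f :: "'a \<Rightarrow> real"
  assumes "A \<noteq> {#}" "\<And>x. x \<in># A \<Longrightarrow> f x > 0"
  shows "(\<Sum>x\<in>#A. f x) > 0"
  using assms
proof (induction A)
  case (add a A)
  then show ?case by (cases "A = {#}") (auto simp: add_pos_pos)
qed simp

lemma Im_sum_mset: "Im (\<Sum>x\<in>#A. f x) = (\<Sum>x\<in>#A. Im (f x))"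
  by (induction A) auto

text \<open>All roots x satisfy Im x <= a, so for Im t > a every 1 / (t - x) has negative imaginary
  part and the logarithmic derivative cannot vanish.\<close>

lemma gauss_lucas_half_plane:
  fixes p :: "complex poly"
  assumes deg: "degree p > 0" and nz: "\<And>t. Im t > a \<Longrightarrow> poly p t \<noteq> 0" and t: "Im t > a"
  shows "poly (pderiv p) t \<noteq> 0"
proof -
  have "p \<noteq> 0" using deg by auto
  then obtain A where A: "size A = degree p" "p = smult (lead_coeff p) (\<Prod>x\<in>#A. [:-x, 1:])"
    using alg_closed_imp_factorization by blast
  have root: "Im x \<le> a" if "x \<in># A" for x
  proof (rule ccontr)
    assume "\<not> Im x \<le> a"
    with nz[of x] show False using A(2) that
      by (metis linorder_not_le mult_zero_right poly_prod_linear_eq_0_iff poly_smult)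
  qed
  then have "t \<notin># A" using t by force
  have "poly (pderiv p) t = lead_coeff p * (poly (\<Prod>x\<in>#A. [:-x, 1:]) t * (\<Sum>x\<in>#A. 1 / (t - x)))"
    by (subst A(2)) (simp add: pderiv_smult poly_pderiv_log(1)[OF \<open>t \<notin># A\<close>])
  moreover have "Im (\<Sum>x\<in>#A. 1 / (t - x)) \<noteq> 0"
  proof -
    have "(\<Sum>x\<in>#A. - Im (1 / (t - x))) > 0"
    proof (rule sum_mset_pos)
      show "A \<noteq> {#}" using A(1) deg by auto
      fix x assume "x \<in># A"
      then have *: "Im (t - x) > 0" using root t by force
      then have "cmod (t - x) > 0" by auto
      then show "- Im (1 / (t - x)) > 0" using *
        by (auto simp: Im_divide intro!: divide_neg_pos add_nonneg_pos)
    qed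
    also have "(\<Sum>x\<in>#A. - Im (1 / (t - x))) = - (\<Sum>x\<in>#A. Im (1 / (t - x)))"
      by (induction A) auto
    finally show ?thesis by (simp add: Im_sum_mset)
  qed
  moreover have "poly (\<Prod>x\<in>#A. [:-x, 1:]) t \<noteq> 0" using \<open>t \<notin># A\<close> poly_prod_linear_eq_0_iff by blast
  moreover have "lead_coeff p \<noteq> 0" using \<open>p \<noteq> 0\<close> by simp
  ultimately show ?thesis by (metis mult_eq_0_iff zero_complex.sel(2))
qed

section \<open>Real-rooted polynomials and the barrier condition\<close>

abbreviation cpoly :: "real poly \<Rightarrow> complex poly" where
  "cpoly \<equiv> map_poly complex_of_real"

lemma cpoly_mult: "cpoly (p * q) = cpoly p * cpoly q"
  by (rule poly_eqI) (simp add: coeff_map_poly coeff_mult)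

lemma cpoly_pderiv: "cpoly (pderiv p) = pderiv (cpoly p)"
  by (rule poly_eqI) (simp add: coeff_map_poly coeff_pderiv)

lemma cpoly_degree [simp]: "degree (cpoly p) = degree p"
  by (rule degree_map_poly) simp

lemma poly_cpoly_of_real [simp]: "poly (cpoly p) (of_real x) = of_real (poly p x)"
  by (induction p) (simp_all add: map_poly_pCons)

lemma cpoly_linear: "cpoly [:-x, 1:] = [:- of_real x, 1:]"
  by (simp add: map_poly_pCons)

lemma poly_cpoly_cnj: "poly (cpoly p) (cnj t) = cnj (poly (cpoly p) t)"
  by (induction p) (simp_all add: map_poly_pCons)

text \<open>Real coefficients make the roots symmetric under conjugation, so the upper half plane
  suffices. The zero polynomial is excluded.\<close>

definition real_rooted :: "real poly \<Rightarrow> bool" where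
  "real_rooted p \<longleftrightarrow> (\<forall>t. Im t > 0 \<longrightarrow> poly (cpoly p) t \<noteq> 0)"

lemma real_rooted_nonzero: "real_rooted p \<Longrightarrow> p \<noteq> 0"
  unfolding real_rooted_def by (auto dest: spec[of _ \<i>])

lemma real_rooted_pderiv: "real_rooted p \<Longrightarrow> degree p > 0 \<Longrightarrow> real_rooted (pderiv p)"
  unfolding real_rooted_def cpoly_pderiv
  using gauss_lucas_half_plane[of "cpoly p" 0] by simp

lemma real_rooted_factor: "real_rooted (p * q) \<Longrightarrow> real_rooted q"
  by (auto simp: real_rooted_def cpoly_mult)

lemma real_rooted_has_root:
  assumes "real_rooted p" "degree p > 0"
  obtains x where "poly p x = 0"
proof -
  obtain t where t: "poly (cpoly p) t = 0"
    using alg_closed_imp_poly_has_root[of "cpoly p"] assms(2) by auto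
  have "poly (cpoly p) (cnj t) = 0" using t by (simp add: poly_cpoly_cnj)
  then have "\<not> Im (cnj t) > 0" "\<not> Im t > 0"
    using assms(1) t unfolding real_rooted_def by blast+
  then have "Im t = 0" by simp
  then have "t = of_real (Re t)" by (simp add: complex_eq_iff)
  with t that[of "Re t"] show ?thesis by (metis of_real_eq_0_iff poly_cpoly_of_real)
qed

lemma real_rooted_factorization:
  assumes "real_rooted p"
  obtains A where "size A = degree p" "p = smult (lead_coeff p) (\<Prod>x\<in>#A. [:-x, 1:])"
  using assms
proof (induction "degree p" arbitrary: p thesis)
  case 0
  then show ?case using degree_0_id[of p] by (force intro!: 0(2)[of "{#}"])
next
  case (Suc n)
  obtain x where "poly p x = 0" using real_rooted_has_root Suc.prems Suc.hyps by (metis zero_less_Suc)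
  then obtain q where q: "p = [:-x, 1:] * q" by (metis dvdE poly_eq_0_iff_dvd)
  have q0: "q \<noteq> 0" using q real_rooted_nonzero[OF Suc.prems(2)] by auto
  have "degree p = degree [:-x, 1:] + degree q"
    unfolding q by (rule degree_mult_eq) (use q0 in auto)
  then have "n = degree q" using Suc.hyps(2) by simp
  moreover have "real_rooted q" using Suc.prems(2) real_rooted_factor unfolding q by blast
  ultimately obtain A where A: "size A = degree q" "q = smult (lead_coeff q) (\<Prod>x\<in>#A. [:-x, 1:])"
    using Suc.hyps(1) by metis
  have "lead_coeff p = lead_coeff [:-x, 1:] * lead_coeff q" unfolding q by (rule lead_coeff_mult)
  then have lc: "lead_coeff p = lead_coeff q" by simp
  show ?case
  proof (rule Suc.prems(1)[of "add_mset x A"])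
    show "size (add_mset x A) = degree p" using A \<open>n = degree q\<close> Suc.hyps by simp
    show "p = smult (lead_coeff p) (\<Prod>x\<in>#add_mset x A. [:-x, 1:])"
      unfolding lc by (subst q, subst A(2)) simp
  qed
qed

text \<open>The upper barrier function p'/p, that is the sum of 1 / (x - l) over the roots l, is at
  most \<open>\<phi>\<close> at a point \<open>x\<close> above all roots.\<close>

definition barrier :: "real \<Rightarrow> real poly \<Rightarrow> real \<Rightarrow> bool" where
  "barrier \<phi> p x \<longleftrightarrow> real_rooted p \<and> lead_coeff p > 0 \<and> (\<forall>t\<ge>x. poly p t > 0) \<and>
     poly (pderiv p) x \<le> \<phi> * poly p x"

text \<open>With y = x - 1 / \<phi> and a = 1 / (y - l) one has 1 / (x - l) = a / (1 + a / \<phi>).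
  Let S1, S2 be the sums of a and a^2 over the roots. Cauchy-Schwarz bounds S1^2 / (S1 + S2 /
  \<phi>) by the sum of these terms, hence by \<phi>. This is S1^2 - S2 <= \<phi> S1, the barrier
  condition of p' at y. The weight \<open>k = \<phi> / S1\<close> in the proof is optimal in the
  case of equality.\<close>

lemma barrier_pderiv:
  assumes bar: "barrier \<phi> p x" and \<phi>: "\<phi> > 0" and deg: "degree p > 0"
  shows "barrier \<phi> (pderiv p) (x - 1 / \<phi>)"
proof -
  have rr: "real_rooted p" and lc: "lead_coeff p > 0" and pos: "\<And>t. t \<ge> x \<Longrightarrow> poly p t > 0"
    and le: "poly (pderiv p) x \<le> \<phi> * poly p x" using bar by (auto simp: barrier_def)
  obtain A where A: "size A = degree p" "p = smult (lead_coeff p) (\<Prod>x\<in>#A. [:-x, 1:])"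
    using real_rooted_factorization[OF rr] by blast
  define c where "c = lead_coeff p"
  define q where "q = (\<Prod>x\<in>#A. [:-x, 1:])"
  have p: "p = smult c q" using A by (simp add: c_def q_def)
  have c: "c > 0" using lc by (simp add: c_def)
  have root: "l < x" if "l \<in># A" for l
  proof (rule ccontr)
    assume "\<not> l < x"
    then have "poly p l > 0" using pos by simp
    then show False using that poly_prod_linear_eq_0_iff[of A l] by (simp add: p q_def)
  qed
  then have xA: "x \<notin># A" by blast
  have S\<phi>: "(\<Sum>l\<in>#A. 1 / (x - l)) \<le> \<phi>"
  proof -
    define S where "S = (\<Sum>l\<in>#A. 1 / (x - l))"
    have "poly (pderiv q) x = poly q x * S" unfolding q_def S_def by (rule poly_pderiv_log(1)[OF xA])
    then have "c * (poly q x * S) \<le> c * (poly q x * \<phi>)"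
      using le unfolding p by (simp add: pderiv_smult mult_ac)
    moreover have "poly q x > 0" using pos[of x] c by (simp add: p zero_less_mult_iff)
    ultimately show ?thesis using c unfolding S_def[symmetric] by simp
  qed
  have lc': "lead_coeff (pderiv p) > 0"
  proof -
    have "lead_coeff (pderiv p) = of_nat (degree p) * lead_coeff p"
      using deg by (simp add: degree_pderiv coeff_pderiv)
    then show ?thesis using lc deg by simp
  qed
  have rr': "real_rooted (pderiv p)" by (rule real_rooted_pderiv[OF rr deg])
  define y where "y = x - 1 / \<phi>"
  show ?thesis
  \<comment> \<open>For degree 1 the root may equal \<open>y\<close>, where 1 / (y - l) makes no
    sense; but then p' is a positive constant.\<close>
  proof (cases "degree p = 1")
    case True
    then have "degree (pderiv p) = 0" by (simp add: degree_pderiv)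
    then obtain k where k: "pderiv p = [:k:]" by (metis degree_eq_zeroE)
    then have "k > 0" using lc' by simp
    then show ?thesis using rr' lc' \<phi> unfolding barrier_def k by simp
  next
    case False
    then have sz: "size A \<ge> 2" using deg A(1) by linarith
    \<comment> \<open>A second root contributes a positive term, so 1 / (x - l) < \<phi> is strict
      and \<open>l\<close> stays to the left of \<open>y\<close>.\<close>
    have yl: "l < y" if l: "l \<in># A" for l
    proof -
      obtain B where B: "A = add_mset l B" using l by (metis mset_add)
      have "B \<noteq> {#}" using sz B by auto
      then have "(\<Sum>l\<in>#B. 1 / (x - l)) > 0" using root B by (intro sum_mset_pos) auto
      then have "1 / (x - l) < \<phi>" using S\<phi> B by simp
      then show ?thesis using root[OF l] \<phi> by (simp add: y_def field_simps)
    qed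
    have tA: "t \<notin># A" if "t \<ge> y" for t using yl that by force
    have ne: "A \<noteq> {#}" using sz by auto
    have qpos: "poly q t > 0" if "t \<ge> y" for t
    proof -
      have "\<And>l. l \<in># A \<Longrightarrow> t - l > 0" using yl that by force
      then show ?thesis unfolding q_def
      proof (induction A)
        case (add a A)
        then show ?case by (simp add: poly_mult)
      qed simp
    qed
    have pos': "poly (pderiv p) t > 0" if t: "t \<ge> y" for t
    proof -
      have "(\<Sum>l\<in>#A. 1 / (t - l)) > 0" using yl t ne by (intro sum_mset_pos) force+
      then have "c * (poly q t * (\<Sum>l\<in>#A. 1 / (t - l))) > 0" using c qpos[OF t] by (intro mult_pos_pos)
      then show ?thesis
        unfolding p pderiv_smult poly_smult q_def poly_pderiv_log(1)[OF tA[OF t]] .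
    qed
    define S1 where "S1 = (\<Sum>l\<in>#A. 1 / (y - l))"
    define S2 where "S2 = (\<Sum>l\<in>#A. (1 / (y - l))\<^sup>2)"
    have S1: "S1 > 0" unfolding S1_def using yl ne by (intro sum_mset_pos) auto
    define k where "k = \<phi> / S1"
    \<comment> \<open>Weighted AM-GM instead of the Cauchy-Schwarz inequality, so that the estimate can be summed termwise.\<close>
    have "(\<Sum>l\<in>#A. 2 * k * (1 / (y - l)) - k\<^sup>2 * (1 / (y - l)) - k\<^sup>2 / \<phi> * (1 / (y - l))\<^sup>2) \<le> (\<Sum>l\<in>#A. 1 / (x - l))"
    proof (rule sum_mset_mono)
      fix l assume "l \<in># A"
      then have h: "y - l > 0" using yl by simp
      define a where "a = 1 / (y - l)"
      have a: "a > 0" using h by (simp add: a_def)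
      have b: "1 + a / \<phi> > 0" using a \<phi> by (simp add: add_pos_pos)
      have "x - l = 1 / a + 1 / \<phi>" using h by (simp add: a_def y_def)
      also have "\<dots> = (1 + a / \<phi>) / a" using a by (simp add: field_simps)
      finally have xl: "1 / (x - l) = a / (1 + a / \<phi>)" by simp
      have "2 * k - k\<^sup>2 * (1 + a / \<phi>) \<le> 1 / (1 + a / \<phi>)"
      proof -
        have "(2 * k - k\<^sup>2 * u) * u \<le> 1" for u
          using zero_le_power2[of "1 - k * u"] by (simp add: power2_eq_square algebra_simps)
        then show ?thesis using b by (simp add: pos_le_divide_eq)
      qed
      then have "a * (2 * k - k\<^sup>2 * (1 + a / \<phi>)) \<le> a * (1 / (1 + a / \<phi>))"
        using a by (intro mult_left_mono) auto
      then show "2 * k * (1 / (y - l)) - k\<^sup>2 * (1 / (y - l)) - k\<^sup>2 / \<phi> * (1 / (y - l))\<^sup>2 \<le> 1 / (x - l)"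
        unfolding xl a_def[symmetric] by (simp add: power2_eq_square algebra_simps)
    qed
    also have "(\<Sum>l\<in>#A. 2 * k * (1 / (y - l)) - k\<^sup>2 * (1 / (y - l)) - k\<^sup>2 / \<phi> * (1 / (y - l))\<^sup>2)
        = 2 * k * S1 - k\<^sup>2 * S1 - k\<^sup>2 / \<phi> * S2"
      unfolding S1_def S2_def by (induction A) (auto simp: algebra_simps)
    finally have "2 * k * S1 - k\<^sup>2 * S1 - k\<^sup>2 / \<phi> * S2 \<le> \<phi>" using S\<phi> by simp
    moreover have "2 * k * S1 = 2 * \<phi>" "k\<^sup>2 * S1 = \<phi>\<^sup>2 / S1" "k\<^sup>2 / \<phi> * S2 = \<phi> * S2 / S1\<^sup>2"
      using S1 \<phi> by (simp_all add: k_def power2_eq_square)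
    ultimately have "\<phi> \<le> \<phi>\<^sup>2 / S1 + \<phi> * S2 / S1\<^sup>2" by simp
    then have "\<phi> * S1\<^sup>2 \<le> (\<phi>\<^sup>2 / S1 + \<phi> * S2 / S1\<^sup>2) * S1\<^sup>2" using S1 by (intro mult_right_mono) auto
    also have "\<dots> = \<phi> * (\<phi> * S1 + S2)" using S1 by (simp add: power2_eq_square field_simps)
    finally have key: "S1\<^sup>2 - S2 \<le> \<phi> * S1" using \<phi> by simp
    have "poly (pderiv (pderiv p)) y = c * poly q y * (S1\<^sup>2 - S2)"
      using poly_pderiv_log(2)[OF tA[of y], folded q_def S1_def S2_def] by (simp add: p pderiv_smult)
    also have "\<dots> \<le> c * poly q y * (\<phi> * S1)"
      using key c qpos[of y] by (intro mult_left_mono) auto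
    also have "\<dots> = \<phi> * poly (pderiv p) y"
      using poly_pderiv_log(1)[OF tA[of y], folded q_def S1_def] by (simp add: p pderiv_smult)
    finally show ?thesis using rr' lc' pos' by (simp add: barrier_def y_def)
  qed
qed

lemma barrier_higher_pderiv:
  assumes "barrier \<phi> p x" "\<phi> > 0" "n \<le> degree p"
  shows "barrier \<phi> ((pderiv ^^ n) p) (x - n / \<phi>)"
  using assms(3)
proof (induction n)
  case 0
  then show ?case using assms by simp
next
  case (Suc n)
  then have "barrier \<phi> ((pderiv ^^ n) p) (x - n / \<phi>)" by simp
  from barrier_pderiv[OF this assms(2)] Suc.prems show ?case
    by (simp add: degree_higher_pderiv add_divide_distrib algebra_simps)
qed

lemma higher_pderiv_linear_mult:
  fixes q :: "real poly"
  shows "(pderiv ^^ Suc n) ([:-a, 1:] * q) = [:-a, 1:] * (pderiv ^^ Suc n) q + smult (of_nat (Suc n)) ((pderiv ^^ n) q)"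
proof (induction n)
  case 0
  show ?case by (simp add: pderiv_mult pderiv_pCons del: mult_pCons_left)
next
  case (Suc n)
  have "(pderiv ^^ Suc (Suc n)) ([:-a, 1:] * q) = pderiv ((pderiv ^^ Suc n) ([:-a, 1:] * q))" by simp
  also have "\<dots> = [:-a, 1:] * (pderiv ^^ Suc (Suc n)) q + (pderiv ^^ Suc n) q + smult (of_nat (Suc n)) ((pderiv ^^ Suc n) q)"
    unfolding Suc.IH by (simp add: pderiv_add pderiv_mult pderiv_smult pderiv_pCons del: mult_pCons_left)
  also have "\<dots> = [:-a, 1:] * (pderiv ^^ Suc (Suc n)) q + smult (of_nat (Suc (Suc n))) ((pderiv ^^ Suc n) q)"
  proof -
    have "smult (of_nat (Suc (Suc n))) r = r + smult (of_nat (Suc n)) r" for r :: "real poly"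
      by (simp only: of_nat_Suc[of "Suc n"] smult_add_left smult_1_left)
    then show ?thesis by (simp only: add.assoc)
  qed
  finally show ?case .
qed

text \<open>For q = p / (X - l) one has p(0) = - l q(0), and the Leibniz rule reduces the claim to
  (- y) q^(n+1)(y) <= (n + 1) q^(n)(y). The barrier of q^(n), available at - n / \<phi>, even gives
  n on the right. So the shift is n / \<phi> although the derivative has order n + 1.\<close>

lemma barrier_root_quotient:
  assumes bar: "barrier \<phi> p 0" and \<phi>: "\<phi> > 0" and root: "poly p l = 0"
    and n: "n < degree p"
  defines "y \<equiv> - (n / \<phi>)"
  shows "poly ((pderiv ^^ Suc n) (p div [:-l, 1:])) y * poly p 0 \<le> poly (p div [:-l, 1:]) 0 * poly ((pderiv ^^ Suc n) p) y"
proof -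
  have rr: "real_rooted p" and lc: "lead_coeff p > 0" and pos: "\<And>t. t \<ge> 0 \<Longrightarrow> poly p t > 0"
    and le: "poly (pderiv p) 0 \<le> \<phi> * poly p 0" using bar by (auto simp: barrier_def)
  define q where "q = p div [:-l, 1:]"
  have p: "p = [:-l, 1:] * q" using root by (simp only: q_def poly_eq_0_iff_dvd dvd_mult_div_cancel)
  have l: "l < 0" using pos[of l] root by force
  have q0: "q \<noteq> 0" using p real_rooted_nonzero[OF rr] by auto
  have "degree p = degree [:-l, 1:] + degree q"
    unfolding p by (rule degree_mult_eq) (use q0 in auto)
  then have dq: "degree p = Suc (degree q)" by simp
  have qpos: "poly q t > 0" if "t \<ge> 0" for t
  proof -
    have "(t - l) * poly q t > 0" using pos[OF that] unfolding p by (simp add: algebra_simps)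
    then show ?thesis using l that by (simp add: zero_less_mult_iff)
  qed
  \<comment> \<open>Cancelling a negative root removes a positive term from p'/p at 0, so
    \<open>q\<close> inherits the barrier.\<close>
  have "barrier \<phi> q 0" unfolding barrier_def
  proof (intro conjI allI impI)
    show "real_rooted q" using rr real_rooted_factor unfolding p by blast
    have "lead_coeff p = lead_coeff [:-l, 1:] * lead_coeff q" unfolding p by (rule lead_coeff_mult)
    then show "lead_coeff q > 0" using lc by simp
    show "poly q t > 0" if "t \<ge> 0" for t using qpos that .
    have "poly q 0 + (- l) * poly (pderiv q) 0 \<le> \<phi> * ((- l) * poly q 0)"
    proof -
      have "pderiv p = [:-l, 1:] * pderiv q + q"
        unfolding p by (simp add: pderiv_mult pderiv_pCons del: mult_pCons_left)
      then have "poly (pderiv p) 0 = poly q 0 + (- l) * poly (pderiv q) 0" by simp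
      moreover have "poly p 0 = (- l) * poly q 0" unfolding p by simp
      ultimately show ?thesis using le by simp
    qed
    then have "(- l) * poly (pderiv q) 0 \<le> (- l) * (\<phi> * poly q 0)"
      using qpos[of 0] by (simp add: algebra_simps)
    then show "poly (pderiv q) 0 \<le> \<phi> * poly q 0" using l by simp
  qed
  then have bq: "barrier \<phi> ((pderiv ^^ n) q) y"
    using barrier_higher_pderiv[of \<phi> q 0 n] \<phi> n dq by (simp add: y_def)
  have "n * poly ((pderiv ^^ n) q) y \<ge> (- y) * poly ((pderiv ^^ Suc n) q) y"
  proof -
    have "(- y) * poly ((pderiv ^^ Suc n) q) y \<le> (- y) * (\<phi> * poly ((pderiv ^^ n) q) y)"
      using bq \<phi> by (intro mult_left_mono) (auto simp: barrier_def y_def)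
    also have "\<dots> = n * poly ((pderiv ^^ n) q) y" using \<phi> by (simp add: y_def)
    finally show ?thesis .
  qed
  moreover have "poly ((pderiv ^^ n) q) y > 0" using bq by (simp add: barrier_def)
  moreover have "poly ((pderiv ^^ Suc n) p) y = (y - l) * poly ((pderiv ^^ Suc n) q) y + Suc n * poly ((pderiv ^^ n) q) y"
    unfolding p higher_pderiv_linear_mult by (simp add: left_diff_distrib)
  ultimately have "(- l) * poly ((pderiv ^^ Suc n) q) y \<le> poly ((pderiv ^^ Suc n) p) y"
    by (simp add: algebra_simps)
  then have "poly q 0 * ((- l) * poly ((pderiv ^^ Suc n) q) y) \<le> poly q 0 * poly ((pderiv ^^ Suc n) p) y"
    using qpos[of 0] by (intro mult_left_mono) auto
  moreover have "poly p 0 = - l * poly q 0" unfolding p by simp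
  ultimately show ?thesis unfolding q_def[symmetric] by (simp add: mult_ac)
qed

text \<open>The inequality for root quotients, summed with nonnegative weights;
  \<open>smult c p\<close> contributes equality. In the application \<open>q\<close> is the
  derivative of \<open>p\<close> in the direction of another block, so the barrier in that direction
  does not grow.\<close>

lemma barrier_ratio:
  assumes bar: "barrier \<phi> p 0" and \<phi>: "\<phi> > 0" and n: "n < degree p"
    and q: "q = smult c p + (\<Sum>l\<in>R. smult (s l) (p div [:-l, 1:]))"
    and R: "finite R" "\<And>l. l \<in> R \<Longrightarrow> poly p l = 0" "\<And>l. l \<in> R \<Longrightarrow> s l \<ge> 0"
  defines "y \<equiv> - (n / \<phi>)"
  shows "t \<ge> y \<Longrightarrow> poly ((pderiv ^^ Suc n) p) t > 0"
    "poly ((pderiv ^^ Suc n) q) y * poly p 0 \<le> poly q 0 * poly ((pderiv ^^ Suc n) p) y"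
proof -
  have "barrier \<phi> ((pderiv ^^ Suc n) p) (0 - Suc n / \<phi>)"
    by (rule barrier_higher_pderiv[OF bar \<phi>]) (use n in simp)
  then have *: "poly ((pderiv ^^ Suc n) p) t > 0" if "t \<ge> - (Suc n / \<phi>)" for t
    using that by (simp add: barrier_def)
  have "- (Suc n / \<phi>) \<le> y" using \<phi> by (simp add: y_def divide_right_mono)
  then show "t \<ge> y \<Longrightarrow> poly ((pderiv ^^ Suc n) p) t > 0" using *[of t] by (simp del: funpow.simps)
  have "poly ((pderiv ^^ Suc n) q) y * poly p 0 = c * poly ((pderiv ^^ Suc n) p) y * poly p 0 +
     (\<Sum>l\<in>R. s l * (poly ((pderiv ^^ Suc n) (p div [:-l, 1:])) y * poly p 0))"
    unfolding q higher_pderiv_add higher_pderiv_sum higher_pderiv_smult poly_add poly_sum poly_smult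
    by (simp add: algebra_simps sum_distrib_left del: funpow.simps)
  also have "\<dots> \<le> c * poly ((pderiv ^^ Suc n) p) y * poly p 0 +
     (\<Sum>l\<in>R. s l * (poly (p div [:-l, 1:]) 0 * poly ((pderiv ^^ Suc n) p) y))"
    unfolding y_def using R barrier_root_quotient[OF bar \<phi> _ n]
    by (intro add_left_mono sum_mono mult_left_mono) auto
  also have "\<dots> = poly q 0 * poly ((pderiv ^^ Suc n) p) y"
    unfolding q poly_add poly_sum poly_smult
    by (simp add: algebra_simps sum_distrib_left del: funpow.simps)
  finally show "poly ((pderiv ^^ Suc n) q) y * poly p 0 \<le> poly q 0 * poly ((pderiv ^^ Suc n) p) y" .
qed

section \<open>Partial fractions with nonnegative residues and common interlacing\<close>

lemma root_simple_and_sign: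
  assumes Im: "\<And>t. Im t > 0 \<Longrightarrow> Im (poly (cpoly q) t * cnj (poly (cpoly p) t)) \<le> 0"
    and p: "p = [:-l, 1:] ^ m * r" and m: "m \<ge> 1" and r: "poly r l \<noteq> 0" and q: "poly q l \<noteq> 0"
  shows "m = 1" "poly q l * poly r l > 0"
proof -
  have cp: "poly (cpoly p) t = (t - of_real l) ^ m * poly (cpoly r) t" for t
  proof -
    have "cpoly ([:-l, 1:] ^ m) = [:- of_real l, 1:] ^ m"
      by (induction m) (simp_all add: cpoly_mult cpoly_linear map_poly_pCons del: mult_pCons_left)
    then show ?thesis by (simp add: p cpoly_mult)
  qed
  \<comment> \<open>On the ray of angle \<theta> above \<open>l\<close>, the product behaves like
    q(l) r(l) e^m cis (- m \<theta>) for small radius e; dividing by e^m and letting e tend to 0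
    turns the hypothesis into this sign condition.\<close>
  have sgn: "poly q l * poly r l * sin (m * \<theta>) \<ge> 0" if \<theta>: "0 < \<theta>" "\<theta> < pi" for \<theta> :: real
  proof -
    define u where "u = cis \<theta>"
    define F where "F = (\<lambda>e. poly (cpoly q) (of_real l + of_real e * u) * cnj (poly (cpoly r) (of_real l + of_real e * u)) * cnj u ^ m)"
    have le: "Im (F e) \<le> 0" if e: "e > 0" for e
    proof -
      have "Im (of_real l + of_real e * u) > 0" using e sin_gt_zero[OF \<theta>] by (simp add: u_def)
      from Im[OF this] have "Im (of_real (e ^ m) * F e) \<le> 0"
        by (simp add: cp F_def power_mult_distrib mult_ac)
      moreover have "Im (of_real (e ^ m) * F e) = e ^ m * Im (F e)" by (simp only: Im_complex_of_real Re_complex_of_real times_complex.sel)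
      ultimately have "e ^ m * Im (F e) \<le> 0" by linarith
      moreover have "e ^ m > 0" using e by simp
      ultimately show ?thesis by (simp add: mult_le_0_iff)
    qed
    have "isCont F 0" unfolding F_def by (intro continuous_intros)
    then have "(F \<longlongrightarrow> F 0) (at_right 0)"
      by (simp add: isCont_def filterlim_at_split)
    then have "((\<lambda>e. Im (F e)) \<longlongrightarrow> Im (F 0)) (at_right 0)" by (rule tendsto_Im)
    moreover have "eventually (\<lambda>e. Im (F e) \<le> 0) (at_right 0)"
      using le by (auto simp: eventually_at_filter)
    ultimately have "Im (F 0) \<le> 0" by (intro tendsto_upperbound) auto
    moreover have "F 0 = of_real (poly q l * poly r l) * cis (- (m * \<theta>))"
      using Complex.DeMoivre[of "-\<theta>" m] by (simp add: F_def u_def cis_cnj)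
    ultimately show ?thesis by simp
  qed
  have nz: "poly q l * poly r l \<noteq> 0" using q r by simp
  \<comment> \<open>The angle pi / (2 m) makes the sine 1. For m >= 2 the angle 3 pi / (2 m) is
    still below pi and makes it -1, a contradiction.\<close>
  have *: "poly q l * poly r l \<ge> 0"
    using sgn[of "pi / (2 * m)"] m by (simp add: field_simps)
  then show "poly q l * poly r l > 0" using nz by linarith
  show "m = 1"
  proof (rule ccontr)
    assume "m \<noteq> 1"
    with m have m2: "m \<ge> 2" by simp
    have "3 * pi / (2 * m) < pi" using m2 pi_gt_zero by (simp add: field_simps)
    moreover have "sin (m * (3 * pi / (2 * m))) = -1"
      using m2 sin_3over2_pi by simp
    ultimately have "poly q l * poly r l \<le> 0"
      using sgn[of "3 * pi / (2 * m)"] m by simp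
    with * nz show False by simp
  qed
qed

text \<open>q/p maps the upper half plane into the closed lower one. After cancelling common roots,
  which the induction does, such a function has only simple real poles, with positive
  residues.\<close>

lemma pick_partial_fractions:
  assumes rr: "real_rooted p"
    and Im: "\<And>t. Im t > 0 \<Longrightarrow> Im (poly (cpoly q) t * cnj (poly (cpoly p) t)) \<le> 0"
    and deg: "degree q \<le> degree p"
  shows "\<exists>c s. (\<forall>l. s l \<ge> 0) \<and> q = smult c p + (\<Sum>l | poly p l = 0. smult (s l) (p div [:-l, 1:]))"
  using assms
proof (induction "degree p" arbitrary: p q rule: less_induct)
  case less
  note rr = less.prems(1) and Im = less.prems(2) and deg = less.prems(3)
  have p0: "p \<noteq> 0" using real_rooted_nonzero[OF rr] .
  have finR: "finite {l. poly p l = 0}" by (rule poly_roots_finite[OF p0])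
  show ?case
  proof (cases "\<exists>l. poly p l = 0 \<and> poly q l = 0")
    case True
    then obtain l p1 q1 where p: "p = [:-l, 1:] * p1" and q: "q = [:-l, 1:] * q1"
      by (metis dvdE poly_eq_0_iff_dvd)
    have p10: "p1 \<noteq> 0" using p p0 by auto
    have "degree p = degree [:-l, 1:] + degree p1" unfolding p by (rule degree_mult_eq) (use p10 in auto)
    then have dp: "degree p = Suc (degree p1)" by simp
    have dq: "degree q1 \<le> degree p1"
    proof (cases "q1 = 0")
      case False
      have "degree q = degree [:-l, 1:] + degree q1" unfolding q by (rule degree_mult_eq) (use False in auto)
      then show ?thesis using deg dp by simp
    qed simp
    have rr1: "real_rooted p1" using rr real_rooted_factor unfolding p by blast
    have Im1: "Im (poly (cpoly q1) t * cnj (poly (cpoly p1) t)) \<le> 0" if t: "Im t > 0" for t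
    proof -
      have "poly (cpoly q) t * cnj (poly (cpoly p) t) =
        (t - of_real l) * cnj (t - of_real l) * (poly (cpoly q1) t * cnj (poly (cpoly p1) t))"
        unfolding p q cpoly_mult by (simp add: cpoly_linear map_poly_pCons algebra_simps)
      also have "\<dots> = of_real ((cmod (t - of_real l))\<^sup>2) * (poly (cpoly q1) t * cnj (poly (cpoly p1) t))"
        by (simp only: complex_norm_square)
      finally have "Im (poly (cpoly q) t * cnj (poly (cpoly p) t)) =
        (cmod (t - of_real l))\<^sup>2 * Im (poly (cpoly q1) t * cnj (poly (cpoly p1) t))"
        by (simp only: Im_complex_of_real Re_complex_of_real times_complex.sel)
      moreover have "(cmod (t - of_real l))\<^sup>2 > 0" using t by auto
      ultimately show ?thesis using Im[OF t] by (simp add: mult_le_0_iff)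
    qed
    obtain c s where s: "\<forall>l. s l \<ge> 0" and q1: "q1 = smult c p1 + (\<Sum>l | poly p1 l = 0. smult (s l) (p1 div [:-l, 1:]))"
      using less.hyps[OF _ rr1 Im1 dq] dp by auto
    define s' where "s' = (\<lambda>l. if poly p1 l = 0 then s l else 0)"
    have "q = smult c p + (\<Sum>k | poly p1 k = 0. smult (s k) ([:-l, 1:] * (p1 div [:-k, 1:])))"
      unfolding q by (subst q1) (simp add: p distrib_left sum_distrib_left del: mult_pCons_left)
    also have "(\<Sum>k | poly p1 k = 0. smult (s k) ([:-l, 1:] * (p1 div [:-k, 1:]))) =
      (\<Sum>k | poly p k = 0. smult (s' k) (p div [:-k, 1:]))"
    proof (rule sum.mono_neutral_cong_left[OF finR])
      show "{k. poly p1 k = 0} \<subseteq> {l. poly p l = 0}" by (auto simp: p)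
      show "\<forall>i\<in>{l. poly p l = 0} - {k. poly p1 k = 0}. smult (s' i) (p div [:- i, 1:]) = 0"
        by (auto simp: s'_def)
      fix k assume "k \<in> {k. poly p1 k = 0}"
      then have k: "poly p1 k = 0" by simp
      then have "[:-k, 1:] dvd p1" by (simp add: poly_eq_0_iff_dvd)
      then have "[:-l, 1:] * (p1 div [:-k, 1:]) = p div [:-k, 1:]"
        unfolding p by (rule div_mult_swap)
      then show "smult (s k) ([:-l, 1:] * (p1 div [:-k, 1:])) = smult (s' k) (p div [:-k, 1:])"
        using k by (simp only: s'_def if_True refl)
    qed
    finally show ?thesis using s by (intro exI[of _ c] exI[of _ s']) (auto simp: s'_def)
  next
    case False
    define P where "P = (\<lambda>l. p div [:-l, 1:])"
    have pP: "p = [:-l, 1:] * P l" if "poly p l = 0" for l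
      using that by (simp only: P_def poly_eq_0_iff_dvd dvd_mult_div_cancel)
    have simple: "order l p = 1" "poly q l * poly (P l) l > 0" if l: "poly p l = 0" for l
    proof -
      obtain r where r: "p = [:-l, 1:] ^ order l p * r" "\<not> [:-l, 1:] dvd r"
        using order_decomp[OF p0] by blast
      have "order l p \<ge> 1" using l p0 by (simp add: order_root Suc_le_eq)
      from root_simple_and_sign[OF Im r(1) this _] r(2) False l
      have *: "order l p = 1" "poly q l * poly r l > 0" by (auto simp: poly_eq_0_iff_dvd)
      then have "[:-l, 1:] * P l = [:-l, 1:] * r" using r(1) pP[OF l] by simp
      then have "P l = r" by (metis mult_cancel_left pCons_eq_0_iff zero_neq_one)
      with * show "order l p = 1" "poly q l * poly (P l) l > 0" by auto
    qed
    obtain A where A: "size A = degree p" "p = smult (lead_coeff p) (\<Prod>x\<in>#A. [:-x, 1:])"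
      using real_rooted_factorization[OF rr] by blast
    have count: "count A x \<le> 1" for x
    proof (rule ccontr)
      assume "\<not> count A x \<le> 1"
      then have "count A x \<ge> 2" by simp
      then have "{#x, x#} \<subseteq># A" by (simp add: subseteq_mset_def)
      then obtain B where "A = {#x, x#} + B" by (metis subset_mset.le_iff_add)
      then have "p = [:-x, 1:] ^ 2 * smult (lead_coeff p) (\<Prod>x\<in>#B. [:-x, 1:])"
        by (subst A(2)) (simp only: power2_eq_square mult_smult_right mult.assoc image_mset_add_mset
            prod_mset.add_mset add_mset_add_single[symmetric] union_mset_add_mset_left add_0)
      then have d: "[:-x, 1:] ^ 2 dvd p" by (metis dvd_triv_left)
      then have "order x p \<ge> 2" using p0 order_divides by blast
      moreover have "poly p x = 0" using d by (metis dvd_trans dvd_power poly_eq_0_iff_dvd pos2)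
      ultimately show False using simple(1) by force
    qed
    have setA: "set_mset A = {l. poly p l = 0}"
    proof -
      have "poly p l = 0 \<longleftrightarrow> l \<in># A" for l
        using p0 poly_prod_linear_eq_0_iff[of A l] by (subst A(2)) simp
      then show ?thesis by auto
    qed
    have card: "card {l. poly p l = 0} = degree p"
    proof -
      have "size A = (\<Sum>x\<in>set_mset A. count A x)" by (simp add: size_multiset_overloaded_eq)
      also have "\<dots> = (\<Sum>x\<in>set_mset A. 1)" using count by (intro sum.cong refl) (metis One_nat_def Suc_leI count_greater_zero_iff le_antisym)
      finally show ?thesis using A(1) setA by simp
    qed
    \<comment> \<open>\<open>c\<close> is the value of q/p at infinity and \<open>s l\<close> its
      residue at \<open>l\<close>.\<close>
    define c where "c = coeff q (degree p) / lead_coeff p"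
    define s where "s = (\<lambda>l. if poly p l = 0 then poly q l / poly (P l) l else 0)"
    have s: "s l \<ge> 0" for l
      using simple(2)[of l] by (auto simp: s_def zero_le_divide_iff zero_less_mult_iff)
    define E where "E = q - (smult c p + (\<Sum>l | poly p l = 0. smult (s l) (P l)))"
    have degP: "degree (P l) < degree p" if "poly p l = 0" for l
    proof -
      have "P l \<noteq> 0" using pP[OF that] p0 by auto
      have "degree p = degree ([:-l, 1:] * P l)" using pP[OF that] by simp
      also have "\<dots> = degree [:-l, 1:] + degree (P l)" by (rule degree_mult_eq) (use \<open>P l \<noteq> 0\<close> in auto)
      finally show ?thesis by simp
    qed
    have E0: "coeff E n = 0" if n: "n \<ge> degree p" for n
    proof -
      have "coeff (P l) n = 0" if "poly p l = 0" for l
        using degP[OF that] n by (simp add: coeff_eq_0)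
      then have "(\<Sum>l | poly p l = 0. s l * coeff (P l) n) = 0" by (simp add: sum.neutral)
      then have "coeff E n = coeff q n - c * coeff p n" by (simp add: E_def coeff_sum)
      also have "\<dots> = 0"
      proof (cases "n = degree p")
        case True
        then show ?thesis using p0 by (simp add: c_def)
      next
        case False
        then show ?thesis using n deg by (simp add: coeff_eq_0)
      qed
      finally show ?thesis .
    qed
    have Eroot: "poly E l = 0" if l: "poly p l = 0" for l
    proof -
      have "poly (P k) l = 0" if k: "poly p k = 0" "k \<noteq> l" for k
      proof -
        have "poly ([:-k, 1:] * P k) l = 0" using pP[OF k(1)] l by simp
        then show ?thesis using k(2) by simp
      qed
      then have "(\<Sum>k | poly p k = 0. s k * poly (P k) l) = (\<Sum>k | poly p k = 0. if k = l then s l * poly (P l) l else 0)"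
        by (intro sum.cong) auto
      also have "\<dots> = s l * poly (P l) l" using finR l by simp
      also have "\<dots> = poly q l" using simple(2)[OF l] l by (auto simp: s_def)
      finally show ?thesis using l by (simp add: E_def poly_sum)
    qed
    \<comment> \<open>The error has degree below that of \<open>p\<close>, yet vanishes at the
      \<open>degree p\<close> distinct roots of \<open>p\<close>.\<close>
    have "E = 0"
    proof (rule ccontr)
      assume E: "E \<noteq> 0"
      have "degree E < degree p" using E0 E by (metis leI leading_coeff_0_iff)
      moreover have "card {l. poly p l = 0} \<le> card {l. poly E l = 0}"
        by (rule card_mono[OF poly_roots_finite[OF E]]) (use Eroot in auto)
      moreover have "card {l. poly E l = 0} \<le> degree E" by (rule card_poly_roots_bound[OF E])
      ultimately show False using card by simp
    qed
    then have "q = smult c p + (\<Sum>l | poly p l = 0. smult (s l) (P l))" by (simp add: E_def)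
    then show ?thesis using s unfolding P_def by blast
  qed
qed

text \<open>The partial fractions of \<open>F i / p\<close> have nonnegative residues, so \<open>p\<close> interlaces every \<open>F i\<close>.\<close>

lemma common_interlacing_selection:
  fixes p :: "real poly" and F :: "'a \<Rightarrow> real poly"
  assumes S: "finite S" and rr: "real_rooted p"
    and F: "\<And>i. i \<in> S \<Longrightarrow> F i = smult (c i) p + (\<Sum>l | poly p l = 0. smult (s i l) (p div [:-l, 1:]))"
    and s: "\<And>i l. i \<in> S \<Longrightarrow> s i l \<ge> 0"
    and pX: "\<And>x. x > X \<Longrightarrow> poly p x > 0" and FX: "\<And>i x. i \<in> S \<Longrightarrow> x > X \<Longrightarrow> poly (F i) x > 0"
    and sum: "\<And>x. x > \<rho> \<Longrightarrow> (\<Sum>i\<in>S. poly (F i) x) > 0"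
  shows "\<exists>i\<in>S. \<forall>x>\<rho>. poly (F i) x > 0"
proof -
  define R where "R = {l. poly p l = 0}"
  have p0: "p \<noteq> 0" using real_rooted_nonzero[OF rr] .
  have finR: "finite R" unfolding R_def by (rule poly_roots_finite[OF p0])
  define P where "P = (\<lambda>l. p div [:-l, 1:])"
  have pP: "p = [:-l, 1:] * P l" if "l \<in> R" for l
    using that unfolding R_def mem_Collect_eq by (simp only: P_def poly_eq_0_iff_dvd dvd_mult_div_cancel)
  have pPx: "poly p x = (x - l) * poly (P l) x" if "l \<in> R" for l x
    using arg_cong[OF pP[OF that], of "\<lambda>p. poly p x"] by (simp add: left_diff_distrib)
  \<comment> \<open>\<open>\<psi> i\<close> is F i / p off the roots of \<open>p\<close>;
    nonnegative residues make it decreasing between consecutive poles.\<close>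
  define \<psi> where "\<psi> = (\<lambda>i x. c i + (\<Sum>l\<in>R. s i l / (x - l)))"
  have Fx: "poly (F i) x = poly p x * \<psi> i x" if "i \<in> S" "x \<notin> R" for i x
  proof -
    have "poly p x / (x - l) = poly (P l) x" if "l \<in> R" for l
    proof -
      have "x - l \<noteq> 0" using that \<open>x \<notin> R\<close> by auto
      then show ?thesis unfolding pPx[OF that, of x] by simp
    qed
    then have "s i l * poly (P l) x = poly p x * (s i l / (x - l))" if "l \<in> R" for l
      using that by (metis mult.commute times_divide_eq_left)
    then show ?thesis
      unfolding F[OF that(1)] R_def[symmetric] \<psi>_def
      by (simp add: poly_sum distrib_left sum_distrib_left P_def)
  qed
  have FR: "poly (F i) l = s i l * poly (P l) l" if i: "i \<in> S" and l: "l \<in> R" for i l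
  proof -
    have "poly (P k) l = 0" if "k \<in> R" "k \<noteq> l" for k
      using pPx[OF that(1), of l] l that(2) by (simp add: R_def)
    then have "(\<Sum>k\<in>R. s i k * poly (P k) l) = (\<Sum>k\<in>R. if k = l then s i l * poly (P l) l else 0)"
      by (intro sum.cong) auto
    also have "\<dots> = s i l * poly (P l) l" using finR l by simp
    finally show ?thesis
      unfolding F[OF i] R_def[symmetric] using l by (simp add: poly_sum R_def P_def)
  qed
  have nosign: "poly q x > 0" if ev: "\<And>x. x > Y \<Longrightarrow> poly q x > 0" and nr: "\<And>l. poly q l = 0 \<Longrightarrow> l < x" for q :: "real poly" and x Y
  proof (rule ccontr)
    assume "\<not> poly q x > 0"
    then have "poly q x < 0" using nr[of x] by force
    define y where "y = max x Y + 1"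
    have "y > x" "poly q y > 0" using ev[of y] by (auto simp: y_def)
    then obtain l where "l > x" "poly q l = 0" using poly_IVT_pos[of x y q] \<open>poly q x < 0\<close> by blast
    with nr[of l] show False by simp
  qed
  have ppos: "poly p x > 0" if "\<And>l. l \<in> R \<Longrightarrow> l < x" for x
    by (rule nosign[of X]) (use pX that in \<open>auto simp: R_def\<close>)
  \<comment> \<open>\<open>c i\<close> is the limit of F i / p at infinity, and both polynomials are
    positive far to the right.\<close>
  have c: "c i \<ge> 0" if i: "i \<in> S" for i
  proof -
    have "((\<lambda>x. s i l / (x - l)) \<longlongrightarrow> 0) at_top" for l by real_asymp
    then have "((\<lambda>x. \<psi> i x) \<longlongrightarrow> c i + (\<Sum>l\<in>R. 0)) at_top"
      unfolding \<psi>_def by (intro tendsto_intros)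
    moreover have "eventually (\<lambda>x. \<psi> i x \<ge> 0) at_top"
    proof -
      obtain Y0 where "\<And>l. l \<in> R \<Longrightarrow> l \<le> Y0"
        using bdd_above_finite[OF finR] by (auto simp: bdd_above_def)
      then have Y: "\<And>l. l \<in> R \<Longrightarrow> l < Y0 + 1" by force
      define Y where "Y = Y0 + 1"
      note Y = Y[folded Y_def]
      have "\<psi> i x \<ge> 0" if "x > max X Y" for x
      proof -
        have "x \<notin> R" "poly p x > 0" "poly (F i) x > 0" using Y[of x] pX[of x] FX[OF i, of x] that by auto
        then show ?thesis using Fx[OF i, of x] by (simp add: zero_less_mult_iff)
      qed
      then show ?thesis using eventually_gt_at_top[of "max X Y"] by (auto elim: eventually_mono)
    qed
    ultimately show ?thesis by (simp add: tendsto_lowerbound)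
  qed
  have \<psi>nonneg: "\<psi> i x \<ge> 0" if "i \<in> S" "\<And>l. l \<in> R \<Longrightarrow> l < x" for i x
    unfolding \<psi>_def using c[OF that(1)] s[OF that(1)] that(2)
    by (intro add_nonneg_nonneg sum_nonneg divide_nonneg_pos) auto
  have \<psi>pos: "\<psi> i x > 0" if i: "i \<in> S" and x: "\<And>l. l \<in> R \<Longrightarrow> l < x" for i x
  proof (rule ccontr)
    assume "\<not> \<psi> i x > 0"
    then have 0: "\<psi> i x = 0" using \<psi>nonneg[OF that] by simp
    have nn: "0 \<le> (\<Sum>l\<in>R. s i l / (x - l))" using s[OF i] x by (intro sum_nonneg divide_nonneg_pos) auto
    then have ci: "c i = 0" and s0: "(\<Sum>l\<in>R. s i l / (x - l)) = 0" using 0 c[OF i] by (auto simp: \<psi>_def)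
    have "\<forall>l\<in>R. s i l / (x - l) = 0"
      using s0 by (subst (asm) sum_nonneg_eq_0_iff[OF finR]) (use s[OF i] x in \<open>auto intro!: divide_nonneg_pos\<close>)
    then have "\<forall>l\<in>R. s i l = 0" using x by force
    then have "F i = 0" unfolding F[OF i] R_def[symmetric] by (simp add: ci)
    then show False using FX[OF i, of "X + 1"] by simp
  qed
  have "S \<noteq> {}" using sum[of "\<rho> + 1"] by auto
  show ?thesis
  \<comment> \<open>If no root of \<open>p\<close> exceeds \<open>\<rho>\<close>, every index works.
    Otherwise the largest root \<open>m\<close> turns out to be the only one above
    \<open>\<rho>\<close>, and the index is chosen by the sign of \<open>\<psi> i\<close> between
    \<open>\<rho>\<close> and \<open>m\<close>.\<close>
  proof (cases "\<forall>l\<in>R. l \<le> \<rho>")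
    case True
    obtain i where i: "i \<in> S" using \<open>S \<noteq> {}\<close> by blast
    have "poly (F i) x > 0" if "x > \<rho>" for x
    proof -
      have x: "\<And>l. l \<in> R \<Longrightarrow> l < x" using True that by force
      then have "x \<notin> R" by blast
      then show ?thesis using Fx[OF i] ppos[OF x] \<psi>pos[OF i x] by simp
    qed
    then show ?thesis using i by blast
  next
    case False
    define m where "m = Max R"
    have "R \<noteq> {}" using False by auto
    then have mR: "m \<in> R" and m: "\<And>l. l \<in> R \<Longrightarrow> l \<le> m"
      using finR unfolding m_def by auto
    have m\<rho>: "m > \<rho>" using False m by force
    have "(\<Sum>i\<in>S. s i m) * poly (P m) m > 0"
      using sum[OF m\<rho>] FR[OF _ mR] by (simp add: sum_distrib_right)
    then have Pm0: "poly (P m) m \<noteq> 0" by auto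
    have rootP: "l \<in> R \<and> l < m" if "poly (P m) l = 0" for l
      using that Pm0 m[of l] pPx[OF mR, of l] by (cases "l = m") (auto simp: R_def)
    have Ppos_ev: "poly (P m) x > 0" if "x > max X m" for x
      using pX[of x] pPx[OF mR, of x] that by (simp add: zero_less_mult_iff)
    have Pmm: "poly (P m) m > 0" by (rule nosign[where Y = "max X m", OF Ppos_ev]) (use rootP in auto)
    \<comment> \<open>At the second largest root the derivative of \<open>p\<close>, which is
      \<open>poly (P k) k\<close>, is not positive. If that root exceeded \<open>\<rho>\<close>, all
      \<open>F i\<close> would be nonpositive there, against \<open>sum\<close>.\<close>
    have R\<rho>: "l \<le> \<rho>" if lR: "l \<in> R" and lm: "l \<noteq> m" for l
    proof (rule ccontr)
      assume l\<rho>: "\<not> l \<le> \<rho>"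
      define k where "k = Max (R - {m})"
      have ne: "R - {m} \<noteq> {}" using lR lm by auto
      have kR: "k \<in> R" "k \<noteq> m" and k: "\<And>l. l \<in> R \<Longrightarrow> l \<noteq> m \<Longrightarrow> l \<le> k"
        using Max_in[of "R - {m}"] Max_ge[of "R - {m}"] finR ne unfolding k_def by auto
      have km: "k < m" using m[OF kR(1)] kR(2) by simp
      have k\<rho>: "k > \<rho>" using k[OF lR lm] l\<rho> by simp
      have "poly (P m) k = 0" using pPx[OF mR, of k] kR by (simp add: R_def)
      then obtain Q where Q: "P m = [:-k, 1:] * Q" by (metis dvdE poly_eq_0_iff_dvd)
      have Qpos: "poly Q x > 0" if "x > k" for x
      proof -
        have "poly (P m) x > 0"
          by (rule nosign[where Y = "max X m", OF Ppos_ev]) (use rootP k that in force)+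
        then have "(x - k) * poly Q x > 0" unfolding Q by (simp add: left_diff_distrib)
        then show ?thesis using that by (simp add: zero_less_mult_iff)
      qed
      have "isCont (poly Q) k" by simp
      then have "(poly Q \<longlongrightarrow> poly Q k) (at_right k)" by (simp add: isCont_def filterlim_at_split)
      moreover have "eventually (\<lambda>x. poly Q x \<ge> 0) (at_right k)"
        using Qpos by (auto simp: eventually_at_filter less_imp_le)
      ultimately have Qk: "poly Q k \<ge> 0" by (intro tendsto_lowerbound) auto
      have "[:-k, 1:] * P k = [:-k, 1:] * ([:-m, 1:] * Q)"
        using pP[OF kR(1)] pP[OF mR] Q by (metis mult.left_commute)
      then have "P k = [:-m, 1:] * Q" by (metis mult_cancel_left pCons_eq_0_iff zero_neq_one)
      then have "poly (P k) k = (k - m) * poly Q k" by (simp add: left_diff_distrib)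
      then have "poly (P k) k \<le> 0" using km Qk by (simp add: mult_le_0_iff)
      then have "(\<Sum>i\<in>S. poly (F i) k) \<le> 0"
        using FR[OF _ kR(1)] s by (intro sum_nonpos) (simp add: mult_le_0_iff)
      with sum[OF k\<rho>] show False by simp
    qed
    have mid: "x \<notin> R" "poly p x < 0" if x: "\<rho> < x" "x < m" for x
    proof -
      show "x \<notin> R" using R\<rho>[of x] x by force
      have "poly (P m) x > 0"
        by (rule nosign[where Y = "max X m", OF Ppos_ev]) (use rootP R\<rho> x in force)+
      then show "poly p x < 0" using pPx[OF mR, of x] x by (simp add: mult_less_0_iff)
    qed
    have \<psi>dec: "\<psi> i x' \<le> \<psi> i x" if i: "i \<in> S" and x: "\<rho> < x" "x \<le> x'" "x' < m" for i x x'
      unfolding \<psi>_def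
    proof (intro add_left_mono sum_mono)
      fix l assume l: "l \<in> R"
      show "s i l / (x' - l) \<le> s i l / (x - l)"
      proof (cases "l = m")
        case True
        have "1 / (x' - m) \<le> 1 / (x - m)" using le_imp_inverse_le_neg[of "x - m" "x' - m"] x by (simp add: inverse_eq_divide)
        from mult_left_mono[OF this s[OF i, of l]] True show ?thesis by simp
      next
        case False
        then have "l \<le> \<rho>" using R\<rho> l by blast
        then show ?thesis using s[OF i, of l] x by (intro divide_left_mono) auto
      qed
    qed
    \<comment> \<open>Otherwise each \<open>\<psi> i\<close> is nonnegative somewhere in the
      interval. By monotonicity all are nonnegative at the leftmost of these points, where
      \<open>p\<close> is negative, so the sum would be nonpositive.\<close>
    obtain i where i: "i \<in> S" and neg: "\<And>x. \<rho> < x \<Longrightarrow> x < m \<Longrightarrow> \<psi> i x < 0"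
    proof -
      have "\<exists>i\<in>S. \<forall>x. \<rho> < x \<longrightarrow> x < m \<longrightarrow> \<psi> i x < 0"
      proof (rule ccontr)
        assume "\<not> ?thesis"
        then have "\<forall>i\<in>S. \<exists>x. \<rho> < x \<and> x < m \<and> \<psi> i x \<ge> 0" by force
        then obtain f where f: "\<And>i. i \<in> S \<Longrightarrow> \<rho> < f i \<and> f i < m \<and> \<psi> i (f i) \<ge> 0" by metis
        define x where "x = Min (f ` S)"
        have xf: "x \<in> f ` S" and xle: "\<And>i. i \<in> S \<Longrightarrow> x \<le> f i"
          unfolding x_def using S \<open>S \<noteq> {}\<close> by (auto intro: Min_in)
        then have x: "\<rho> < x" "x < m" using f by auto
        have "\<psi> i x \<ge> 0" if "i \<in> S" for i
          using \<psi>dec[OF that x(1) xle[OF that]] f[OF that] by linarith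
        then have "(\<Sum>i\<in>S. poly (F i) x) \<le> 0"
          using Fx[OF _ mid(1)[OF x]] mid(2)[OF x] by (intro sum_nonpos) (simp add: mult_le_0_iff)
        with sum[OF x(1)] show False by simp
      qed
      then show ?thesis using that by blast
    qed
    \<comment> \<open>Without a pole at \<open>m\<close> all terms of \<open>\<psi> i\<close> would
      be nonnegative to the right of \<open>\<rho>\<close>, so its negative sign must come from
      \<open>m\<close>.\<close>
    have si: "s i m > 0"
    proof (rule ccontr)
      assume "\<not> s i m > 0"
      then have sm: "s i m = 0" using s[OF i, of m] by simp
      define x where "x = (\<rho> + m) / 2"
      have x: "\<rho> < x" "x < m" using m\<rho> by (auto simp: x_def)
      have "(\<Sum>l\<in>R. s i l / (x - l)) \<ge> 0"
      proof (rule sum_nonneg)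
        fix l assume "l \<in> R"
        then show "s i l / (x - l) \<ge> 0" using R\<rho>[of l] x s[OF i, of l] sm by (cases "l = m") auto
      qed
      then have "\<psi> i x \<ge> 0" using c[OF i] by (simp add: \<psi>_def)
      with neg[OF x] show False by simp
    qed
    have "poly (F i) x > 0" if "x > \<rho>" for x
    proof -
      consider "x < m" | "x = m" | "x > m" by linarith
      then show ?thesis
      proof cases
        case 1
        then show ?thesis using Fx[OF i mid(1)] mid(2) neg that by (simp add: zero_less_mult_iff)
      next
        case 2
        then show ?thesis using FR[OF i mR] si Pmm by simp
      next
        case 3
        then have "\<And>l. l \<in> R \<Longrightarrow> l < x" using m by force
        then show ?thesis using Fx[OF i, of x] ppos[of x] \<psi>pos[OF i, of x] by force
      qed
    qed
    then show ?thesis using i by blast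
  qed
qed

section \<open>Stable multi-affine families\<close>

definition shift :: "'i set \<Rightarrow> complex \<Rightarrow> ('i \<Rightarrow> complex) \<Rightarrow> 'i \<Rightarrow> complex" where
  "shift J t z = (\<lambda>i. if i \<in> J then z i + t else z i)"

text \<open>\<open>V T\<close> abstracts the determinant of a principal submatrix on
  \<open>T\<close>: it has degree at most 1 in each variable, with partial derivative
  \<open>V (T - {i})\<close>. The abstraction pays off because the sums over deletions,
  \<open>VD\<close>, form such a family again.\<close>

locale affine_family =
  fixes I :: "'i set" and V :: "'i set \<Rightarrow> ('i \<Rightarrow> complex) \<Rightarrow> complex"
  assumes finI: "finite I"
    and affine: "\<lbrakk>T \<subseteq> I; i \<in> T\<rbrakk> \<Longrightarrow> V T (z(i := z i + t)) = V T z + t * V (T - {i}) z"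
    and cong: "\<lbrakk>T \<subseteq> I; \<And>i. i \<in> T \<Longrightarrow> z i = z' i\<rbrakk> \<Longrightarrow> V T z = V T z'"
begin

lemma finT: "T \<subseteq> I \<Longrightarrow> finite T"
  using finI finite_subset by blast

lemma shift_expand:
  assumes "T \<subseteq> I" "J \<subseteq> T"
  shows "V T (shift J t z) = (\<Sum>B\<in>Pow J. t ^ card B * V (T - B) z)"
proof -
  have "finite J" using assms finT finite_subset by blast
  then show ?thesis using assms
  proof (induction J arbitrary: T rule: finite_induct)
    case empty
    then show ?case by (simp add: shift_def)
  next
    case (insert j J)
    have sh: "shift (insert j J) t z = (shift J t z)(j := shift J t z j + t)"
      using insert.hyps by (auto simp: shift_def)
    have jT: "j \<in> T" using insert.prems by auto
    have "V T (shift (insert j J) t z) = V T (shift J t z) + t * V (T - {j}) (shift J t z)"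
      unfolding sh by (rule affine[OF insert.prems(1) jT])
    also have "V T (shift J t z) = (\<Sum>B\<in>Pow J. t ^ card B * V (T - B) z)"
      using insert by (intro insert.IH) auto
    also have "V (T - {j}) (shift J t z) = (\<Sum>B\<in>Pow J. t ^ card B * V (T - {j} - B) z)"
      using insert by (intro insert.IH) auto
    also have "t * (\<Sum>B\<in>Pow J. t ^ card B * V (T - {j} - B) z) =
        (\<Sum>B\<in>insert j ` Pow J. t ^ card B * V (T - B) z)"
    proof -
      have inj: "inj_on (insert j) (Pow J)" using insert.hyps by (auto simp: inj_on_def)
      have "t * (t ^ card B * V (T - {j} - B) z) = t ^ card (insert j B) * V (T - insert j B) z"
        if "B \<in> Pow J" for B
      proof -
        have "finite B" "j \<notin> B" using that insert.hyps finite_subset by auto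
        moreover have "T - {j} - B = T - insert j B" by auto
        ultimately show ?thesis by simp
      qed
      then show ?thesis unfolding sum.reindex[OF inj] by (simp add: sum_distrib_left)
    qed
    finally show ?case
      using insert.hyps by (subst Pow_insert, subst sum.union_disjoint) auto
  qed
qed

text \<open>\<open>V T\<close> along the line z + t 1_J. It is given by coefficients, so that the
  n-th one is visibly a sum over the deletions of n points of \<open>J\<close>.\<close>

definition line_poly :: "'i set \<Rightarrow> 'i set \<Rightarrow> ('i \<Rightarrow> complex) \<Rightarrow> complex poly" where
  "line_poly T J z = (\<Sum>B\<in>Pow J. monom (V (T - B) z) (card B))"

lemma poly_line_poly:
  "T \<subseteq> I \<Longrightarrow> J \<subseteq> T \<Longrightarrow> poly (line_poly T J z) t = V T (shift J t z)"
  by (simp add: line_poly_def shift_expand poly_sum poly_monom mult.commute)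

lemma coeff_line_poly:
  assumes "finite J"
  shows "coeff (line_poly T J z) n = (\<Sum>B | B \<subseteq> J \<and> card B = n. V (T - B) z)"
proof -
  have "coeff (line_poly T J z) n = (\<Sum>B\<in>Pow J. if card B = n then V (T - B) z else 0)"
    by (simp add: line_poly_def coeff_sum)
  also have "\<dots> = (\<Sum>B\<in>Pow J \<inter> {B. card B = n}. V (T - B) z)"
    using assms by (simp add: sum.inter_restrict)
  also have "Pow J \<inter> {B. card B = n} = {B. B \<subseteq> J \<and> card B = n}" by auto
  finally show ?thesis .
qed

lemma coeff_line_poly_card:
  assumes "finite J" shows "coeff (line_poly T J z) (card J) = V (T - J) z"
proof -
  have "{B. B \<subseteq> J \<and> card B = card J} = {J}" using assms card_subset_eq by blast
  then show ?thesis using coeff_line_poly[OF assms, of T z "card J"] by simp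
qed

lemma degree_line_poly_le: "finite J \<Longrightarrow> degree (line_poly T J z) \<le> card J"
proof (rule degree_le, safe)
  fix n assume J: "finite J" and n: "card J < n"
  have "\<not> (B \<subseteq> J \<and> card B = n)" for B using card_mono[OF J, of B] n by auto
  then have "{B. B \<subseteq> J \<and> card B = n} = {}" by blast
  then show "coeff (line_poly T J z) n = 0" using coeff_line_poly[OF J, of T z n] by (simp only: sum.empty)
qed

definition upper_nonzero :: "'i set \<Rightarrow> bool" where
  "upper_nonzero T \<longleftrightarrow> (\<forall>z. (\<forall>i\<in>T. Im (z i) > 0) \<longrightarrow> V T z \<noteq> 0)"

text \<open>As a function of its variable \<open>i\<close>, \<open>V T\<close> is affine with zero
  at z i + t, where t = - V T z / V (T - {i}) z. Stability forces Im t < 0, which is the claim after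
  clearing the denominator.\<close>

lemma upper_ratio_open:
  assumes T: "T \<subseteq> I" and st: "upper_nonzero T" and i: "i \<in> T" and z: "\<And>j. j \<in> T \<Longrightarrow> Im (z j) > 0"
  shows "Im (V (T - {i}) z * cnj (V T z)) \<le> 0"
proof (cases "V (T - {i}) z = 0")
  case False
  define b where "b = V (T - {i}) z"
  define t where "t = - V T z / b"
  have b: "b \<noteq> 0" using False by (simp add: b_def)
  have "V T (z(i := z i + t)) = 0"
    using b unfolding affine[OF T i] by (simp add: t_def b_def)
  moreover have "Im ((z(i := z i + t)) j) > 0" if "Im t \<ge> 0" "j \<in> T" for j
    using z[OF that(2)] z[OF i] that(1) by auto
  ultimately have t: "Im t < 0" using st unfolding upper_nonzero_def by (meson not_le)
  have a: "V T z = - t * b" using b by (simp add: t_def)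
  have "V (T - {i}) z * cnj (V T z) = - cnj t * (b * cnj b)" unfolding a b_def[symmetric] by simp
  also have "\<dots> = - cnj t * of_real ((cmod b)\<^sup>2)" by (simp only: complex_norm_square)
  finally have "Im (V (T - {i}) z * cnj (V T z)) = Im t * (cmod b)\<^sup>2" by simp
  then show ?thesis using t by (simp add: mult_nonpos_nonneg)
qed simp

text \<open>All variables are lifted by i e, and e tends to 0. The closed half plane includes real
  points, where \<open>V T z\<close> may vanish; this is why the ratio is written as a product with
  the conjugate.\<close>

lemma upper_ratio:
  assumes T: "T \<subseteq> I" and st: "upper_nonzero T" and i: "i \<in> T" and z: "\<And>j. j \<in> T \<Longrightarrow> Im (z j) \<ge> 0"
  shows "Im (V (T - {i}) z * cnj (V T z)) \<le> 0"
proof -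
  define F where "F = (\<lambda>e. poly (line_poly (T - {i}) (T - {i}) z) (\<i> * of_real e) * cnj (poly (line_poly T T z) (\<i> * of_real e)))"
  have Fe: "F e = V (T - {i}) (shift T (\<i> * of_real e) z) * cnj (V T (shift T (\<i> * of_real e) z))" for e
  proof -
    have "V (T - {i}) (shift (T - {i}) t z) = V (T - {i}) (shift T t z)" for t
      using T by (intro cong) (auto simp: shift_def)
    moreover have "T - {i} \<subseteq> I" using T by auto
    ultimately show ?thesis
      by (simp only: F_def poly_line_poly[OF T order.refl] poly_line_poly[OF _ order.refl])
  qed
  have le: "Im (F e) \<le> 0" if "e > 0" for e
    unfolding Fe using that z by (intro upper_ratio_open[OF T st i]) (auto simp: shift_def add_nonneg_pos)
  have "isCont F 0" unfolding F_def by (intro continuous_intros)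
  then have "(F \<longlongrightarrow> F 0) (at_right 0)" by (simp add: isCont_def filterlim_at_split)
  then have "((\<lambda>e. Im (F e)) \<longlongrightarrow> Im (F 0)) (at_right 0)" by (rule tendsto_Im)
  moreover have "eventually (\<lambda>e. Im (F e) \<le> 0) (at_right 0)"
    using le by (auto simp: eventually_at_filter)
  ultimately have "Im (F 0) \<le> 0" by (intro tendsto_upperbound) auto
  moreover have "shift T 0 z = z" by (auto simp: shift_def)
  ultimately show ?thesis by (simp add: Fe)
qed

text \<open>Raising one variable by i h turns |a|^2 into |a|^2 + h^2 |b|^2 - 2 h Im (b cnj a), and
  Im (b cnj a) <= 0 by \<open>upper_ratio\<close>. This does the work of Hurwitz's theorem for lines
  on which some variables stay real.\<close>

lemma norm_shift_mono:
  assumes T: "T \<subseteq> I" and st: "upper_nonzero T" and J: "J \<subseteq> T" and z: "\<And>j. j \<in> T \<Longrightarrow> Im (z j) \<ge> 0" and h: "h \<ge> 0"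
  shows "cmod (V T z) \<le> cmod (V T (shift J (\<i> * of_real h) z))"
proof -
  have "finite J" using T J finT finite_subset by blast
  then show ?thesis using J
  proof (induction J rule: finite_induct)
    case empty
    then show ?case by (simp add: shift_def)
  next
    case (insert j J)
    let ?z = "shift J (\<i> * of_real h) z"
    have sh: "shift (insert j J) (\<i> * of_real h) z = ?z(j := ?z j + \<i> * of_real h)"
      using insert.hyps by (auto simp: shift_def)
    have j: "j \<in> T" using insert.prems by auto
    define a where "a = V T ?z"
    define b where "b = V (T - {j}) ?z"
    have "Im (b * cnj a) \<le> 0" unfolding a_def b_def
      using z h by (intro upper_ratio[OF T st j]) (auto simp: shift_def)
    then have im: "h * Im (b * cnj a) \<le> 0" using h by (simp add: mult_nonneg_nonpos)
    have "(cmod (a + \<i> * of_real h * b))\<^sup>2 = (cmod a)\<^sup>2 + h\<^sup>2 * (cmod b)\<^sup>2 - 2 * (h * Im (b * cnj a))"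
      unfolding cmod_power2 by (simp add: power2_eq_square) (simp add: algebra_simps)
    also have "\<dots> \<ge> (cmod a)\<^sup>2" 
    proof -
      have "0 \<le> h\<^sup>2 * (cmod b)\<^sup>2" by simp
      with im show ?thesis by linarith
    qed
    finally have "cmod a \<le> cmod (a + \<i> * of_real h * b)" by (rule power2_le_imp_le) simp
    moreover have "cmod (V T z) \<le> cmod a" unfolding a_def using insert.IH insert.prems by blast
    ultimately show ?case unfolding sh affine[OF T j] a_def b_def by simp
  qed
qed

end

section \<open>Families with real values: restrictions to lines\<close>

locale real_affine_family = affine_family +
  assumes real: "\<lbrakk>T \<subseteq> I; \<And>i. i \<in> T \<Longrightarrow> z i \<in> \<real>\<rbrakk> \<Longrightarrow> V T z \<in> \<real>"
begin

definition RV :: "'a set \<Rightarrow> ('a \<Rightarrow> real) \<Rightarrow> real" where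
  "RV T \<xi> = Re (V T (\<lambda>i. of_real (\<xi> i)))"

lemma of_real_RV: "T \<subseteq> I \<Longrightarrow> of_real (RV T \<xi>) = V T (\<lambda>i. of_real (\<xi> i))"
  unfolding RV_def by (rule of_real_Re[OF real]) auto

definition real_line_poly :: "'a set \<Rightarrow> 'a set \<Rightarrow> ('a \<Rightarrow> real) \<Rightarrow> real poly" where
  "real_line_poly T J \<xi> = (\<Sum>B\<in>Pow J. monom (RV (T - B) \<xi>) (card B))"

lemma cpoly_real_line_poly:
  assumes "T \<subseteq> I" "finite J"
  shows "cpoly (real_line_poly T J \<xi>) = line_poly T J (\<lambda>i. of_real (\<xi> i))"
proof (rule poly_eqI)
  fix n
  have "T - B \<subseteq> I" for B using assms by auto
  from of_real_RV[OF this] show "coeff (cpoly (real_line_poly T J \<xi>)) n = coeff (line_poly T J (\<lambda>i. of_real (\<xi> i))) n"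
    by (simp add: coeff_map_poly real_line_poly_def line_poly_def coeff_sum if_distrib[of of_real] cong: if_cong)
qed

lemma coeff_real_line_poly:
  assumes "T \<subseteq> I" "finite J"
  shows "coeff (real_line_poly T J \<xi>) n = (\<Sum>B | B \<subseteq> J \<and> card B = n. RV (T - B) \<xi>)"
proof -
  have "of_real (coeff (real_line_poly T J \<xi>) n) = coeff (cpoly (real_line_poly T J \<xi>)) n"
    by (simp add: coeff_map_poly)
  also have "\<dots> = of_real (\<Sum>B | B \<subseteq> J \<and> card B = n. RV (T - B) \<xi>)"
  proof -
    have "T - B \<subseteq> I" for B using assms by auto
    from of_real_RV[OF this] show ?thesis
      unfolding cpoly_real_line_poly[OF assms] coeff_line_poly[OF assms(2)] by simp
  qed
  finally show ?thesis by (simp only: of_real_eq_iff)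
qed

definition rshift :: "'a set \<Rightarrow> real \<Rightarrow> ('a \<Rightarrow> real) \<Rightarrow> 'a \<Rightarrow> real" where
  "rshift J t \<xi> = (\<lambda>i. if i \<in> J then \<xi> i + t else \<xi> i)"

lemma of_real_rshift: "(\<lambda>i. of_real (rshift J t \<xi> i)) = shift J (of_real t) (\<lambda>i. of_real (\<xi> i))"
  by (auto simp: rshift_def shift_def)

lemma poly_cpoly_real_line_poly:
  assumes "T \<subseteq> I" "J \<subseteq> T"
  shows "poly (cpoly (real_line_poly T J \<xi>)) t = V T (shift J t (\<lambda>i. of_real (\<xi> i)))"
  using assms finT finite_subset by (subst cpoly_real_line_poly) (auto simp: poly_line_poly)

lemma poly_real_line_poly:
  assumes "T \<subseteq> I" "J \<subseteq> T"
  shows "poly (real_line_poly T J \<xi>) t = RV T (rshift J t \<xi>)"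
proof -
  have "of_real (poly (real_line_poly T J \<xi>) t) = poly (cpoly (real_line_poly T J \<xi>)) (of_real t)" by simp
  also have "\<dots> = of_real (RV T (rshift J t \<xi>))"
    by (simp only: poly_cpoly_real_line_poly[OF assms] of_real_RV[OF assms(1)] of_real_rshift)
  finally show ?thesis by (simp only: of_real_eq_iff)
qed

text \<open>Only the variables in \<open>J\<close> leave the real axis, so stability does not apply
  directly. But since lowering the imaginary parts does not increase the norm, a zero at
  \<open>t\<close> forces zeros on the whole segment down to the real axis, hence the zero
  polynomial.\<close>

lemma real_rooted_line:
  assumes T: "T \<subseteq> I" and st: "upper_nonzero T" and J: "J \<subseteq> T" and nz: "real_line_poly T J \<xi> \<noteq> 0"
  shows "real_rooted (real_line_poly T J \<xi>)"
  unfolding real_rooted_def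
proof safe
  fix t assume t: "Im t > 0" and 0: "poly (cpoly (real_line_poly T J \<xi>)) t = 0"
  let ?p = "cpoly (real_line_poly T J \<xi>)" and ?z = "\<lambda>i. complex_of_real (\<xi> i)"
  have "poly ?p (Complex (Re t) b) = 0" if b: "0 \<le> b" "b \<le> Im t" for b
  proof -
    have "shift J (\<i> * of_real (Im t - b)) (shift J (Complex (Re t) b) ?z) = shift J t ?z"
      by (auto simp: shift_def complex_eq_iff)
    moreover have "cmod (V T (shift J (Complex (Re t) b) ?z)) \<le>
        cmod (V T (shift J (\<i> * of_real (Im t - b)) (shift J (Complex (Re t) b) ?z)))"
      using b by (intro norm_shift_mono[OF T st J]) (auto simp: shift_def)
    ultimately show ?thesis using 0 by (simp add: poly_cpoly_real_line_poly[OF T J])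
  qed
  then have "Complex (Re t) ` {0..Im t} \<subseteq> {x. poly ?p x = 0}" by auto
  moreover have "infinite (Complex (Re t) ` {0..Im t})"
    using t by (subst finite_image_iff) (auto simp: inj_on_def infinite_Icc)
  ultimately have "infinite {x. poly ?p x = 0}" using finite_subset by blast
  then have "?p = 0" using poly_roots_finite by blast
  then show False using nz by (simp add: map_poly_eq_0_iff)
qed

text \<open>Each deletion contributes a ratio with nonpositive imaginary part at the shifted point.
  \<open>J - {i}\<close> appears because the family on \<open>T - {i}\<close> has no variable
  \<open>i\<close> to be shifted.\<close>

lemma pick_line:
  assumes T: "T \<subseteq> I" and st: "upper_nonzero T" and J: "J \<subseteq> T" and L: "L \<subseteq> T" and t: "Im t > 0"
  shows "Im (poly (cpoly (\<Sum>i\<in>L. real_line_poly (T - {i}) (J - {i}) \<xi>)) t * cnj (poly (cpoly (real_line_poly T J \<xi>)) t)) \<le> 0"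
proof -
  let ?z = "shift J t (\<lambda>i. of_real (\<xi> i))"
  have "cpoly (\<Sum>i\<in>L. f i) = (\<Sum>i\<in>L. cpoly (f i))" for f :: "'a \<Rightarrow> real poly"
    by (rule poly_eqI) (simp add: coeff_map_poly coeff_sum)
  then have "poly (cpoly (\<Sum>i\<in>L. real_line_poly (T - {i}) (J - {i}) \<xi>)) t =
      (\<Sum>i\<in>L. poly (cpoly (real_line_poly (T - {i}) (J - {i}) \<xi>)) t)"
    by (simp add: poly_sum)
  also have "\<dots> = (\<Sum>i\<in>L. V (T - {i}) ?z)"
  proof (rule sum.cong[OF refl])
    fix i assume "i \<in> L"
    have "poly (cpoly (real_line_poly (T - {i}) (J - {i}) \<xi>)) t = V (T - {i}) (shift (J - {i}) t (\<lambda>i. of_real (\<xi> i)))"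
      using T J by (intro poly_cpoly_real_line_poly) auto
    also have "\<dots> = V (T - {i}) ?z" using T by (intro cong) (auto simp: shift_def)
    finally show "poly (cpoly (real_line_poly (T - {i}) (J - {i}) \<xi>)) t = V (T - {i}) ?z" .
  qed
  finally have "Im (poly (cpoly (\<Sum>i\<in>L. real_line_poly (T - {i}) (J - {i}) \<xi>)) t * cnj (poly (cpoly (real_line_poly T J \<xi>)) t))
     = (\<Sum>i\<in>L. Im (V (T - {i}) ?z * cnj (V T ?z)))"
    by (simp only: poly_cpoly_real_line_poly[OF T J] sum_distrib_right Im_sum)
  also have "\<dots> \<le> 0"
    using t L by (intro sum_nonpos upper_ratio[OF T st]) (auto simp: shift_def less_imp_le)
  finally show ?thesis .
qed

text \<open>Two cases matter: \<open>J\<close> a block and \<open>L\<close> another one, in the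
  barrier step; \<open>J = T\<close> and \<open>L\<close> a single point, in the choice of the next
  deletion.\<close>

lemma line_partial_fractions:
  assumes T: "T \<subseteq> I" and st: "upper_nonzero T" and J: "J \<subseteq> T" and L: "L \<subseteq> T"
    and nz: "real_line_poly T J \<xi> \<noteq> 0"
    and deg: "degree (\<Sum>i\<in>L. real_line_poly (T - {i}) (J - {i}) \<xi>) \<le> degree (real_line_poly T J \<xi>)"
  shows "\<exists>c s. (\<forall>l. s l \<ge> 0) \<and> (\<Sum>i\<in>L. real_line_poly (T - {i}) (J - {i}) \<xi>) = smult c (real_line_poly T J \<xi>) +
    (\<Sum>l | poly (real_line_poly T J \<xi>) l = 0. smult (s l) (real_line_poly T J \<xi> div [:-l, 1:]))"
  by (rule pick_partial_fractions[OF real_rooted_line[OF T st J nz] pick_line[OF T st J L] deg])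

end

section \<open>Higher derivatives and sums over deletions by blocks\<close>

lemma higher_pderiv_pcompose_linear:
  fixes p :: "'a::{idom,semiring_char_0} poly"
  shows "(pderiv ^^ n) (pcompose p [:y, 1:]) = pcompose ((pderiv ^^ n) p) [:y, 1:]"
  by (induction n) (simp_all add: pderiv_pcompose pderiv_pCons)

lemma poly_higher_pderiv_0:
  fixes p :: "'a::{idom,semiring_char_0} poly"
  shows "poly ((pderiv ^^ n) p) 0 = fact n * coeff p n"
  by (simp add: poly_0_coeff_0 coeff_higher_pderiv pochhammer_fact)

lemma poly_higher_pderiv_translate:
  fixes p q :: "'a::field_char_0 poly"
  assumes "\<And>t. poly p (y + t) = poly q t"
  shows "poly ((pderiv ^^ n) p) y = fact n * coeff q n"
proof -
  have "poly (pcompose p [:y, 1:]) t = poly q t" for t using assms by (simp add: poly_pcompose)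
  then have "pcompose p [:y, 1:] = q" by (metis poly_eq_poly_eq_iff ext)
  then have "poly (pcompose ((pderiv ^^ n) p) [:y, 1:]) 0 = fact n * coeff q n"
    by (simp add: higher_pderiv_pcompose_linear[symmetric] poly_higher_pderiv_0)
  then show ?thesis by (simp add: poly_pcompose)
qed

lemma gauss_lucas_higher:
  fixes p :: "complex poly"
  assumes "n \<le> degree p" and "\<And>t. Im t > a \<Longrightarrow> poly p t \<noteq> 0" and "Im t > a"
  shows "poly ((pderiv ^^ n) p) t \<noteq> 0"
  using assms(1,3)
proof (induction n arbitrary: t)
  case 0
  then show ?case using assms by simp
next
  case (Suc n)
  then show ?case
    using gauss_lucas_half_plane[of "(pderiv ^^ n) p" a t] by (simp add: degree_higher_pderiv)
qed

locale stable_family = real_affine_family I W for I :: "'i set" and W :: "'i set \<Rightarrow> ('i \<Rightarrow> complex) \<Rightarrow> complex" +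
  fixes grp :: "'i \<Rightarrow> 'k"
  assumes stable: "T \<subseteq> I \<Longrightarrow> upper_nonzero T"
begin

definition block :: "'k \<Rightarrow> 'i set \<Rightarrow> 'i set" where
  "block k T = {i \<in> T. grp i = k}"

definition dels :: "('k \<Rightarrow> nat) \<Rightarrow> 'k set \<Rightarrow> 'i set \<Rightarrow> 'i set set" where
  "dels n K T = {A. A \<subseteq> T \<and> grp ` A \<subseteq> K \<and> (\<forall>k\<in>K. card (block k A) = n k)}"

text \<open>Up to a constant factor, this is the image of \<open>W T\<close> under the product over \<open>k \<in> K\<close> of the
  \<open>n k\<close>-th powers of the derivative in the direction of the indicator function of block \<open>k\<close>.\<close>

definition VD :: "('k \<Rightarrow> nat) \<Rightarrow> 'k set \<Rightarrow> 'i set \<Rightarrow> ('i \<Rightarrow> complex) \<Rightarrow> complex" where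
  "VD n K T z = (\<Sum>A\<in>dels n K T. W (T - A) z)"

lemma block_subset: "block k T \<subseteq> T" by (auto simp: block_def)

lemma finite_block: "T \<subseteq> I \<Longrightarrow> finite (block k T)"
  by (rule finite_subset[OF block_subset finT])

lemma finite_dels: "T \<subseteq> I \<Longrightarrow> finite (dels n K T)"
  by (rule finite_subset[of _ "Pow T"]) (auto simp: dels_def finT)

lemma dels_remove: "dels n K (T - {i}) = {A \<in> dels n K T. i \<notin> A}"
  by (auto simp: dels_def)

lemma VD_family: "real_affine_family I (VD n K)"
proof
  show "finite I" by (rule finI)
next
  fix T i z t assume T: "T \<subseteq> I" and i: "i \<in> T"
  have "W (T - A) (z(i := z i + t)) = W (T - A) z + (if i \<notin> A then t * W (T - {i} - A) z else 0)"
    if "A \<in> dels n K T" for A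
  proof (cases "i \<in> A")
    case True
    then show ?thesis using T by (auto intro!: cong)
  next
    case False
    have "T - A - {i} = T - {i} - A" by auto
    with affine[of "T - A" i z t] False T i show ?thesis by auto
  qed
  then have "VD n K T (z(i := z i + t)) = (\<Sum>A\<in>dels n K T. W (T - A) z + (if i \<notin> A then t * W (T - {i} - A) z else 0))"
    unfolding VD_def by (rule sum.cong[OF refl])
  also have "\<dots> = VD n K T z + (\<Sum>A\<in>dels n K T. if i \<notin> A then t * W (T - {i} - A) z else 0)"
    by (simp add: VD_def sum.distrib)
  also have "(\<Sum>A\<in>dels n K T. if i \<notin> A then t * W (T - {i} - A) z else 0) = t * VD n K (T - {i}) z"
    using finite_dels[OF T] unfolding VD_def dels_remove sum_distrib_left
    by (intro sum.mono_neutral_cong_right) auto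
  finally show "VD n K T (z(i := z i + t)) = VD n K T z + t * VD n K (T - {i}) z" .
next
  fix T and z z' :: "'i \<Rightarrow> complex"
  assume T: "T \<subseteq> I" and z: "\<And>i. i \<in> T \<Longrightarrow> z i = z' i"
  have "W (T - A) z = W (T - A) z'" for A
    by (rule cong) (use T z in blast)+
  then show "VD n K T z = VD n K T z'" unfolding VD_def by (simp only:)
next
  fix T and z :: "'i \<Rightarrow> complex"
  assume T: "T \<subseteq> I" and z: "\<And>i. i \<in> T \<Longrightarrow> z i \<in> \<real>"
  have "W (T - A) z \<in> \<real>" for A
    by (rule real) (use T z in blast)+
  then show "VD n K T z \<in> \<real>" unfolding VD_def by (rule sum_in_Reals)
qed

lemma VD_empty: "VD n {} T z = W T z"
proof -
  have "dels n {} T = {{}}" by (auto simp: dels_def)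
  then show ?thesis by (simp add: VD_def)
qed

lemma VD_zero:
  assumes "T \<subseteq> I" "\<And>k. k \<in> K \<Longrightarrow> n k = 0"
  shows "VD n K T z = W T z"
proof -
  have "dels n K T = {{}}"
  proof safe
    fix A x assume A: "A \<in> dels n K T" "x \<in> A"
    then have "grp x \<in> K" by (auto simp: dels_def)
    moreover have "finite (block (grp x) A)"
      using A(1) assms(1) by (intro finite_block) (auto simp: dels_def)
    moreover have "x \<in> block (grp x) A" using A by (auto simp: block_def)
    ultimately show "x \<in> {}" using A assms(2) by (auto simp: dels_def)
  next
    show "{} \<in> dels n K T" using assms(2) by (auto simp: dels_def block_def)
  qed
  then show ?thesis by (simp add: VD_def)
qed

text \<open>A deletion splits into its part in block \<open>k\<close> and the rest. So treating one
  more block means taking the coefficient of order \<open>n k\<close> of a line polynomial of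
  \<open>VD n K\<close>, which permits induction over blocks.\<close>

lemma VD_insert:
  assumes T: "T \<subseteq> I" and k: "k \<notin> K"
  shows "VD n (insert k K) T z = (\<Sum>B | B \<subseteq> block k T \<and> card B = n k. VD n K (T - B) z)"
proof -
  let ?Bs = "{B. B \<subseteq> block k T \<and> card B = n k}"
  have fin: "finite ?Bs" by (rule finite_subset[of _ "Pow (block k T)"]) (auto simp: finite_block[OF T])
  have dB: "dels n K (T - B) = dels n K T" if "B \<in> ?Bs" for B
  proof -
    have "A \<subseteq> T - B \<longleftrightarrow> A \<subseteq> T" if "grp ` A \<subseteq> K" for A
      using that k \<open>B \<in> ?Bs\<close> unfolding block_def by blast
    then show ?thesis unfolding dels_def by (intro Collect_cong) blast
  qed
  have "(\<Sum>B\<in>?Bs. VD n K (T - B) z) = (\<Sum>B\<in>?Bs. \<Sum>A\<in>dels n K T. W (T - (B \<union> A)) z)"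
  proof (rule sum.cong[OF refl])
    fix B assume B: "B \<in> ?Bs"
    have "T - B - A = T - (B \<union> A)" for A by auto
    then show "VD n K (T - B) z = (\<Sum>A\<in>dels n K T. W (T - (B \<union> A)) z)"
      unfolding VD_def dB[OF B] by simp
  qed
  also have "\<dots> = (\<Sum>(B, A)\<in>?Bs \<times> dels n K T. W (T - (B \<union> A)) z)"
    by (rule sum.cartesian_product)
  also have "\<dots> = (\<Sum>C\<in>dels n (insert k K) T. W (T - C) z)"
  proof (rule sum.reindex_bij_witness[where j = "\<lambda>(B, A). B \<union> A" and i = "\<lambda>C. (block k C, C - block k C)"])
    fix p assume "p \<in> ?Bs \<times> dels n K T"
    then obtain B A where p: "p = (B, A)" and B: "B \<subseteq> block k T" "card B = n k" and A: "A \<in> dels n K T" by auto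
    have bk: "block k (B \<union> A) = B" using B A k by (auto simp: block_def dels_def)
    have bj: "block j (B \<union> A) = block j A" if "j \<in> K" for j using B that k by (auto simp: block_def)
    have "B \<inter> A = {}" using B A k by (auto simp: block_def dels_def)
    then have "B \<union> A - B = A" by blast
    then show "(\<lambda>C. (block k C, C - block k C)) ((\<lambda>(B, A). B \<union> A) p) = p"
      unfolding p by (simp only: prod.case bk)
    have "B \<union> A \<subseteq> T" "grp ` (B \<union> A) \<subseteq> insert k K" using A B by (auto simp: dels_def block_def)
    moreover have "\<forall>j\<in>insert k K. card (block j (B \<union> A)) = n j"
      using A B(2) bk bj by (simp add: dels_def)
    ultimately show "(\<lambda>(B, A). B \<union> A) p \<in> dels n (insert k K) T"
      unfolding p dels_def by simp
    show "W (T - (\<lambda>(B, A). B \<union> A) p) z = (\<lambda>(B, A). W (T - (B \<union> A)) z) p" using p by simp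
  next
    fix C assume C: "C \<in> dels n (insert k K) T"
    show "(\<lambda>(B, A). B \<union> A) (block k C, C - block k C) = C" by (auto simp: block_def)
    have 1: "block j (C - block k C) = block j C" if "j \<in> K" for j using that k by (auto simp: block_def)
    have 2: "block k C \<subseteq> block k T" "C - block k C \<subseteq> T" "grp ` (C - block k C) \<subseteq> K"
      using C by (auto simp: dels_def block_def)
    show "(block k C, C - block k C) \<in> ?Bs \<times> dels n K T"
      using C 1 2 by (simp add: dels_def)
  qed
  finally show ?thesis by (simp add: VD_def)
qed

text \<open>The new value is, up to a factorial, the derivative of order \<open>n k\<close> at 0 of
  a polynomial without zeros in a half plane containing 0; Gauss-Lucas applies.\<close>

lemma VD_stable:
  assumes "finite K" "T \<subseteq> I" "\<And>k. k \<in> K \<Longrightarrow> n k \<le> card (block k T)" "\<And>i. i \<in> T \<Longrightarrow> Im (z i) > 0"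
  shows "VD n K T z \<noteq> 0"
  using assms
proof (induction K arbitrary: T z rule: finite_induct)
  case empty
  then show ?case using stable unfolding upper_nonzero_def VD_empty by blast
next
  case (insert k K)
  interpret D: real_affine_family I "VD n K" by (rule VD_family)
  note T = insert.prems(1)
  let ?J = "block k T"
  define p where "p = D.line_poly T ?J z"
  have finJ: "finite ?J" by (rule finite_block[OF T])
  \<comment> \<open>The top coefficient deletes the whole block and is nonzero by induction. Without
    this degree bound the derivative of order \<open>n k\<close> could vanish identically.\<close>
  have "coeff p (card ?J) \<noteq> 0" unfolding p_def D.coeff_line_poly_card[OF finJ]
  proof (rule insert.IH)
    show "T - ?J \<subseteq> I" using T by auto
    fix j assume j: "j \<in> K"
    then have "block j (T - ?J) = block j T" using insert.hyps by (auto simp: block_def)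
    then show "n j \<le> card (block j (T - ?J))" using insert.prems(2) j by auto
  qed (use insert.prems in auto)
  then have "card ?J \<le> degree p" by (rule le_degree)
  then have nd: "n k \<le> degree p" using insert.prems(2)[of k] by simp
  \<comment> \<open>A common positive margin of the imaginary parts puts 0 strictly inside the
    zero-free half plane.\<close>
  obtain d where d: "d > 0" "\<And>i. i \<in> T \<Longrightarrow> d \<le> Im (z i)"
  proof (cases "T = {}")
    case False
    have fT: "finite ((\<lambda>i. Im (z i)) ` T)" using finT[OF T] by simp
    have "Min ((\<lambda>i. Im (z i)) ` T) > 0" using fT False insert.prems(3) by simp
    moreover have "Min ((\<lambda>i. Im (z i)) ` T) \<le> Im (z i)" if "i \<in> T" for i using fT that by simp
    ultimately show ?thesis using that by blast
  qed (use that[of 1] in auto)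
  have nz: "poly p t \<noteq> 0" if t: "Im t > - d" for t
    unfolding p_def D.poly_line_poly[OF T block_subset]
  proof (rule insert.IH[OF T])
    show "Im (shift ?J t z i) > 0" if "i \<in> T" for i
      using d(2)[OF that] t insert.prems(3)[OF that] by (auto simp: shift_def)
  qed (use insert.prems in auto)
  have "poly ((pderiv ^^ n k) p) 0 \<noteq> 0"
    by (rule gauss_lucas_higher[OF nd nz]) (use d in auto)
  then have "coeff p (n k) \<noteq> 0" by (simp add: poly_higher_pderiv_0)
  then show ?case
    unfolding VD_insert[OF T insert.hyps(2)] p_def D.coeff_line_poly[OF finJ] .
qed

lemma VD_upper_nonzero:
  assumes "finite K" "T \<subseteq> I" "\<And>k. k \<in> K \<Longrightarrow> n k \<le> card (block k T)"
  shows "affine_family.upper_nonzero (VD n K) T"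
proof -
  interpret D: real_affine_family I "VD n K" by (rule VD_family)
  show ?thesis using VD_stable[OF assms] unfolding D.upper_nonzero_def by blast
qed

definition RVD :: "('k \<Rightarrow> nat) \<Rightarrow> 'k set \<Rightarrow> 'i set \<Rightarrow> ('i \<Rightarrow> real) \<Rightarrow> real" where
  "RVD n K T \<xi> = Re (VD n K T (\<lambda>i. of_real (\<xi> i)))"

lemma RVD_eq_RV: "RVD n K = real_affine_family.RV (VD n K)"
proof -
  interpret D: real_affine_family I "VD n K" by (rule VD_family)
  show ?thesis by (auto simp: RVD_def D.RV_def fun_eq_iff)
qed

text \<open>Double counting of pairs of a deletion set and one of its points in block
  \<open>k\<close>. Hence \<open>VD n\<close> is, up to a factor, the average of the families after
  one deletion in that block.\<close>

lemma VD_count: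
  assumes T: "T \<subseteq> I" and k: "k \<in> K" and nk: "n k > 0"
  shows "of_nat (n k) * VD n K T z = (\<Sum>i\<in>block k T. VD (n(k := n k - 1)) K (T - {i}) z)"
proof -
  let ?n = "n(k := n k - 1)"
  have "(\<Sum>i\<in>block k T. VD ?n K (T - {i}) z) = (\<Sum>i\<in>block k T. \<Sum>A | A \<in> dels n K T \<and> i \<in> A. W (T - A) z)"
  proof (rule sum.cong[OF refl])
    fix i assume i: "i \<in> block k T"
    show "VD ?n K (T - {i}) z = (\<Sum>A | A \<in> dels n K T \<and> i \<in> A. W (T - A) z)"
      unfolding VD_def
    proof (rule sum.reindex_bij_witness[where j = "insert i" and i = "\<lambda>A. A - {i}"])
      fix A assume A: "A \<in> dels ?n K (T - {i})"
      then have iA: "i \<notin> A" by (auto simp: dels_def)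
      have fin: "finite (block k A)" using A T by (intro finite_block) (auto simp: dels_def)
      have 1: "block k (insert i A) = insert i (block k A)" using i by (auto simp: block_def)
      have 2: "block j (insert i A) = block j A" if "j \<noteq> k" for j using i that by (auto simp: block_def)
      have "card (block k (insert i A)) = n k"
        unfolding 1 using A fin iA k nk by (auto simp: dels_def block_def card_insert_if)
      moreover have "card (block j (insert i A)) = n j" if "j \<in> K" "j \<noteq> k" for j
        using A that 2[OF that(2)] by (simp add: dels_def)
      moreover have "insert i A \<subseteq> T" "grp ` insert i A \<subseteq> K" using A i k by (auto simp: dels_def block_def)
      ultimately show "insert i A \<in> {A. A \<in> dels n K T \<and> i \<in> A}"
        unfolding dels_def by blast
      show "insert i A - {i} = A" using iA by auto
      show "W (T - insert i A) z = W (T - {i} - A) z" by (subst Diff_insert2) (rule refl)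
    next
      fix A assume "A \<in> {A. A \<in> dels n K T \<and> i \<in> A}"
      then have A: "A \<in> dels n K T" and iA: "i \<in> A" by auto
      show "insert i (A - {i}) = A" using iA by auto
      have fin: "finite (block k A)" using A T by (intro finite_block) (auto simp: dels_def)
      have 1: "block k (A - {i}) = block k A - {i}" by (auto simp: block_def)
      have 2: "block j (A - {i}) = block j A" if "j \<noteq> k" for j using i that by (auto simp: block_def)
      have "i \<in> block k A" using i iA by (auto simp: block_def)
      then have "card (block k (A - {i})) = n k - 1" unfolding 1 using A k fin by (simp add: dels_def)
      moreover have "card (block j (A - {i})) = n j" if "j \<in> K" "j \<noteq> k" for j
        using A that 2[OF that(2)] by (simp add: dels_def)
      moreover have "A - {i} \<subseteq> T - {i}" "grp ` (A - {i}) \<subseteq> K" using A by (auto simp: dels_def)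
      ultimately show "A - {i} \<in> dels ?n K (T - {i})"
        unfolding dels_def by simp
    qed
  qed
  also have "\<dots> = (\<Sum>i\<in>block k T. \<Sum>A\<in>dels n K T. if i \<in> A then W (T - A) z else 0)"
    using finite_dels[OF T] by (intro sum.cong refl sum.mono_neutral_cong_left) auto
  also have "\<dots> = (\<Sum>A\<in>dels n K T. \<Sum>i\<in>block k T. if i \<in> A then W (T - A) z else 0)"
    by (rule sum.swap)
  also have "\<dots> = (\<Sum>A\<in>dels n K T. of_nat (n k) * W (T - A) z)"
  proof (rule sum.cong[OF refl])
    fix A assume A: "A \<in> dels n K T"
    have "(\<Sum>i\<in>block k T. if i \<in> A then W (T - A) z else 0) = (\<Sum>i\<in>block k T \<inter> A. W (T - A) z)"
      by (rule sum.inter_restrict[OF finite_block[OF T], symmetric])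
    also have "block k T \<inter> A = block k A" using A by (auto simp: block_def dels_def)
    finally show "(\<Sum>i\<in>block k T. if i \<in> A then W (T - A) z else 0) = of_nat (n k) * W (T - A) z"
      using A k by (simp add: dels_def)
  qed
  finally show ?thesis by (simp add: VD_def sum_distrib_left)
qed

end

section \<open>The barrier invariant and the choice of deletions\<close>

context stable_family
begin

lemma RVD_insert:
  assumes "T \<subseteq> I" "k \<notin> K"
  shows "RVD n (insert k K) T \<xi> = (\<Sum>B | B \<subseteq> block k T \<and> card B = n k. RVD n K (T - B) \<xi>)"
  unfolding RVD_def VD_insert[OF assms] by simp

definition admissible :: "'k set \<Rightarrow> 'i set \<Rightarrow> bool" where
  "admissible K T \<longleftrightarrow> T \<subseteq> I \<and> (\<forall>k\<in>K. block k I \<subseteq> T) \<and> (\<forall>k. block k I \<subseteq> T \<or> block k I \<inter> T = {})"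

text \<open>Positivity and the barrier bound are needed not only on \<open>I\<close> but on all unions of blocks
  containing the processed ones: they supply the leading coefficients of the line polynomials.\<close>

definition barrier_inv :: "('k \<Rightarrow> nat) \<Rightarrow> real \<Rightarrow> real \<Rightarrow> real \<Rightarrow> 'k set \<Rightarrow> bool" where
  "barrier_inv n \<phi> x \<delta> K \<longleftrightarrow> (\<forall>T \<xi>. admissible K T \<longrightarrow> (\<forall>k. \<xi> k \<ge> (if k \<in> K then x - \<delta> else x)) \<longrightarrow>
     RVD n K T (\<lambda>i. \<xi> (grp i)) > 0 \<and>
     (\<forall>j. j \<notin> K \<longrightarrow> block j I \<subseteq> T \<longrightarrow>
        (\<Sum>i\<in>block j I. RVD n K (T - {i}) (\<lambda>i. \<xi> (grp i))) \<le> \<phi> * RVD n K T (\<lambda>i. \<xi> (grp i))))"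

text \<open>In the direction of block \<open>k\<close> the family restricts to a polynomial
  \<open>p\<close> with a barrier at 0, whose derivative of order m + 1 at - m / \<phi> is, up to a
  factorial, the family for \<open>insert k K\<close> at the shifted point. For another block
  \<open>j\<close>, the derivative \<open>q\<close> in its direction has nonnegative residues over
  \<open>p\<close>, so \<open>barrier_ratio\<close> keeps its barrier at
  \<open>\<phi>\<close>.\<close>

lemma barrier_inv_step:
  assumes inv: "barrier_inv n \<phi> x \<delta> K" and finK: "finite K" and k: "k \<notin> K"
    and \<phi>: "\<phi> > 0" and nk: "n k = Suc m" and m: "m < card (block k I)" and \<delta>: "\<delta> = m / \<phi>"
    and nK: "\<And>k. k \<in> K \<Longrightarrow> n k \<le> card (block k I)"
  shows "barrier_inv n \<phi> x \<delta> (insert k K)"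
  unfolding barrier_inv_def
proof (intro allI impI)
  fix T \<xi>
  assume adm: "admissible (insert k K) T" and \<xi>: "\<forall>j. \<xi> j \<ge> (if j \<in> insert k K then x - \<delta> else x)"
  interpret D: real_affine_family I "VD n K" by (rule VD_family)
  note RV = RVD_eq_RV[of n K, symmetric]
  define J where "J = block k I"
  have T: "T \<subseteq> I" and JT: "J \<subseteq> T" using adm by (auto simp: admissible_def J_def)
  have bT: "block k T = J" using T JT by (auto simp: J_def block_def)
  have finJ: "finite J" unfolding J_def by (rule finite_block) simp
  have admT: "admissible K T" using adm by (auto simp: admissible_def)
  have admTJ: "admissible K (T - J)"
    unfolding admissible_def
  proof (intro conjI allI ballI)
    have disj: "block j I \<inter> J = {}" if "j \<noteq> k" for j using that by (auto simp: J_def block_def)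
    show "T - J \<subseteq> I" using T by auto
    show "block j I \<subseteq> T - J" if j: "j \<in> K" for j
    proof -
      have "block j I \<subseteq> T" "j \<noteq> k" using adm j k by (auto simp: admissible_def)
      then show ?thesis using disj by blast
    qed
    show "block j I \<subseteq> T - J \<or> block j I \<inter> (T - J) = {}" for j
    proof (cases "j = k")
      case False
      have "block j I \<subseteq> T \<or> block j I \<inter> T = {}" using adm by (auto simp: admissible_def)
      then show ?thesis using disj[OF False] by blast
    qed (auto simp: J_def)
  qed
  have blockT: "block j T = block j I" if "j \<in> K" for j
    using admT that by (auto simp: admissible_def block_def)
  have st: "D.upper_nonzero T"
    by (rule VD_upper_nonzero[OF finK T]) (use nK blockT in auto)
  \<comment> \<open>\<open>\<eta>\<close> undoes the shift in block \<open>k\<close>: the invariant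
    for \<open>K\<close> applies at \<open>\<eta>\<close>, and the point - m / \<phi> of the line
    leads back to \<open>\<xi>\<close>.\<close>
  define \<eta> where "\<eta> = \<xi>(k := \<xi> k + \<delta>)"
  have \<eta>: "\<eta> j \<ge> (if j \<in> K then x - \<delta> else x)" for j
    using \<xi>[rule_format, of j] k by (cases "j = k") (auto simp: \<eta>_def)
  let ?z = "\<lambda>i. \<eta> (grp i)"
  define p where "p = D.real_line_poly T J ?z"
  have sh: "RVD n K S (D.rshift J t ?z) = RVD n K S (\<lambda>i. (\<eta>(k := \<eta> k + t)) (grp i))" if "S \<subseteq> I" for S t
  proof -
    have "VD n K S (\<lambda>i. of_real (D.rshift J t ?z i)) = VD n K S (\<lambda>i. of_real ((\<eta>(k := \<eta> k + t)) (grp i)))"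
      using that by (intro D.cong) (auto simp: D.rshift_def J_def block_def)
    then show ?thesis by (simp add: RVD_def)
  qed
  have py: "poly p t = RVD n K T (\<lambda>i. (\<eta>(k := \<eta> k + t)) (grp i))" for t
    unfolding p_def D.poly_real_line_poly[OF T JT] RV sh[OF T] ..
  have ppos: "poly p t > 0" if "t \<ge> 0" for t
  proof -
    have "(\<eta>(k := \<eta> k + t)) j \<ge> (if j \<in> K then x - \<delta> else x)" for j
      using \<eta>[of j] that by (cases "j = k") auto
    then show ?thesis unfolding py using inv admT unfolding barrier_inv_def by blast
  qed
  have top: "coeff p (card J) > 0"
  proof -
    have "{B. B \<subseteq> J \<and> card B = card J} = {J}" using finJ card_subset_eq by blast
    then have "coeff p (card J) = RVD n K (T - J) ?z"
      unfolding p_def D.coeff_real_line_poly[OF T finJ] RV by simp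
    then show ?thesis using inv admTJ \<eta> unfolding barrier_inv_def by simp
  qed
  have degp_le: "degree p \<le> card J"
  proof -
    have "degree p = degree (cpoly p)" by simp
    also have "\<dots> \<le> card J"
      unfolding p_def D.cpoly_real_line_poly[OF T finJ] by (rule D.degree_line_poly_le[OF finJ])
    finally show ?thesis .
  qed
  then have degp: "degree p = card J" using top le_degree[of p "card J"] by simp
  have p0: "p \<noteq> 0" using top by auto
  have rr: "real_rooted p" unfolding p_def by (rule D.real_rooted_line[OF T st JT]) (use p0 p_def in simp)
  have bar: "barrier \<phi> p 0"
    unfolding barrier_def
  proof (intro conjI allI impI rr ppos)
    show "lead_coeff p > 0" using top degp by simp
    have "{B. B \<subseteq> J \<and> card B = 1} = (\<lambda>i. {i}) ` J" by (auto simp: card_1_singleton_iff)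
    then have "coeff p 1 = (\<Sum>i\<in>J. RVD n K (T - {i}) ?z)"
      unfolding p_def D.coeff_real_line_poly[OF T finJ] RV by (simp add: sum.reindex inj_on_def)
    also have "\<dots> \<le> \<phi> * RVD n K T ?z"
      using inv admT \<eta> k JT unfolding barrier_inv_def J_def by blast
    also have "RVD n K T ?z = poly p 0" unfolding py by simp
    finally show "poly (pderiv p) 0 \<le> \<phi> * poly p 0"
      by (simp add: poly_0_coeff_0 coeff_pderiv)
  qed
  have y: "\<eta>(k := \<eta> k + - (m / \<phi>)) = \<xi>" by (simp add: \<eta>_def \<delta>)
  have taylor: "poly ((pderiv ^^ Suc m) (D.real_line_poly S J ?z)) (- (m / \<phi>)) =
      fact (Suc m) * RVD n (insert k K) S (\<lambda>i. \<xi> (grp i))" if S: "S \<subseteq> I" "J \<subseteq> S" for S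
  proof -
    have "poly (D.real_line_poly S J ?z) (- (m / \<phi>) + t) = poly (D.real_line_poly S J (\<lambda>i. \<xi> (grp i))) t" for t
    proof -
      have "D.rshift J (- (m / \<phi>) + t) ?z i = D.rshift J t (\<lambda>i. \<xi> (grp i)) i" if "i \<in> I" for i
        using that by (auto simp: D.rshift_def J_def block_def \<eta>_def \<delta>)
      then have "RVD n K S (D.rshift J (- (m / \<phi>) + t) ?z) = RVD n K S (D.rshift J t (\<lambda>i. \<xi> (grp i)))"
        unfolding RVD_def using S by (intro arg_cong[where f = Re] D.cong) auto
      then show ?thesis by (simp only: D.poly_real_line_poly[OF S] RV)
    qed
    then have "poly ((pderiv ^^ Suc m) (D.real_line_poly S J ?z)) (- (m / \<phi>)) =
      fact (Suc m) * coeff (D.real_line_poly S J (\<lambda>i. \<xi> (grp i))) (Suc m)"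
      by (rule poly_higher_pderiv_translate)
    also have "coeff (D.real_line_poly S J (\<lambda>i. \<xi> (grp i))) (Suc m) = RVD n (insert k K) S (\<lambda>i. \<xi> (grp i))"
    proof -
      have "block k S = J" using S by (auto simp: J_def block_def)
      then show ?thesis
        unfolding D.coeff_real_line_poly[OF S(1) finJ] RVD_insert[OF S(1) k] RV nk by simp
    qed
    finally show ?thesis .
  qed
  have mp: "m < degree p" using m degp by (simp add: J_def)
  \<comment> \<open>Only positivity of the derivative is wanted here, so the zero polynomial with an
    empty sum serves as \<open>q\<close>.\<close>
  have "poly ((pderiv ^^ Suc m) p) (- (m / \<phi>)) > 0"
    by (rule barrier_ratio(1)[OF bar \<phi> mp, where q = 0 and c = 0 and s = "\<lambda>_. 0" and R = "{}"]) auto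
  then have pos: "RVD n (insert k K) T (\<lambda>i. \<xi> (grp i)) > 0"
    unfolding p_def taylor[OF T JT] by (simp add: zero_less_mult_iff del: fact_Suc)
  show "RVD n (insert k K) T (\<lambda>i. \<xi> (grp i)) > 0 \<and>
     (\<forall>j. j \<notin> insert k K \<longrightarrow> block j I \<subseteq> T \<longrightarrow>
        (\<Sum>i\<in>block j I. RVD n (insert k K) (T - {i}) (\<lambda>i. \<xi> (grp i))) \<le> \<phi> * RVD n (insert k K) T (\<lambda>i. \<xi> (grp i)))"
  proof (intro conjI allI impI pos)
    fix j assume j: "j \<notin> insert k K" and jT: "block j I \<subseteq> T"
    define L where "L = block j I"
    have LJ: "i \<notin> J" if "i \<in> L" for i using that j by (auto simp: L_def J_def block_def)
    define q where "q = (\<Sum>i\<in>L. D.real_line_poly (T - {i}) (J - {i}) ?z)"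
    have q': "q = (\<Sum>i\<in>L. D.real_line_poly (T - {i}) J ?z)"
      unfolding q_def using LJ by (intro sum.cong) auto
    have Ti: "T - {i} \<subseteq> I" "J \<subseteq> T - {i}" if "i \<in> L" for i using T JT LJ[OF that] by auto
    have "degree (D.real_line_poly (T - {i}) J ?z) \<le> card J" if "i \<in> L" for i
    proof -
      have "degree (D.real_line_poly (T - {i}) J ?z) = degree (cpoly (D.real_line_poly (T - {i}) J ?z))" by simp
      also have "\<dots> \<le> card J"
        unfolding D.cpoly_real_line_poly[OF Ti(1)[OF that] finJ] by (rule D.degree_line_poly_le[OF finJ])
      finally show ?thesis .
    qed
    then have "degree q \<le> degree p"
      unfolding q' degp by (intro degree_sum_le) (auto simp: L_def finite_block)
    then obtain c s where s: "\<forall>l. s l \<ge> 0" and qc: "q = smult c p + (\<Sum>l | poly p l = 0. smult (s l) (p div [:-l, 1:]))"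
      using D.line_partial_fractions[OF T st JT, of L ?z] jT p0 unfolding p_def q_def L_def by blast
    have "poly ((pderiv ^^ Suc m) q) (- (m / \<phi>)) * poly p 0 \<le> poly q 0 * poly ((pderiv ^^ Suc m) p) (- (m / \<phi>))"
      by (rule barrier_ratio(2)[OF bar \<phi> mp qc poly_roots_finite[OF p0]]) (use s in auto)
    moreover have "poly ((pderiv ^^ Suc m) q) (- (m / \<phi>)) =
        fact (Suc m) * (\<Sum>i\<in>L. RVD n (insert k K) (T - {i}) (\<lambda>i. \<xi> (grp i)))"
      unfolding q' higher_pderiv_sum poly_sum sum_distrib_left
      by (intro sum.cong refl taylor Ti)
    moreover have "poly ((pderiv ^^ Suc m) p) (- (m / \<phi>)) = fact (Suc m) * RVD n (insert k K) T (\<lambda>i. \<xi> (grp i))"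
      unfolding p_def by (rule taylor[OF T JT])
    ultimately have "fact (Suc m) * ((\<Sum>i\<in>L. RVD n (insert k K) (T - {i}) (\<lambda>i. \<xi> (grp i))) * poly p 0) \<le>
        fact (Suc m) * (poly q 0 * RVD n (insert k K) T (\<lambda>i. \<xi> (grp i)))"
      by (simp only: mult_ac)
    then have 1: "(\<Sum>i\<in>L. RVD n (insert k K) (T - {i}) (\<lambda>i. \<xi> (grp i))) * poly p 0 \<le>
        poly q 0 * RVD n (insert k K) T (\<lambda>i. \<xi> (grp i))"
      by (simp del: fact_Suc)
    have "poly q 0 = (\<Sum>i\<in>L. RVD n K (T - {i}) ?z)"
    proof -
      have "poly (D.real_line_poly (T - {i}) J ?z) 0 = RVD n K (T - {i}) ?z" if "i \<in> L" for i
        unfolding D.poly_real_line_poly[OF Ti[OF that]] RV sh[OF Ti(1)[OF that]] by simp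
      then show ?thesis unfolding q' poly_sum by (intro sum.cong) auto
    qed
    also have "\<dots> \<le> \<phi> * RVD n K T ?z"
      using inv admT \<eta> j jT unfolding barrier_inv_def L_def by blast
    also have "RVD n K T ?z = poly p 0" unfolding py by simp
    finally have "poly q 0 * RVD n (insert k K) T (\<lambda>i. \<xi> (grp i)) \<le>
        \<phi> * poly p 0 * RVD n (insert k K) T (\<lambda>i. \<xi> (grp i))"
      using pos by (intro mult_right_mono) auto
    with 1 have "poly p 0 * (\<Sum>i\<in>L. RVD n (insert k K) (T - {i}) (\<lambda>i. \<xi> (grp i))) \<le>
        poly p 0 * (\<phi> * RVD n (insert k K) T (\<lambda>i. \<xi> (grp i)))"
      by (simp add: mult_ac)
    then show "(\<Sum>i\<in>block j I. RVD n (insert k K) (T - {i}) (\<lambda>i. \<xi> (grp i))) \<le> \<phi> * RVD n (insert k K) T (\<lambda>i. \<xi> (grp i))"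
      using ppos[of 0] unfolding L_def by simp
  qed
qed

lemma barrier_inv_all:
  assumes "finite K" "barrier_inv n \<phi> x \<delta> {}" "\<phi> > 0"
    and "\<And>k. k \<in> K \<Longrightarrow> n k = Suc m" "\<And>k. k \<in> K \<Longrightarrow> m < card (block k I)" "\<delta> = m / \<phi>"
  shows "barrier_inv n \<phi> x \<delta> K"
  using assms(1,4,5)
proof (induction K rule: finite_induct)
  case empty
  then show ?case using assms by simp
next
  case (insert k K)
  show ?case
    by (rule barrier_inv_step[OF _ insert.hyps(1,2) assms(3) _ _ assms(6)])
       (use insert in \<open>auto simp: Suc_le_eq\<close>)
qed

text \<open>The candidates \<open>F i\<close> are partial derivatives of the family with one
  deletion fewer in block \<open>k\<close>, restricted to the diagonal line. They share its
  restriction \<open>p\<close> as interlacer, and by \<open>VD_count\<close> their sum is a multiple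
  of the given polynomial without roots above \<open>\<rho>\<close>.\<close>

lemma selection_step:
  assumes finK: "finite K" and T: "T \<subseteq> I" and n: "\<And>j. j \<in> K \<Longrightarrow> n j \<le> card (block j T)"
    and k: "k \<in> K" and nk: "n k > 0"
    and posX: "\<And>S x. S \<subseteq> I \<Longrightarrow> x > X \<Longrightarrow> Re (W S (\<lambda>i. of_real x)) > 0"
    and pos: "\<And>x. x > \<rho> \<Longrightarrow> RVD n K T (\<lambda>i. x) > 0"
  shows "\<exists>i\<in>block k T. \<forall>x>\<rho>. RVD (n(k := n k - 1)) K (T - {i}) (\<lambda>i. x) > 0"
proof -
  let ?n = "n(k := n k - 1)"
  interpret D: real_affine_family I "VD ?n K" by (rule VD_family)
  note RV = RVD_eq_RV[of ?n K, symmetric]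
  have n': "?n j \<le> card (block j T)" if "j \<in> K" for j
    using n[OF that] by (cases "j = k") auto
  have n'i: "?n j \<le> card (block j (T - {i}))" if "j \<in> K" "i \<in> block k T" for i j
  proof (cases "j = k")
    case True
    have "block k (T - {i}) = block k T - {i}" by (auto simp: block_def)
    then show ?thesis using n[OF k] nk that finite_block[OF T] True by simp
  next
    case False
    have "block j (T - {i}) = block j T" using that False by (auto simp: block_def)
    then show ?thesis using n[OF that(1)] False by simp
  qed
  have VDpos: "RVD ?n K S (\<lambda>i. x) > 0" if S: "S \<subseteq> I" and nS: "\<And>j. j \<in> K \<Longrightarrow> ?n j \<le> card (block j S)" and x: "x > X" for S x
  proof -
    have "VD ?n K S (\<lambda>i. \<i>) \<noteq> 0" by (rule VD_stable[OF finK S nS]) auto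
    then have "dels ?n K S \<noteq> {}" by (auto simp: VD_def)
    then have "(\<Sum>A\<in>dels ?n K S. Re (W (S - A) (\<lambda>i. of_real x))) > 0"
      using S x finite_dels[OF S] by (intro sum_pos posX) auto
    then show ?thesis by (simp add: RVD_def VD_def)
  qed
  have st: "D.upper_nonzero T" by (rule VD_upper_nonzero[OF finK T n'])
  \<comment> \<open>At \<open>c\<close> all minors are positive; the coefficients of the line
    polynomials based there are sums of them, hence nonnegative.\<close>
  define c where "c = X + 1"
  define p where "p = D.real_line_poly T T (\<lambda>i. c)"
  have sh: "RVD ?n K S (D.rshift S x (\<lambda>i. c)) = RVD ?n K S (\<lambda>i. c + x)" if "S \<subseteq> I" for S x
    unfolding RVD_def using that by (intro arg_cong[where f = Re] D.cong) (auto simp: D.rshift_def)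
  have px: "poly p x = RVD ?n K T (\<lambda>i. c + x)" for x
    unfolding p_def D.poly_real_line_poly[OF T order.refl] RV sh[OF T] ..
  have pX: "poly p x > 0" if "x > -1" for x
    unfolding px by (rule VDpos[OF T n']) (use that in \<open>auto simp: c_def\<close>)
  have p0: "p \<noteq> 0" using pX[of 0] by auto
  have rr: "real_rooted p" unfolding p_def by (rule D.real_rooted_line[OF T st order.refl]) (use p0 p_def in simp)
  define F where "F = (\<lambda>i. D.real_line_poly (T - {i}) (T - {i}) (\<lambda>i. c))"
  have Fx: "poly (F i) x = RVD ?n K (T - {i}) (\<lambda>i. c + x)" for i x
  proof -
    have S: "T - {i} \<subseteq> I" using T by auto
    show ?thesis unfolding F_def D.poly_real_line_poly[OF S order.refl] RV sh[OF S] ..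
  qed
  have FX: "poly (F i) x > 0" if "i \<in> block k T" "x > -1" for i x
    unfolding Fx by (rule VDpos) (use T n'i that in \<open>auto simp: c_def\<close>)
  have finT': "finite T" by (rule finT[OF T])
  have nonneg: "RVD ?n K S (\<lambda>i. c) \<ge> 0" if "S \<subseteq> I" for S
  proof -
    have "(\<Sum>A\<in>dels ?n K S. Re (W (S - A) (\<lambda>i. of_real c))) \<ge> 0"
      by (rule sum_nonneg, rule less_imp_le, rule posX) (use that in \<open>auto simp: c_def\<close>)
    then show ?thesis by (simp add: RVD_def VD_def)
  qed
  \<comment> \<open>Nonnegative terms cannot cancel: a set \<open>B\<close> contributing to the top
    coefficient of \<open>F i\<close> makes \<open>insert i B\<close> contribute to the next higher
    coefficient of \<open>p\<close>.\<close>
  have degF: "degree (F i) \<le> degree p" if i: "i \<in> block k T" for i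
  proof -
    have iT: "i \<in> T" using i by (auto simp: block_def)
    have S: "T - {i} \<subseteq> I" "finite (T - {i})" using T finT' by auto
    define d where "d = degree (F i)"
    have "F i \<noteq> 0" using FX[OF i, of 0] by auto
    then have "coeff (F i) d \<noteq> 0" by (simp add: d_def)
    then obtain B where B: "B \<subseteq> T - {i}" "card B = d" "RVD ?n K (T - {i} - B) (\<lambda>i. c) \<noteq> 0"
      unfolding F_def D.coeff_real_line_poly[OF S] RV by (auto elim: sum.not_neutral_contains_not_neutral)
    have "finite B" "i \<notin> B" using B(1) S(2) finite_subset by auto
    then have cB: "card (insert i B) = Suc d" using B(2) by simp
    have "T - {i} - B = T - insert i B" by auto
    then have "RVD ?n K (T - insert i B) (\<lambda>i. c) > 0" using B(3) nonneg[of "T - insert i B"] T by (auto simp: less_le)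
    moreover have "insert i B \<subseteq> T" using B(1) iT by auto
    moreover have "finite {B. B \<subseteq> T \<and> card B = Suc d}"
      by (rule finite_subset[of _ "Pow T"]) (use finT' in auto)
    ultimately have "coeff p (Suc d) > 0"
      unfolding p_def D.coeff_real_line_poly[OF T finT'] RV
      using cB T by (intro sum_pos2[where i = "insert i B"] nonneg) auto
    then show ?thesis using le_degree[of p "Suc d"] by (simp add: d_def)
  qed
  have "\<exists>cs. (\<forall>l. snd cs l \<ge> 0) \<and> F i = smult (fst cs) p + (\<Sum>l | poly p l = 0. smult (snd cs l) (p div [:-l, 1:]))"
    if i: "i \<in> block k T" for i
    using D.line_partial_fractions[OF T st order.refl, of "{i}" "\<lambda>i. c"] degF[OF i] p0 i
    unfolding p_def F_def by (auto simp: block_def)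
  then have "\<forall>i\<in>block k T. \<exists>cs. (\<forall>l. snd cs l \<ge> 0) \<and> F i = smult (fst cs) p + (\<Sum>l | poly p l = 0. smult (snd cs l) (p div [:-l, 1:]))"
    by blast
  from bchoice[OF this] obtain cs where cs: "\<forall>i\<in>block k T. (\<forall>l. snd (cs i) l \<ge> 0) \<and>
      F i = smult (fst (cs i)) p + (\<Sum>l | poly p l = 0. smult (snd (cs i) l) (p div [:-l, 1:]))" ..
  have sum: "(\<Sum>i\<in>block k T. poly (F i) x) > 0" if x: "x > \<rho> - c" for x
  proof -
    have "(\<Sum>i\<in>block k T. poly (F i) x) = Re (\<Sum>i\<in>block k T. VD ?n K (T - {i}) (\<lambda>i. of_real (c + x)))"
      unfolding Fx RVD_def by (rule Re_sum[symmetric])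
    also have "\<dots> = Re (of_nat (n k) * VD n K T (\<lambda>i. of_real (c + x)))"
      unfolding VD_count[where n = n, OF T k nk] ..
    also have "\<dots> = n k * RVD n K T (\<lambda>i. c + x)"
      unfolding RVD_def by simp
    finally show ?thesis using pos[of "c + x"] x nk by simp
  qed
  have "\<exists>i\<in>block k T. \<forall>x>\<rho> - c. poly (F i) x > 0"
  proof (rule common_interlacing_selection[where p = p and c = "\<lambda>i. fst (cs i)" and s = "\<lambda>i. snd (cs i)" and X = "-1"])
    show "F i = smult (fst (cs i)) p + (\<Sum>l | poly p l = 0. smult (snd (cs i) l) (p div [:-l, 1:]))" if "i \<in> block k T" for i
      using cs that by blast
    show "snd (cs i) l \<ge> 0" if "i \<in> block k T" for i l
      using cs that by blast
  qed (fact finite_block[OF T] rr pX FX sum)+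
  then obtain i where i: "i \<in> block k T" "\<forall>x>\<rho> - c. poly (F i) x > 0" ..
  have "RVD ?n K (T - {i}) (\<lambda>i. x) > 0" if "x > \<rho>" for x
    using i(2)[rule_format, of "x - c"] that by (simp add: Fx)
  then show ?thesis using i(1) by blast
qed

text \<open>Induction on the number of deletions left. Each choice preserves positivity above
  \<open>\<rho>\<close>, so the root bound of the averaged polynomial passes to one actual principal
  submatrix.\<close>

lemma selection:
  assumes finK: "finite K" and T: "T \<subseteq> I" and n: "\<And>j. j \<in> K \<Longrightarrow> n j \<le> card (block j T)"
    and posX: "\<And>S x. S \<subseteq> I \<Longrightarrow> x > X \<Longrightarrow> Re (W S (\<lambda>i. of_real x)) > 0"
    and pos: "\<And>x. x > \<rho> \<Longrightarrow> RVD n K T (\<lambda>i. x) > 0"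
  shows "\<exists>A\<in>dels n K T. \<forall>x>\<rho>. Re (W (T - A) (\<lambda>i. of_real x)) > 0"
  using T n pos
proof (induction "\<Sum>k\<in>K. n k" arbitrary: n T)
  case 0
  then have n0: "\<And>k. k \<in> K \<Longrightarrow> n k = 0" using finK by simp
  have "{} \<in> dels n K T" using n0 by (auto simp: dels_def block_def)
  moreover have "Re (W (T - {}) (\<lambda>i. of_real x)) > 0" if "x > \<rho>" for x
    using 0(4)[OF that] by (simp add: RVD_def VD_zero[OF 0(2) n0])
  ultimately show ?case by blast
next
  case (Suc N)
  have "\<exists>k\<in>K. n k > 0"
  proof (rule ccontr)
    assume "\<not> (\<exists>k\<in>K. n k > 0)"
    then have "(\<Sum>k\<in>K. n k) = 0" by simp
    with Suc.hyps(2) show False by simp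
  qed
  then obtain k where k: "k \<in> K" "n k > 0" by blast
  let ?n = "n(k := n k - 1)"
  obtain i where i: "i \<in> block k T" "\<And>x. x > \<rho> \<Longrightarrow> RVD ?n K (T - {i}) (\<lambda>i. x) > 0"
    using selection_step[OF finK Suc.prems(1,2) k posX Suc.prems(3)] by blast
  have N: "N = (\<Sum>k\<in>K. ?n k)"
  proof -
    have "(\<Sum>k\<in>K. n k) = n k + (\<Sum>k\<in>K - {k}. n k)" using finK k by (simp add: sum.remove)
    moreover have "(\<Sum>k\<in>K. ?n k) = ?n k + (\<Sum>k\<in>K - {k}. ?n k)" using finK k by (subst sum.remove[of K k]) auto
    moreover have "(\<Sum>j\<in>K - {k}. ?n j) = (\<Sum>k\<in>K - {k}. n k)" by (intro sum.cong) auto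
    ultimately show ?thesis using Suc.hyps(2) k by simp
  qed
  have n': "?n j \<le> card (block j (T - {i}))" if j: "j \<in> K" for j
  proof (cases "j = k")
    case True
    have "block k (T - {i}) = block k T - {i}" by (auto simp: block_def)
    then show ?thesis using Suc.prems(2)[OF k(1)] k(2) i(1) finite_block[OF Suc.prems(1)] True by simp
  next
    case False
    have "block j (T - {i}) = block j T" using i False by (auto simp: block_def)
    then show ?thesis using Suc.prems(2)[OF j] False by simp
  qed
  have Ti: "T - {i} \<subseteq> I" using Suc.prems(1) by auto
  obtain A where A: "A \<in> dels ?n K (T - {i})" "\<forall>x>\<rho>. Re (W (T - {i} - A) (\<lambda>i. of_real x)) > 0"
    using Suc.hyps(1)[OF N Ti n' i(2)] by blast
  have iA: "i \<notin> A" using A by (auto simp: dels_def)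
  have fin: "finite (block k A)" using A Ti by (intro finite_block) (auto simp: dels_def)
  have 1: "block k (insert i A) = insert i (block k A)" using i by (auto simp: block_def)
  have 2: "block j (insert i A) = block j A" if "j \<noteq> k" for j using i that by (auto simp: block_def)
  have "i \<notin> block k A" using iA by (auto simp: block_def)
  then have "card (block k (insert i A)) = n k"
    unfolding 1 using A fin k by (simp add: dels_def)
  moreover have "card (block j (insert i A)) = n j" if "j \<in> K" "j \<noteq> k" for j
    using A that 2[OF that(2)] by (simp add: dels_def)
  moreover have "insert i A \<subseteq> T" "grp ` insert i A \<subseteq> K" using A i k by (auto simp: dels_def block_def)
  ultimately have "insert i A \<in> dels n K T"
    unfolding dels_def by blast
  moreover have "T - {i} - A = T - insert i A" by auto
  ultimately show ?case using A(2) by metis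
qed

end

section \<open>The selection theorem for contractions\<close>

context contraction
begin

lemma stable_family_char_minor: "stable_family {..<N} (char_minor N M)"
proof -
  interpret F: real_affine_family "{..<N}" "char_minor N M"
  proof
    show "finite {..<N}" by simp
  next
    fix T i z t assume "T \<subseteq> {..<N}" "i \<in> T"
    then show "char_minor N M T (z(i := z i + t)) = char_minor N M T z + t * char_minor N M (T - {i}) z"
      by (intro char_minor_affine) auto
  next
    fix T and z z' :: "nat \<Rightarrow> complex" assume "\<And>i. i \<in> T \<Longrightarrow> z i = z' i"
    then have "minor_mat N M T z = minor_mat N M T z'"
      unfolding minor_mat_def by (intro cong_mat) auto
    then show "char_minor N M T z = char_minor N M T z'" by (simp add: char_minor_def)
  next
    fix T and z :: "nat \<Rightarrow> complex" assume "T \<subseteq> {..<N}" "\<And>i. i \<in> T \<Longrightarrow> z i \<in> \<real>"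
    then show "char_minor N M T z \<in> \<real>" using char_minor_real sub(2) by blast
  qed
  show ?thesis
  proof
    fix T assume T: "T \<subseteq> {..<N}"
    show "F.upper_nonzero T" unfolding F.upper_nonzero_def
      using char_minor_upper_half[OF T sub(2)[OF T]] by blast
  qed
qed

text \<open>All variables start at 1 + t, where every block has a barrier of at most
  \<open>\<phi>\<close>. Processing all blocks lowers them to 1 + t - m / \<phi>, which is the
  stated factor; \<open>selection\<close> then finds a deletion no worse than the average.\<close>

lemma selector_nat:
  fixes grp :: "nat \<Rightarrow> 'k" and \<alpha> t :: real
  assumes finK: "finite K" and grp: "grp ` {..<N} \<subseteq> K"
    and r: "\<And>k. k \<in> K \<Longrightarrow> card {i \<in> {..<N}. grp i = k} = r" and s: "s < r"
    and \<alpha>: "\<alpha> \<ge> 0" "\<And>i. i < N \<Longrightarrow> Re (M i i) \<le> \<alpha>" and t: "t > 0"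
  obtains S where "S \<subseteq> {..<N}" "\<And>k. k \<in> K \<Longrightarrow> card {i \<in> S. grp i = k} = s"
    "\<And>c. quad_form S M c \<le> (1 + t) * (\<alpha> + (real s + 1) / real r * t) / (t + \<alpha>) * sq_norm S c"
proof -
  interpret F: stable_family "{..<N}" "char_minor N M" grp by (rule stable_family_char_minor)
  \<comment> \<open>One less than the number r - s of deletions per block: the barrier step takes
    \<open>Suc m\<close> derivatives with a shift of only \<open>m / \<phi>\<close>, whence s + 1 in
    the bound.\<close>
  define m where "m = r - s - 1"
  define n :: "'k \<Rightarrow> nat" where "n = (\<lambda>k. Suc m)"
  have rs: "Suc m = r - s" using s by (simp add: m_def)
  \<comment> \<open>By \<open>char_minor_ratio\<close> at x = 1 + t, one point contributes at most
    (t + \<alpha>) / ((1 + t) t), and a block has at most r points.\<close>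
  define \<phi> where "\<phi> = r * ((t + \<alpha>) / ((1 + t) * t))"
  have r0: "real r > 0" using s by simp
  have \<phi>: "\<phi> > 0" using r0 t \<alpha>(1) by (simp add: \<phi>_def add_pos_nonneg)
  define \<delta> where "\<delta> = m / \<phi>"
  define \<beta> where "\<beta> = (1 + t) * (\<alpha> + (real s + 1) / real r * t) / (t + \<alpha>)"
  have ta: "t + \<alpha> > 0" using t \<alpha>(1) by simp
  have \<beta>: "1 + t - \<delta> = \<beta>"
  proof -
    have m: "real m = real r - real s - 1" using s by (simp add: m_def of_nat_diff)
    have "\<delta> = (real r - real s - 1) / real r * ((1 + t) * t) / (t + \<alpha>)"
      by (simp add: \<delta>_def \<phi>_def m)
    also have "\<dots> = (1 - (real s + 1) / real r) * ((1 + t) * t) / (t + \<alpha>)"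
      using r0 by (simp add: field_simps)
    finally have "\<delta> * (t + \<alpha>) = (1 - (real s + 1) / real r) * ((1 + t) * t)"
      using ta by (subst (asm) nonzero_eq_divide_eq) auto
    then have "(1 + t - \<delta>) * (t + \<alpha>) = (1 + t) * (t + \<alpha>) - (1 - (real s + 1) / real r) * ((1 + t) * t)"
      by (simp only: left_diff_distrib)
    also have "\<dots> = (1 + t) * (\<alpha> + (real s + 1) / real r * t)" by (simp add: algebra_simps)
    finally show ?thesis unfolding \<beta>_def using ta by (simp add: eq_divide_eq)
  qed
  have \<beta>0: "\<beta> \<ge> 0" unfolding \<beta>_def using t \<alpha>(1) ta r0 by (intro divide_nonneg_pos mult_nonneg_nonneg add_nonneg_nonneg) auto
  have block: "card (F.block k {..<N}) = r" if "k \<in> K" for k using r[OF that] by (simp add: F.block_def)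
  have blocks_le: "card (F.block k {..<N}) \<le> r" for k
  proof (cases "k \<in> K")
    case False
    then have "F.block k {..<N} = {}" using grp by (auto simp: F.block_def)
    then show ?thesis by simp
  qed (use block in simp)
  have RW: "F.RVD n {} T \<xi> = Re (char_minor N M T (\<lambda>i. of_real (\<xi> i)))" for T \<xi>
    by (simp add: F.RVD_def F.VD_empty)
  have base: "F.barrier_inv n \<phi> (1 + t) \<delta> {}"
    unfolding F.barrier_inv_def RW
  proof (intro allI impI conjI)
    fix T and \<xi> :: "'k \<Rightarrow> real"
    assume T: "F.admissible {} T" and \<xi>: "\<forall>k. \<xi> k \<ge> (if k \<in> {} then 1 + t - \<delta> else 1 + t)"
    have TN: "T \<subseteq> {..<N}" using T by (simp add: F.admissible_def)
    have \<xi>1: "\<xi> k > 1" for k using \<xi>[rule_format, of k] t by simp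
    show pos: "Re (char_minor N M T (\<lambda>i. of_real (\<xi> (grp i)))) > 0"
      by (rule char_minor_pos[OF TN]) (rule \<xi>1)
    fix j assume jT: "F.block j {..<N} \<subseteq> T"
    let ?b = "(t + \<alpha>) / ((1 + t) * t)"
    have "Re (char_minor N M (T - {i}) (\<lambda>i. of_real (\<xi> (grp i)))) \<le> ?b * Re (char_minor N M T (\<lambda>i. of_real (\<xi> (grp i))))"
      if i: "i \<in> F.block j {..<N}" for i
    proof -
      have iT: "i \<in> T" "i < N" using i jT by (auto simp: F.block_def)
      have "(1 + t) * (1 + t - 1) * Re (char_minor N M (T - {i}) (\<lambda>i. of_real (\<xi> (grp i)))) \<le>
        (1 + t - 1 + Re (M i i)) * Re (char_minor N M T (\<lambda>i. of_real (\<xi> (grp i))))"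
        by (rule char_minor_ratio[OF TN iT(1)]) (use t \<xi> in auto)
      also have "\<dots> \<le> (t + \<alpha>) * Re (char_minor N M T (\<lambda>i. of_real (\<xi> (grp i))))"
        using \<alpha>(2)[OF iT(2)] pos by (intro mult_right_mono) auto
      finally have "((1 + t) * t) * Re (char_minor N M (T - {i}) (\<lambda>i. of_real (\<xi> (grp i)))) \<le>
        (t + \<alpha>) * Re (char_minor N M T (\<lambda>i. of_real (\<xi> (grp i))))" by simp
      then show ?thesis using t by (simp add: pos_le_divide_eq mult.commute)
    qed
    then have "(\<Sum>i\<in>F.block j {..<N}. Re (char_minor N M (T - {i}) (\<lambda>i. of_real (\<xi> (grp i))))) \<le>
      (\<Sum>i\<in>F.block j {..<N}. ?b * Re (char_minor N M T (\<lambda>i. of_real (\<xi> (grp i)))))"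
      by (rule sum_mono)
    also have "\<dots> = card (F.block j {..<N}) * (?b * Re (char_minor N M T (\<lambda>i. of_real (\<xi> (grp i)))))" by simp
    also have "\<dots> \<le> r * (?b * Re (char_minor N M T (\<lambda>i. of_real (\<xi> (grp i)))))"
      using blocks_le[of j] pos t ta by (intro mult_right_mono) auto
    finally show "(\<Sum>i\<in>F.block j {..<N}. Re (char_minor N M (T - {i}) (\<lambda>i. of_real (\<xi> (grp i))))) \<le>
      \<phi> * Re (char_minor N M T (\<lambda>i. of_real (\<xi> (grp i))))" by (simp add: \<phi>_def)
  qed
  have inv: "F.barrier_inv n \<phi> (1 + t) \<delta> K"
    by (rule F.barrier_inv_all[where m = m, OF finK base \<phi>]) (use block s in \<open>auto simp: n_def m_def \<delta>_def\<close>)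
  have pos: "F.RVD n K {..<N} (\<lambda>i. x) > 0" if x: "x > \<beta>" for x
  proof -
    \<comment> \<open>Labels outside \<open>K\<close> belong to no point, but the invariant
      quantifies over all labels; they keep the initial value 1 + t.\<close>
    define \<xi> where "\<xi> = (\<lambda>k. if k \<in> K then x else 1 + t)"
    have "F.admissible K {..<N}" by (auto simp: F.admissible_def F.block_def)
    moreover have "\<forall>k. \<xi> k \<ge> (if k \<in> K then 1 + t - \<delta> else 1 + t)" using x by (auto simp: \<xi>_def \<beta>)
    ultimately have "F.RVD n K {..<N} (\<lambda>i. \<xi> (grp i)) > 0"
      using inv unfolding F.barrier_inv_def by blast
    moreover have "F.VD n K {..<N} (\<lambda>i. of_real (\<xi> (grp i))) = F.VD n K {..<N} (\<lambda>i. of_real x)"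
    proof -
      interpret D: real_affine_family "{..<N}" "F.VD n K" by (rule F.VD_family)
      show ?thesis using grp by (intro D.cong) (auto simp: \<xi>_def)
    qed
    ultimately show ?thesis by (simp add: F.RVD_def)
  qed
  obtain A where A: "A \<in> F.dels n K {..<N}" "\<forall>x>\<beta>. Re (char_minor N M ({..<N} - A) (\<lambda>i. of_real x)) > 0"
  proof -
    have "\<exists>A\<in>F.dels n K {..<N}. \<forall>x>\<beta>. Re (char_minor N M ({..<N} - A) (\<lambda>i. of_real x)) > 0"
    proof (rule F.selection[OF finK order.refl])
      show "n j \<le> card (F.block j {..<N})" if "j \<in> K" for j
        using block[OF that] by (simp add: n_def rs)
      show "Re (char_minor N M S (\<lambda>i. of_real x)) > 0" if "S \<subseteq> {..<N}" "x > 1" for S x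
        by (rule char_minor_pos) (use that in auto)
    qed (rule pos)
    then show ?thesis using that by blast
  qed
  define S where "S = {..<N} - A"
  have SN: "S \<subseteq> {..<N}" by (auto simp: S_def)
  show ?thesis
  proof (rule that[OF SN])
    fix k assume k: "k \<in> K"
    have AN: "A \<subseteq> {..<N}" using A by (simp add: F.dels_def)
    have "{i \<in> S. grp i = k} = F.block k {..<N} - F.block k A" using AN by (auto simp: S_def F.block_def)
    moreover have "F.block k A \<subseteq> F.block k {..<N}" using AN by (auto simp: F.block_def)
    moreover have "card (F.block k A) = r - s" using A k by (simp add: F.dels_def n_def rs)
    ultimately show "card {i \<in> S. grp i = k} = s"
      using block[OF k] s F.finite_block[OF AN] by (simp add: card_Diff_subset)
  next
    fix c
    have "quad_form S M c \<le> \<beta> * sq_norm S c"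
      by (rule quad_form_le_of_char_minor[OF SN \<beta>0]) (use A(2) in \<open>force simp: S_def\<close>)
    then show "quad_form S M c \<le> (1 + t) * (\<alpha> + (real s + 1) / real r * t) / (t + \<alpha>) * sq_norm S c"
      by (simp add: \<beta>_def)
  qed
qed

end

lemma quad_form_reindex:
  assumes "inj_on e S"
  shows "quad_form (e ` S) M c = quad_form S (\<lambda>i j. M (e i) (e j)) (c \<circ> e)"
    "sq_norm (e ` S) c = sq_norm S (c \<circ> e)"
  using assms by (simp_all add: quad_form_def sesq_def mat_app_def sq_norm_def sum.reindex)

lemma quad_form_cong:
  assumes "\<And>i. i \<in> S \<Longrightarrow> c i = c' i"
  shows "quad_form S M c = quad_form S M c'" "sq_norm S c = sq_norm S c'"
  using assms by (simp_all add: quad_form_def sesq_def mat_app_def sq_norm_def)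

text \<open>The determinants above are indexed by an initial segment of the naturals; an enumeration
  of \<open>I\<close> transports the result.\<close>

theorem selector:
  fixes I :: "'i set" and grp :: "'i \<Rightarrow> 'k" and \<alpha> t :: real
  assumes finI: "finite I" and herm: "herm_on I M"
    and psd: "\<And>c. 0 \<le> quad_form I M c" and le1: "\<And>c. quad_form I M c \<le> sq_norm I c"
    and finK: "finite K" and grp: "grp ` I \<subseteq> K"
    and r: "\<And>k. k \<in> K \<Longrightarrow> card {i \<in> I. grp i = k} = r" and s: "s < r"
    and \<alpha>: "\<alpha> \<ge> 0" "\<And>i. i \<in> I \<Longrightarrow> Re (M i i) \<le> \<alpha>" and t: "t > 0"
  obtains S where "S \<subseteq> I" "\<And>k. k \<in> K \<Longrightarrow> card {i \<in> S. grp i = k} = s"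
    "\<And>c. quad_form S M c \<le> (1 + t) * (\<alpha> + (real s + 1) / real r * t) / (t + \<alpha>) * sq_norm S c"
proof -
  define N where "N = card I"
  obtain e where e: "bij_betw e {..<N} I"
    using finI ex_bij_betw_nat_finite[OF finI] unfolding N_def by (auto simp: atLeast0LessThan)
  then have inj: "inj_on e {..<N}" and img: "e ` {..<N} = I" by (auto simp: bij_betw_def)
  define M' where "M' = (\<lambda>i j. M (e i) (e j))"
  have ext: "quad_form {..<N} M' c = quad_form I M (c \<circ> the_inv_into {..<N} e)"
    "sq_norm {..<N} c = sq_norm I (c \<circ> the_inv_into {..<N} e)" for c
  proof -
    have 1: "i \<in> {..<N} \<Longrightarrow> c i = (c \<circ> the_inv_into {..<N} e \<circ> e) i" for i
      by (simp add: the_inv_into_f_f[OF inj])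
    show "quad_form {..<N} M' c = quad_form I M (c \<circ> the_inv_into {..<N} e)"
      unfolding img[symmetric] quad_form_reindex[OF inj] M'_def by (rule quad_form_cong(1)[OF 1])
    show "sq_norm {..<N} c = sq_norm I (c \<circ> the_inv_into {..<N} e)"
      unfolding img[symmetric] quad_form_reindex[OF inj] by (rule quad_form_cong(2)[OF 1])
  qed
  interpret C: contraction N M'
  proof
    show "herm_on {..<N} M'" unfolding herm_on_def
    proof safe
      fix i j assume "i < N" "j < N"
      then have "e i \<in> I" "e j \<in> I" using img by auto
      then have "M (e j) (e i) = cnj (M (e i) (e j))" using herm unfolding herm_on_def by blast
      then show "M' j i = cnj (M' i j)" by (simp only: M'_def)
    qed
    show "0 \<le> quad_form {..<N} M' c" "quad_form {..<N} M' c \<le> sq_norm {..<N} c" for c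
      unfolding ext using psd le1 by blast+
  qed
  have card_e: "card {i \<in> e ` S'. grp i = k} = card {i \<in> S'. (grp \<circ> e) i = k}" if "S' \<subseteq> {..<N}" for S' k
  proof -
    have "{i \<in> e ` S'. grp i = k} = e ` {i \<in> S'. (grp \<circ> e) i = k}" by auto
    moreover have "inj_on e {i \<in> S'. (grp \<circ> e) i = k}" using inj that by (rule_tac inj_on_subset) auto
    ultimately show ?thesis by (simp add: card_image)
  qed
  obtain S' where S': "S' \<subseteq> {..<N}" "\<And>k. k \<in> K \<Longrightarrow> card {i \<in> S'. (grp \<circ> e) i = k} = s"
    "\<And>c. quad_form S' M' c \<le> (1 + t) * (\<alpha> + (real s + 1) / real r * t) / (t + \<alpha>) * sq_norm S' c"
  proof (rule C.selector_nat[OF finK, of "grp \<circ> e" r s \<alpha> t])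
    show "(grp \<circ> e) ` {..<N} \<subseteq> K" using grp img by auto
    show "card {i \<in> {..<N}. (grp \<circ> e) i = k} = r" if "k \<in> K" for k
      using card_e[OF order.refl, of k] r[OF that] by (simp add: img)
    show "Re (M' i i) \<le> \<alpha>" if "i < N" for i using \<alpha>(2)[of "e i"] img that by (auto simp: M'_def)
  qed (use s \<alpha> t in auto)
  have injS: "inj_on e S'" using inj S'(1) by (rule inj_on_subset)
  show ?thesis
  proof (rule that[of "e ` S'"])
    show "e ` S' \<subseteq> I" using S'(1) img by auto
    show "card {i \<in> e ` S'. grp i = k} = s" if "k \<in> K" for k
      using card_e[OF S'(1)] S'(2)[OF that] by simp
    show "quad_form (e ` S') M c \<le> (1 + t) * (\<alpha> + (real s + 1) / real r * t) / (t + \<alpha>) * sq_norm (e ` S') c" for c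
      unfolding quad_form_reindex[OF injS] using S'(3)[of "c \<circ> e"] by (simp add: M'_def)
  qed
qed

section \<open>Square-integrable functions and Riesz sequences\<close>

no_notation vec_index (infixl \<open>$\<close> 100)
no_notation scalar_prod (infix \<open>\<bullet>\<close> 70)

text \<open>The squared seminorm, which keeps the estimates free of square roots.\<close>

definition sqint :: "'a measure \<Rightarrow> ('a \<Rightarrow> complex) \<Rightarrow> real" where
  "sqint M f = (LINT t|M. (cmod (f t))\<^sup>2)"

lemma sqint_nonneg: "sqint M f \<ge> 0"
  by (simp add: sqint_def)

lemma L2_norm_power2: "(L2_norm M f)\<^sup>2 = sqint M f"
  by (simp add: L2_norm_def sqint_def)

lemma L2_measurable: "f \<in> L2 M \<Longrightarrow> f \<in> borel_measurable M"
  and L2_integrable: "f \<in> L2 M \<Longrightarrow> integrable M (\<lambda>t. (cmod (f t))\<^sup>2)"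
  by (auto simp: L2_def)

text \<open>The weighted triangle inequality: \<delta> is small where the constant in front of the
  main term matters, and 1 in crude estimates.\<close>

lemma cmod_add_power2_le:
  fixes a b :: complex and \<delta> :: real
  assumes "\<delta> > 0"
  shows "(cmod (a + b))\<^sup>2 \<le> (1 + \<delta>) * (cmod a)\<^sup>2 + (1 + 1 / \<delta>) * (cmod b)\<^sup>2"
proof -
  have "(cmod (a + b))\<^sup>2 \<le> (cmod a + cmod b)\<^sup>2"
    by (intro power_mono norm_triangle_ineq) simp
  also have "\<dots> = (1 + \<delta>) * (cmod a)\<^sup>2 + (1 + 1 / \<delta>) * (cmod b)\<^sup>2 - (\<delta> * cmod a - cmod b)\<^sup>2 / \<delta>"
    using assms by (simp add: power2_eq_square field_simps)
  also have "\<dots> \<le> (1 + \<delta>) * (cmod a)\<^sup>2 + (1 + 1 / \<delta>) * (cmod b)\<^sup>2"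
    using assms by simp
  finally show ?thesis .
qed

lemma L2_add: "f \<in> L2 M \<Longrightarrow> g \<in> L2 M \<Longrightarrow> (\<lambda>t. f t + g t) \<in> L2 M"
proof -
  assume f: "f \<in> L2 M" and g: "g \<in> L2 M"
  note [measurable] = L2_measurable[OF f] L2_measurable[OF g]
  have "integrable M (\<lambda>t. (cmod (f t + g t))\<^sup>2)"
  proof (rule Bochner_Integration.integrable_bound)
    show "integrable M (\<lambda>t. 2 * (cmod (f t))\<^sup>2 + 2 * (cmod (g t))\<^sup>2)"
      using L2_integrable[OF f] L2_integrable[OF g] by auto
    show "AE t in M. norm ((cmod (f t + g t))\<^sup>2) \<le> norm (2 * (cmod (f t))\<^sup>2 + 2 * (cmod (g t))\<^sup>2)"
    proof (rule AE_I2)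
      fix t
      show "norm ((cmod (f t + g t))\<^sup>2) \<le> norm (2 * (cmod (f t))\<^sup>2 + 2 * (cmod (g t))\<^sup>2)"
        using cmod_add_power2_le[of 1 "f t" "g t"] by simp
    qed
  qed simp
  then show ?thesis by (simp add: L2_def)
qed

lemma L2_scale: "f \<in> L2 M \<Longrightarrow> (\<lambda>t. c * f t) \<in> L2 M"
  by (auto simp: L2_def norm_mult power_mult_distrib)

lemma L2_zero: "(\<lambda>t. 0) \<in> L2 M"
  by (simp add: L2_def)

lemma L2_diff: "f \<in> L2 M \<Longrightarrow> g \<in> L2 M \<Longrightarrow> (\<lambda>t. f t - g t) \<in> L2 M"
  using L2_add[of f M "\<lambda>t. (-1) * g t"] L2_scale[of g M "-1"] by simp

lemma L2_sum: "(\<And>i. i \<in> F \<Longrightarrow> u i \<in> L2 M) \<Longrightarrow> (\<lambda>t. \<Sum>i\<in>F. u i t) \<in> L2 M"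
  by (induction F rule: infinite_finite_induct) (auto simp: L2_zero intro!: L2_add)

lemma sqint_scale: "sqint M (\<lambda>t. c * f t) = (cmod c)\<^sup>2 * sqint M f"
  by (simp add: sqint_def norm_mult power_mult_distrib)

lemma sqint_add_le:
  assumes f: "f \<in> L2 M" and g: "g \<in> L2 M" and \<delta>: "\<delta> > 0"
  shows "sqint M (\<lambda>t. f t + g t) \<le> (1 + \<delta>) * sqint M f + (1 + 1 / \<delta>) * sqint M g"
proof -
  have "sqint M (\<lambda>t. f t + g t) \<le> (LINT t|M. (1 + \<delta>) * (cmod (f t))\<^sup>2 + (1 + 1 / \<delta>) * (cmod (g t))\<^sup>2)"
    unfolding sqint_def using L2_integrable[OF f] L2_integrable[OF g] L2_integrable[OF L2_add[OF f g]]
    by (intro integral_mono cmod_add_power2_le \<delta>) auto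
  also have "\<dots> = (1 + \<delta>) * sqint M f + (1 + 1 / \<delta>) * sqint M g"
    unfolding sqint_def using L2_integrable[OF f] L2_integrable[OF g] by simp
  finally show ?thesis .
qed

text \<open>Pointwise Cauchy-Schwarz. The bound grows with the number of functions, so it serves for
  error terms only.\<close>

lemma sqint_sum_le:
  assumes u: "\<And>i. i \<in> F \<Longrightarrow> u i \<in> L2 M"
  shows "sqint M (\<lambda>t. \<Sum>i\<in>F. c i * u i t) \<le> (\<Sum>i\<in>F. (cmod (c i))\<^sup>2) * (\<Sum>i\<in>F. sqint M (u i))"
proof -
  have "(cmod (\<Sum>i\<in>F. c i * u i t))\<^sup>2 \<le> (\<Sum>i\<in>F. (cmod (c i))\<^sup>2) * (\<Sum>i\<in>F. (cmod (u i t))\<^sup>2)" for t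
  proof -
    have "(cmod (\<Sum>i\<in>F. c i * u i t))\<^sup>2 \<le> (\<Sum>i\<in>F. cmod (c i) * cmod (u i t))\<^sup>2"
      by (intro power_mono order.trans[OF norm_sum]) (auto simp: norm_mult)
    also have "\<dots> \<le> (\<Sum>i\<in>F. (cmod (c i))\<^sup>2) * (\<Sum>i\<in>F. (cmod (u i t))\<^sup>2)"
      by (rule Cauchy_Schwarz_ineq_sum)
    finally show ?thesis .
  qed
  then have "sqint M (\<lambda>t. \<Sum>i\<in>F. c i * u i t) \<le>
      (LINT t|M. (\<Sum>i\<in>F. (cmod (c i))\<^sup>2) * (\<Sum>i\<in>F. (cmod (u i t))\<^sup>2))"
    unfolding sqint_def using L2_integrable[OF u]
    by (intro integral_mono L2_integrable[OF L2_sum] L2_scale u) auto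
  also have "\<dots> = (\<Sum>i\<in>F. (cmod (c i))\<^sup>2) * (\<Sum>i\<in>F. sqint M (u i))"
    unfolding sqint_def using L2_integrable[OF u] by simp
  finally show ?thesis .
qed

lemma sqint_Fatou:
  assumes S: "\<And>n. S n \<in> L2 M" and f: "f \<in> borel_measurable M"
    and lim: "AE t in M. (\<lambda>n. S n t) \<longlonglongrightarrow> f t" and b: "\<And>n. n \<ge> m \<Longrightarrow> sqint M (S n) \<le> b"
  shows "f \<in> L2 M" "sqint M f \<le> b"
proof -
  note [measurable] = f L2_measurable[OF S]
  have b0: "b \<ge> 0" using b[of m] sqint_nonneg[of M "S m"] by simp
  have eq: "(\<integral>\<^sup>+t. ennreal ((cmod (S n t))\<^sup>2) \<partial>M) = ennreal (sqint M (S n))" for n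
    unfolding sqint_def by (rule nn_integral_eq_integral[OF L2_integrable[OF S]]) simp
  have "(\<integral>\<^sup>+t. ennreal ((cmod (f t))\<^sup>2) \<partial>M) = (\<integral>\<^sup>+t. liminf (\<lambda>n. ennreal ((cmod (S n t))\<^sup>2)) \<partial>M)"
  proof (rule nn_integral_cong_AE)
    show "AE t in M. ennreal ((cmod (f t))\<^sup>2) = liminf (\<lambda>n. ennreal ((cmod (S n t))\<^sup>2))"
      using lim
    proof eventually_elim
      case (elim t)
      then have "(\<lambda>n. ennreal ((cmod (S n t))\<^sup>2)) \<longlonglongrightarrow> ennreal ((cmod (f t))\<^sup>2)"
        by (intro tendsto_intros)
      then show ?case by (intro lim_imp_Liminf[symmetric]) auto
    qed
  qed
  also have "\<dots> \<le> liminf (\<lambda>n. \<integral>\<^sup>+t. ennreal ((cmod (S n t))\<^sup>2) \<partial>M)"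
    by (rule nn_integral_liminf) simp
  also have "\<dots> \<le> ennreal b"
  proof -
    have "liminf (\<lambda>n. ennreal (sqint M (S n))) \<le> liminf (\<lambda>n. ennreal b)"
      by (rule Liminf_mono) (use b in \<open>auto simp: eventually_sequentially intro!: exI[of _ m] ennreal_leI\<close>)
    then show ?thesis unfolding eq by (simp add: Liminf_const)
  qed
  finally have le: "(\<integral>\<^sup>+t. ennreal ((cmod (f t))\<^sup>2) \<partial>M) \<le> ennreal b" .
  then have int: "integrable M (\<lambda>t. (cmod (f t))\<^sup>2)"
    by (intro integrableI_nonneg) (auto simp: order.strict_trans1)
  then show "f \<in> L2 M" using f by (simp add: L2_def)
  have "ennreal (sqint M f) \<le> ennreal b"
    using le unfolding sqint_def by (subst (asm) nn_integral_eq_integral[OF int]) auto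
  then show "sqint M f \<le> b" using b0 by simp
qed

text \<open>Since 2 |z| <= 2^n |z|^2 + 2^(-n), absolute convergence follows from a weighted sum of
  squares.\<close>

lemma summable_sqrt_geometric:
  fixes z :: "nat \<Rightarrow> complex"
  assumes "summable (\<lambda>n. 2 ^ n * (cmod (z n))\<^sup>2)"
  shows "summable z"
proof -
  have "cmod (z n) \<le> 2 ^ n * (cmod (z n))\<^sup>2 + (1 / 2) ^ n" for n
  proof -
    have "0 \<le> (2 ^ n * cmod (z n) - 1)\<^sup>2" by simp
    then have "2 ^ n * (2 * cmod (z n)) \<le> 2 ^ n * (2 ^ n * (cmod (z n))\<^sup>2 + (1 / 2) ^ n)"
      by (simp add: power2_eq_square algebra_simps power_one_over)
    then have "2 * cmod (z n) \<le> 2 ^ n * (cmod (z n))\<^sup>2 + (1 / 2) ^ n" by simp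
    then show ?thesis using norm_ge_zero[of "z n"] by linarith
  qed
  then show ?thesis
    by (intro summable_comparison_test'[OF summable_add[OF assms summable_geometric[of "1 / 2 :: real"]]]) auto
qed

text \<open>The sum is the almost everywhere limit of partial sums along growing finite sets, as in
  the proof that L2 is complete. Fatou's lemma carries the tail estimates to the limit, and weights
  \<delta> tending to 0 preserve \<open>A\<close> and \<open>B\<close>.\<close>

theorem riesz_sequenceI:
  fixes G :: "'i \<Rightarrow> 'a \<Rightarrow> complex"
  assumes ctb: "countable I" and G: "\<And>i. i \<in> I \<Longrightarrow> G i \<in> L2 M" and A: "A > 0" and B: "B > 0"
    and lower: "\<And>F c. finite F \<Longrightarrow> F \<subseteq> I \<Longrightarrow> A * (\<Sum>i\<in>F. (cmod (c i))\<^sup>2) \<le> sqint M (\<lambda>t. \<Sum>i\<in>F. c i * G i t)"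
    and upper: "\<And>F c. finite F \<Longrightarrow> F \<subseteq> I \<Longrightarrow> sqint M (\<lambda>t. \<Sum>i\<in>F. c i * G i t) \<le> B * (\<Sum>i\<in>F. (cmod (c i))\<^sup>2)"
  shows "riesz_sequence M G I"
proof -
  have main: "\<exists>f. L2_has_sum M (\<lambda>i t. c i * G i t) f I \<and> A * (\<Sum>\<^sub>\<infinity>i\<in>I. (cmod (c i))\<^sup>2) \<le> (L2_norm M f)\<^sup>2 \<and>
      (L2_norm M f)\<^sup>2 \<le> B * (\<Sum>\<^sub>\<infinity>i\<in>I. (cmod (c i))\<^sup>2)"
    if sm: "(\<lambda>i. (cmod (c i))\<^sup>2) summable_on I" for c :: "'i \<Rightarrow> complex"
  proof -
  define s where "s = (\<Sum>\<^sub>\<infinity>i\<in>I. (cmod (c i))\<^sup>2)"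
  define w where "w = (\<lambda>F. \<Sum>i\<in>F. (cmod (c i))\<^sup>2)"
  define S where "S = (\<lambda>F t. \<Sum>i\<in>F. c i * G i t)"
  have SL2: "S F \<in> L2 M" if "F \<subseteq> I" for F
    unfolding S_def using that G by (intro L2_sum L2_scale) auto
  have ws: "w F \<le> s" if "finite F" "F \<subseteq> I" for F
    unfolding w_def s_def by (rule finite_sum_le_infsum[OF sm that]) simp
  have w0: "w F \<ge> 0" for F unfolding w_def by (simp add: sum_nonneg)
  have s0: "s \<ge> 0" using ws[of "{}"] by (simp add: w_def)
  have "\<exists>F. finite F \<and> F \<subseteq> I \<and> w F > s - e" if "e > 0" for e
  proof -
    have "(w \<longlongrightarrow> s) (finite_subsets_at_top I)"
      using infsum_tendsto[OF sm] by (simp add: w_def s_def)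
    then have "eventually (\<lambda>F. w F > s - e) (finite_subsets_at_top I)"
      using that by (intro order_tendstoD) auto
    then have "eventually (\<lambda>F. finite F \<and> F \<subseteq> I \<and> w F > s - e) (finite_subsets_at_top I)"
      using eventually_finite_subsets_at_top_weakI[of I "\<lambda>F. finite F \<and> F \<subseteq> I"]
      by (auto elim: eventually_elim2)
    then show ?thesis using eventually_happens' finite_subsets_at_top_neq_bot by blast
  qed
  \<comment> \<open>The rate 8^(-n) still leaves the summable 2^n 8^(-n) = 4^(-n) after the
    weighting of \<open>summable_sqrt_geometric\<close>.\<close>
  then have "\<forall>n. \<exists>F. finite F \<and> F \<subseteq> I \<and> w F > s - (1 / 8) ^ n" by simp
  then obtain E where E: "\<And>n. finite (E n)" "\<And>n. E n \<subseteq> I" "\<And>n. w (E n) > s - (1 / 8) ^ n" by metis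
  define H where "H = (\<lambda>n. \<Union>k\<le>n. E k)"
  have H: "finite (H n)" "H n \<subseteq> I" "H n \<subseteq> H (Suc n)" "E n \<subseteq> H n" for n
    using E by (auto simp: H_def atMost_Suc)
  have Hmono: "H m \<subseteq> H n" if "m \<le> n" for m n unfolding H_def using that by (intro UN_mono) auto
  have tail: "w F \<le> (1 / 8) ^ n" if "finite F" "F \<subseteq> I" "F \<inter> H n = {}" for F n
  proof -
    have "F \<inter> E n = {}" using that H(4) by blast
    then have "w (F \<union> E n) = w F + w (E n)" unfolding w_def using that E by (intro sum.union_disjoint) auto
    then show ?thesis using ws[of "F \<union> E n"] E[of n] that by auto
  qed
  have Sdiff: "sqint M (\<lambda>t. S F t - S F' t) \<le> B * (1 / 8) ^ n"
    if F: "finite F" "F \<subseteq> I" "H n \<subseteq> F" and F': "finite F'" "F' \<subseteq> I" "H n \<subseteq> F'" for F F' n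
  proof -
    \<comment> \<open>The difference of two partial sums is a combination over the symmetric
      difference, with the signs absorbed into \<open>d\<close>.\<close>
    define d where "d = (\<lambda>i. if i \<in> F then c i else - c i)"
    let ?D = "(F - F') \<union> (F' - F)"
    have "S F t - S F' t = (\<Sum>i\<in>?D. d i * G i t)" for t
    proof -
      have 1: "S F t = (\<Sum>i\<in>F - F'. c i * G i t) + (\<Sum>i\<in>F \<inter> F'. c i * G i t)"
        using sum.Int_Diff[OF F(1), of "\<lambda>i. c i * G i t" F'] by (simp only: S_def add.commute)
      have 2: "S F' t = (\<Sum>i\<in>F' - F. c i * G i t) + (\<Sum>i\<in>F \<inter> F'. c i * G i t)"
        using sum.Int_Diff[OF F'(1), of "\<lambda>i. c i * G i t" F] by (simp only: S_def add.commute Int_commute)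
      have "(\<Sum>i\<in>?D. d i * G i t) = (\<Sum>i\<in>F - F'. d i * G i t) + (\<Sum>i\<in>F' - F. d i * G i t)"
        using F F' by (intro sum.union_disjoint) auto
      also have "(\<Sum>i\<in>F - F'. d i * G i t) = (\<Sum>i\<in>F - F'. c i * G i t)" by (simp add: d_def)
      also have "(\<Sum>i\<in>F' - F. d i * G i t) = - (\<Sum>i\<in>F' - F. c i * G i t)" by (simp add: d_def sum_negf)
      finally show ?thesis using 1 2 by simp
    qed
    then have "sqint M (\<lambda>t. S F t - S F' t) = sqint M (\<lambda>t. \<Sum>i\<in>?D. d i * G i t)" by simp
    also have "\<dots> \<le> B * (\<Sum>i\<in>?D. (cmod (d i))\<^sup>2)" using F F' by (intro upper) auto
    also have "(\<Sum>i\<in>?D. (cmod (d i))\<^sup>2) = w ?D" unfolding w_def by (intro sum.cong) (auto simp: d_def)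
    also have "\<dots> \<le> (1 / 8) ^ n" using F F' by (intro tail) auto
    finally show ?thesis using B by simp
  qed
  define f where "f = (\<lambda>t. lim (\<lambda>n. S (H n) t))"
  note [measurable] = L2_measurable[OF SL2[OF H(2)]]
  have f: "f \<in> borel_measurable M" unfolding f_def by simp
  have conv: "AE t in M. (\<lambda>n. S (H n) t) \<longlonglongrightarrow> f t"
  proof -
    define D where "D = (\<lambda>n t. S (H (Suc n)) t - S (H n) t)"
    have DL2: "D n \<in> L2 M" for n unfolding D_def using SL2 H by (intro L2_diff) auto
    note [measurable] = L2_measurable[OF DL2]
    have Dn: "(\<integral>\<^sup>+t. ennreal (2 ^ n * (cmod (D n t))\<^sup>2) \<partial>M) \<le> ennreal (B * (1 / 4) ^ n)" for n
    proof -
      have "(\<integral>\<^sup>+t. ennreal (2 ^ n * (cmod (D n t))\<^sup>2) \<partial>M) = ennreal (2 ^ n * sqint M (D n))"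
        unfolding sqint_def using L2_integrable[OF DL2, of n]
        by (subst nn_integral_eq_integral) auto
      also have "\<dots> \<le> ennreal (2 ^ n * (B * (1 / 8) ^ n))"
        unfolding D_def using H by (intro ennreal_leI mult_left_mono Sdiff) auto
      also have "2 ^ n * (B * (1 / 8) ^ n) = B * ((2 * (1 / 8)) ^ n)" unfolding power_mult_distrib by simp
      also have "\<dots> = B * (1 / 4) ^ n" by simp
      finally show ?thesis .
    qed
    have "(\<integral>\<^sup>+t. (\<Sum>n. ennreal (2 ^ n * (cmod (D n t))\<^sup>2)) \<partial>M) = (\<Sum>n. \<integral>\<^sup>+t. ennreal (2 ^ n * (cmod (D n t))\<^sup>2) \<partial>M)"
      by (rule nn_integral_suminf) simp
    also have "\<dots> \<le> (\<Sum>n. ennreal (B * (1 / 4) ^ n))" by (intro suminf_le Dn) auto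
    also have "\<dots> = ennreal (\<Sum>n. B * (1 / 4) ^ n)"
      using B by (intro suminf_ennreal2 summable_mult summable_geometric) auto
    also have "\<dots> < \<infinity>" by simp
    finally have "AE t in M. (\<Sum>n. ennreal (2 ^ n * (cmod (D n t))\<^sup>2)) \<noteq> \<infinity>"
      by (intro nn_integral_PInf_AE) auto
    then show ?thesis
    proof eventually_elim
      case (elim t)
      then have "summable (\<lambda>n. 2 ^ n * (cmod (D n t))\<^sup>2)"
        by (intro summable_suminf_not_top) auto
      then have "summable (\<lambda>n. D n t)" by (rule summable_sqrt_geometric)
      then have "convergent (\<lambda>n. \<Sum>k<n. D k t)" by (simp add: summable_iff_convergent)
      moreover have "(\<Sum>k<n. D k t) = S (H n) t - S (H 0) t" for n
        unfolding D_def by (rule sum_lessThan_telescope)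
      ultimately have "convergent (\<lambda>n. (S (H n) t - S (H 0) t) + S (H 0) t)"
        by (intro convergent_add) (auto simp: convergent_const)
      then have "convergent (\<lambda>n. S (H n) t)" by simp
      then show ?case unfolding f_def by (rule convergent_LIMSEQ_iff[THEN iffD1])
    qed
  qed
  have approx: "(\<lambda>t. f t - S F t) \<in> L2 M" "sqint M (\<lambda>t. f t - S F t) \<le> B * (1 / 8) ^ m"
    if F: "finite F" "F \<subseteq> I" "H m \<subseteq> F" for F m
  proof -
    note [measurable] = f L2_measurable[OF SL2[OF F(2)]]
    have 1: "(\<lambda>t. S (H n) t - S F t) \<in> L2 M" for n by (intro L2_diff SL2 F H)
    have 2: "(\<lambda>t. f t - S F t) \<in> borel_measurable M" by simp
    have 3: "AE t in M. (\<lambda>n. S (H n) t - S F t) \<longlonglongrightarrow> f t - S F t"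
      using conv by eventually_elim (intro tendsto_intros)
    have 4: "sqint M (\<lambda>t. S (H n) t - S F t) \<le> B * (1 / 8) ^ m" if "n \<ge> m" for n
      using Hmono[OF that] H F by (intro Sdiff) auto
    show "(\<lambda>t. f t - S F t) \<in> L2 M" "sqint M (\<lambda>t. f t - S F t) \<le> B * (1 / 8) ^ m"
      using sqint_Fatou[OF 1 2 3 4] by auto
  qed
  have fL2: "f \<in> L2 M"
    using L2_add[OF approx(1)[OF H(1,2) order.refl, of 0] SL2[OF H(2), of 0]] by simp
  have "\<exists>f. L2_has_sum M (\<lambda>i t. c i * G i t) f I \<and> A * s \<le> (L2_norm M f)\<^sup>2 \<and> (L2_norm M f)\<^sup>2 \<le> B * s"
  proof (intro exI conjI)
    have "((\<lambda>F. L2_norm M (\<lambda>t. f t - S F t)) \<longlongrightarrow> 0) (finite_subsets_at_top I)"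
    proof (rule tendstoI)
      fix e :: real assume e: "e > 0"
      have "(\<lambda>m. B * (1 / 8 :: real) ^ m) \<longlonglongrightarrow> B * 0" by (intro tendsto_intros) simp
      then have "eventually (\<lambda>m. B * (1 / 8 :: real) ^ m < e\<^sup>2) sequentially"
        using e by (intro order_tendstoD) auto
      then obtain m where m: "B * (1 / 8 :: real) ^ m < e\<^sup>2" by (auto simp: eventually_sequentially)
      have "\<forall>F. finite F \<and> H m \<subseteq> F \<and> F \<subseteq> I \<longrightarrow> dist (L2_norm M (\<lambda>t. f t - S F t)) 0 < e"
      proof safe
        fix F assume F: "finite F" "H m \<subseteq> F" "F \<subseteq> I"
        have "sqint M (\<lambda>t. f t - S F t) < e\<^sup>2" using approx(2)[OF F(1,3,2)] m by simp
        then have "L2_norm M (\<lambda>t. f t - S F t) < sqrt (e\<^sup>2)"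
          unfolding L2_norm_def sqint_def[symmetric] by (rule real_sqrt_less_mono)
        moreover have "L2_norm M (\<lambda>t. f t - S F t) \<ge> 0"
          unfolding L2_norm_def sqint_def[symmetric] by (simp add: sqint_nonneg)
        ultimately show "dist (L2_norm M (\<lambda>t. f t - S F t)) 0 < e" using e by (simp add: dist_real_def)
      qed
      then show "eventually (\<lambda>F. dist (L2_norm M (\<lambda>t. f t - S F t)) 0 < e) (finite_subsets_at_top I)"
        unfolding eventually_finite_subsets_at_top
        by (intro exI[of _ "H m"] conjI H(1) H(2)[of m])
    qed
    then show "L2_has_sum M (\<lambda>i t. c i * G i t) f I"
      using fL2 by (simp add: L2_has_sum_def S_def)
    have up: "sqint M f \<le> (1 + \<delta>) * (B * s) + (1 + 1 / \<delta>) * (B * (1 / 8) ^ m)" if \<delta>: "\<delta> > 0" for \<delta> m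
    proof -
      have 1: "sqint M f \<le> (1 + \<delta>) * sqint M (S (H m)) + (1 + 1 / \<delta>) * sqint M (\<lambda>t. f t - S (H m) t)"
        using sqint_add_le[OF SL2[OF H(2), of m] approx(1)[OF H(1,2) order.refl, of m] \<delta>] by simp
      have "sqint M (S (H m)) \<le> B * w (H m)"
        unfolding S_def w_def by (rule upper[OF H(1,2)])
      also have "\<dots> \<le> B * s" using ws[OF H(1,2)] B by simp
      finally have 2: "(1 + \<delta>) * sqint M (S (H m)) \<le> (1 + \<delta>) * (B * s)"
        using \<delta> by (intro mult_left_mono) auto
      have 3: "(1 + 1 / \<delta>) * sqint M (\<lambda>t. f t - S (H m) t) \<le> (1 + 1 / \<delta>) * (B * (1 / 8) ^ m)"
        using approx(2)[OF H(1,2) order.refl, of m] \<delta> by (intro mult_left_mono) auto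
      show ?thesis using 1 2 3 by linarith
    qed
    have lo: "A * (s - (1 / 8) ^ m) \<le> (1 + \<delta>) * sqint M f + (1 + 1 / \<delta>) * (B * (1 / 8) ^ m)" if \<delta>: "\<delta> > 0" for \<delta> m
    proof -
      have "w (E m) \<le> w (H m)" unfolding w_def using H by (intro sum_mono2) auto
      then have "A * (s - (1 / 8) ^ m) \<le> A * w (H m)" using E(3)[of m] A by simp
      also have "\<dots> \<le> sqint M (S (H m))" unfolding w_def S_def by (rule lower[OF H(1,2)])
      also have "\<dots> = sqint M (\<lambda>t. f t + (-1) * (f t - S (H m) t))" by simp
      also have "\<dots> \<le> (1 + \<delta>) * sqint M f + (1 + 1 / \<delta>) * sqint M (\<lambda>t. (-1) * (f t - S (H m) t))"
        by (rule sqint_add_le[OF fL2 L2_scale[OF approx(1)[OF H(1,2) order.refl, of m]] \<delta>])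
      finally have 1: "A * (s - (1 / 8) ^ m) \<le> (1 + \<delta>) * sqint M f + (1 + 1 / \<delta>) * sqint M (\<lambda>t. (-1) * (f t - S (H m) t))" .
      have "sqint M (\<lambda>t. (-1) * (f t - S (H m) t)) = sqint M (\<lambda>t. f t - S (H m) t)"
        by (subst sqint_scale) simp
      then have "(1 + 1 / \<delta>) * sqint M (\<lambda>t. (-1) * (f t - S (H m) t)) \<le> (1 + 1 / \<delta>) * (B * (1 / 8) ^ m)"
        using approx(2)[OF H(1,2) order.refl, of m] \<delta> by (intro mult_left_mono) auto
      with 1 show ?thesis by linarith
    qed
    have pw: "(\<lambda>m. (1 / 8 :: real) ^ m) \<longlonglongrightarrow> 0" by (rule LIMSEQ_realpow_zero) auto
    have up': "sqint M f \<le> (1 + \<delta>) * (B * s)" if \<delta>: "\<delta> > 0" for \<delta>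
    proof -
      have "(\<lambda>m. (1 + \<delta>) * (B * s) + (1 + 1 / \<delta>) * (B * (1 / 8) ^ m)) \<longlonglongrightarrow> (1 + \<delta>) * (B * s) + (1 + 1 / \<delta>) * (B * 0)"
        by (intro tendsto_intros pw)
      then show ?thesis using up[OF \<delta>] by (intro LIMSEQ_le_const[where X = "\<lambda>m. (1 + \<delta>) * (B * s) + (1 + 1 / \<delta>) * (B * (1 / 8) ^ m)"]) auto
    qed
    have lo': "A * s \<le> (1 + \<delta>) * sqint M f" if \<delta>: "\<delta> > 0" for \<delta>
    proof -
      have "(\<lambda>m. (1 + \<delta>) * sqint M f + (1 + 1 / \<delta>) * (B * (1 / 8) ^ m) - A * (s - (1 / 8) ^ m))
          \<longlonglongrightarrow> (1 + \<delta>) * sqint M f + (1 + 1 / \<delta>) * (B * 0) - A * (s - 0)"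
        by (intro tendsto_intros pw)
      then have "0 \<le> (1 + \<delta>) * sqint M f + (1 + 1 / \<delta>) * (B * 0) - A * (s - 0)"
        using lo[OF \<delta>] by (intro LIMSEQ_le_const) (auto simp: algebra_simps)
      then show ?thesis by simp
    qed
    \<comment> \<open>After m has gone to infinity for fixed \<delta>, \<delta> tends to 0.\<close>
    have d0: "((\<lambda>\<delta>. (1 + \<delta>) * x) \<longlongrightarrow> (1 + 0) * x) (at_right 0)" for x :: real
      by (intro tendsto_intros)
    have "A * s \<le> (1 + 0) * sqint M f"
      by (rule tendsto_lowerbound[OF d0]) (use lo' in \<open>auto simp: eventually_at_filter\<close>)
    then show "A * s \<le> (L2_norm M f)\<^sup>2" by (simp add: L2_norm_power2)
    have "sqint M f \<le> (1 + 0) * (B * s)"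
      by (rule tendsto_lowerbound[OF d0]) (use up' in \<open>auto simp: eventually_at_filter\<close>)
    then show "(L2_norm M f)\<^sup>2 \<le> B * s" by (simp add: L2_norm_power2)
  qed
  then show ?thesis unfolding s_def .
  qed
  show ?thesis
    unfolding riesz_sequence_def
  proof (intro conjI ballI)
    show "\<exists>A>0. \<exists>B>0. \<forall>c::'i \<Rightarrow> complex. (\<lambda>i. (cmod (c i))\<^sup>2) summable_on I \<longrightarrow>
        (\<exists>f. L2_has_sum M (\<lambda>i t. c i * G i t) f I \<and>
             A * (\<Sum>\<^sub>\<infinity>i\<in>I. (cmod (c i))\<^sup>2) \<le> (L2_norm M f)\<^sup>2 \<and>
             (L2_norm M f)\<^sup>2 \<le> B * (\<Sum>\<^sub>\<infinity>i\<in>I. (cmod (c i))\<^sup>2))"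
      using A B main by blast
  qed (use ctb G in auto)
qed

section \<open>Time-frequency shifts and step functions\<close>

lemma sqint_dominated:
  assumes S: "\<And>n. S n \<in> borel_measurable M" and f: "f \<in> borel_measurable M" and w: "integrable M w"
    and lim: "AE t in M. (\<lambda>n. S n t) \<longlonglongrightarrow> f t"
    and bound: "\<And>n. AE t in M. (cmod (f t - S n t))\<^sup>2 \<le> w t"
  shows "(\<lambda>n. sqint M (\<lambda>t. f t - S n t)) \<longlonglongrightarrow> 0"
proof -
  note [measurable] = S f
  have "(\<lambda>n. LINT t|M. (cmod (f t - S n t))\<^sup>2) \<longlonglongrightarrow> (LINT t|M. 0)"
  proof (rule integral_dominated_convergence[OF _ _ w])
    show "AE t in M. (\<lambda>n. (cmod (f t - S n t))\<^sup>2) \<longlonglongrightarrow> 0"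
      using lim
    proof eventually_elim
      case (elim t)
      then have "(\<lambda>n. (cmod (f t - S n t))\<^sup>2) \<longlonglongrightarrow> (cmod (f t - f t))\<^sup>2" by (intro tendsto_intros)
      then show ?case by simp
    qed
    show "AE t in M. norm ((cmod (f t - S n t))\<^sup>2) \<le> w t" for n using bound by simp
  qed simp_all
  then show ?thesis by (simp add: sqint_def)
qed

lemma lebesgue_translate:
  fixes a :: "'a::euclidean_space"
  shows "distr lebesgue lebesgue (\<lambda>t. t - a) = lebesgue" "(\<lambda>t. t - a) \<in> lebesgue \<rightarrow>\<^sub>M lebesgue"
proof -
  have T: "(\<lambda>x. - a + (\<Sum>j\<in>Basis. (1 * (x \<bullet> j)) *\<^sub>R j)) = (\<lambda>t. t - a)"
    by (auto simp: euclidean_representation)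
  have "lebesgue = density (distr lebesgue lebesgue (\<lambda>t. t - a)) (\<lambda>_. (\<Prod>j\<in>(Basis :: 'a set). ennreal \<bar>1\<bar>))"
    using lebesgue_affine_euclidean[of "\<lambda>_. 1" "- a"] unfolding T by simp
  then show "distr lebesgue lebesgue (\<lambda>t. t - a) = lebesgue" by (simp add: density_1)
  show "(\<lambda>t. t - a) \<in> lebesgue \<rightarrow>\<^sub>M lebesgue"
    using lebesgue_affine_measurable[of "\<lambda>_. 1" "- a"] unfolding T by simp
qed

lemma sqint_translate:
  fixes a :: "'a::euclidean_space"
  assumes "f \<in> L2 lebesgue"
  shows "(\<lambda>t. f (t - a)) \<in> L2 lebesgue" "sqint lebesgue (\<lambda>t. f (t - a)) = sqint lebesgue f"
proof -
  note [measurable] = lebesgue_translate(2)[of a] L2_measurable[OF assms]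
  have m: "(\<lambda>t. f (t - a)) \<in> borel_measurable lebesgue" by measurable
  have "integrable lebesgue (\<lambda>t. (cmod (f (t - a)))\<^sup>2) \<longleftrightarrow> integrable (distr lebesgue lebesgue (\<lambda>t. t - a)) (\<lambda>t. (cmod (f t))\<^sup>2)"
    by (subst integrable_distr_eq) auto
  then show "(\<lambda>t. f (t - a)) \<in> L2 lebesgue"
    using m L2_integrable[OF assms] by (simp add: L2_def lebesgue_translate(1))
  have "sqint lebesgue (\<lambda>t. f (t - a)) = (LINT t|distr lebesgue lebesgue (\<lambda>t. t - a). (cmod (f t))\<^sup>2)"
    unfolding sqint_def by (subst integral_distr) auto
  then show "sqint lebesgue (\<lambda>t. f (t - a)) = sqint lebesgue f" by (simp add: lebesgue_translate(1) sqint_def)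
qed

lemma time_freq_shift_L2:
  fixes g :: "real^'n \<Rightarrow> complex"
  assumes "g \<in> L2 lebesgue"
  shows "time_freq_shift z g \<in> L2 lebesgue" "sqint lebesgue (time_freq_shift z g) = sqint lebesgue g"
proof -
  have eq: "cmod (time_freq_shift z g t) = cmod (g (t - snd z))" for t
    by (simp add: time_freq_shift_def norm_mult)
  have "continuous_on UNIV (\<lambda>t::real^'n. exp (2 * complex_of_real pi * \<i> * complex_of_real (fst z \<bullet> t)))"
    by (intro continuous_intros)
  then have [measurable]: "(\<lambda>t::real^'n. exp (2 * complex_of_real pi * \<i> * complex_of_real (fst z \<bullet> t))) \<in> borel_measurable lebesgue"
    by (intro measurable_completion) (simp add: borel_measurable_continuous_onI)
  note [measurable] = L2_measurable[OF sqint_translate(1)[OF assms, of "snd z"]]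
  have "time_freq_shift z g \<in> borel_measurable lebesgue"
    unfolding time_freq_shift_def[abs_def] by measurable
  then show "time_freq_shift z g \<in> L2 lebesgue"
    using L2_integrable[OF sqint_translate(1)[OF assms, of "snd z"]] by (simp add: L2_def eq)
  show "sqint lebesgue (time_freq_shift z g) = sqint lebesgue g"
    using sqint_translate(2)[OF assms, of "snd z"] by (simp add: sqint_def eq)
qed

section \<open>Approximation by step functions on fine grids\<close>

definition gridpt :: "nat \<Rightarrow> real^'n \<Rightarrow> int^'n" where
  "gridpt p t = (\<chi> i. \<lfloor>real p * t $ i\<rfloor>)"

definition step :: "nat \<Rightarrow> (int^'n \<Rightarrow> complex) \<Rightarrow> real^'n \<Rightarrow> complex" where
  "step p C t = C (gridpt p t)"

definition grid_cube :: "nat \<Rightarrow> int^'n \<Rightarrow> (real^'n) set" where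
  "grid_cube p k = {t. gridpt p t = k}"

lemma grid_cube_measurable [measurable]: "grid_cube p k \<in> sets borel"
proof -
  have "grid_cube p k = {t. \<forall>i. \<lfloor>real p * t $ i\<rfloor> = k $ i}"
    by (auto simp: grid_cube_def gridpt_def Finite_Cartesian_Product.vec_eq_iff)
  also have "\<dots> \<in> sets borel" by measurable
  finally show ?thesis .
qed

lemma grid_cube_measure:
  assumes p: "p > 0"
  shows "emeasure lebesgue (grid_cube p (k :: int^'n)) = ennreal ((1 / p) ^ CARD('n))"
proof -
  define a b :: "real^'n" where "a = (\<chi> i. k $ i / p)" and "b = (\<chi> i. (k $ i + 1) / p)"
  have ab: "a $ i \<le> b $ i" for i using p by (simp add: a_def b_def divide_right_mono)
  have *: "\<lfloor>real p * x\<rfloor> = m \<longleftrightarrow> m / p \<le> x \<and> x < (m + 1) / p" for x and m :: int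
    using p by (simp add: floor_eq_iff field_simps)
  have sub: "box a b \<subseteq> grid_cube p k" "grid_cube p k \<subseteq> cbox a b"
    by (auto simp: grid_cube_def gridpt_def Finite_Cartesian_Product.vec_eq_iff mem_box_cart a_def b_def * less_imp_le)
  have "measure lborel (cbox a b) = (1 / p) ^ CARD('n)"
  proof -
    have "cbox a b \<noteq> {}" using ab by (auto simp: interval_ne_empty_cart)
    then have "measure lborel (cbox a b) = (\<Prod>i\<in>UNIV. b $ i - a $ i)" by (rule content_cbox_cart)
    also have "\<dots> = (\<Prod>i\<in>(UNIV :: 'n set). 1 / p)"
      by (intro prod.cong) (auto simp: a_def b_def diff_divide_distrib[symmetric])
    finally show ?thesis by simp
  qed
  moreover have "emeasure lborel (cbox a b) = ennreal (measure lborel (cbox a b))"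
    by (rule emeasure_eq_ennreal_measure) (use emeasure_lborel_cbox_finite[of a b] in auto)
  moreover have "emeasure lborel (box a b) = emeasure lborel (cbox a b)"
  proof -
    have "a \<bullet> j \<le> b \<bullet> j" if "j \<in> Basis" for j
      using that ab by (auto simp: Basis_vec_def inner_axis)
    then show ?thesis by (simp only: emeasure_lborel_box emeasure_lborel_cbox)
  qed
  moreover have "emeasure lborel (box a b) \<le> emeasure lborel (grid_cube p k)"
    "emeasure lborel (grid_cube p k) \<le> emeasure lborel (cbox a b)"
    using sub by (auto intro!: emeasure_mono)
  ultimately show ?thesis by simp
qed

lemma step_sum:
  assumes "finite {k. C k \<noteq> 0}"
  shows "step p C t = (\<Sum>k | C k \<noteq> 0. C k * indicator (grid_cube p k) t)"
proof -
  have "(\<Sum>k | C k \<noteq> 0. C k * indicator (grid_cube p k) t) = (\<Sum>k | C k \<noteq> 0. if k = gridpt p t then C k else 0)"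
    by (intro sum.cong) (auto simp: grid_cube_def indicator_def)
  also have "\<dots> = step p C t" using assms by (simp add: step_def)
  finally show ?thesis by simp
qed

lemma integrable_indicator_lmeasurable:
  "A \<in> lmeasurable \<Longrightarrow> integrable lebesgue (indicator A :: _ \<Rightarrow> real)"
  by (rule integrable_real_indicator) (auto simp: fmeasurable_def)

lemma indicator_L2:
  assumes "A \<in> lmeasurable"
  shows "(\<lambda>t. indicator A t :: complex) \<in> L2 lebesgue" "sqint lebesgue (indicator A) = measure lebesgue A"
proof -
  have [measurable]: "A \<in> sets lebesgue" using assms by auto
  have eq: "(cmod (indicator A t))\<^sup>2 = indicator A t" for t by (simp add: indicator_def)
  have "integrable lebesgue (indicator A :: _ \<Rightarrow> real)" using assms by (rule integrable_indicator_lmeasurable)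
  then show "(\<lambda>t. indicator A t :: complex) \<in> L2 lebesgue" by (simp add: L2_def eq)
  show "sqint lebesgue (indicator A) = measure lebesgue A" by (simp add: sqint_def eq)
qed

lemma grid_cube_lmeasurable: "p > 0 \<Longrightarrow> grid_cube p k \<in> lmeasurable"
  using grid_cube_measure[of p k] by (simp add: fmeasurable_def)

lemma step_L2:
  assumes "p > 0" "finite {k. C k \<noteq> 0}"
  shows "step p C \<in> L2 lebesgue"
proof -
  have "step p C = (\<lambda>t. \<Sum>k | C k \<noteq> 0. C k * indicator (grid_cube p k) t)"
    using step_sum[OF assms(2)] by auto
  also have "\<dots> \<in> L2 lebesgue"
    by (intro L2_sum L2_scale indicator_L2 grid_cube_lmeasurable assms)
  finally show ?thesis .
qed

lemma sqint_step:
  fixes C :: "int^'n \<Rightarrow> complex"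
  assumes "p > 0" "finite {k. C k \<noteq> 0}"
  shows "sqint lebesgue (step p C) = (1 / p) ^ CARD('n) * (\<Sum>k | C k \<noteq> 0. (cmod (C k))\<^sup>2)"
proof -
  have "(cmod (step p C t))\<^sup>2 = (\<Sum>k | C k \<noteq> 0. (cmod (C k))\<^sup>2 * indicator (grid_cube p k) t)" for t
  proof -
    have "(\<Sum>k | C k \<noteq> 0. (cmod (C k))\<^sup>2 * indicator (grid_cube p k) t) = (\<Sum>k | C k \<noteq> 0. if k = gridpt p t then (cmod (C k))\<^sup>2 else 0)"
      by (intro sum.cong) (auto simp: grid_cube_def indicator_def)
    also have "\<dots> = (cmod (step p C t))\<^sup>2" using assms(2) by (simp add: step_def)
    finally show ?thesis by simp
  qed
  then have "sqint lebesgue (step p C) = (LINT t|lebesgue. (\<Sum>k | C k \<noteq> 0. (cmod (C k))\<^sup>2 * indicator (grid_cube p k) t))"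
    by (simp add: sqint_def)
  also have "\<dots> = (\<Sum>k | C k \<noteq> 0. (cmod (C k))\<^sup>2 * measure lebesgue (grid_cube p k))"
    by (subst Bochner_Integration.integral_sum)
       (auto intro!: integrable_mult_right integrable_indicator_lmeasurable grid_cube_lmeasurable assms(1))
  also have "\<dots> = (\<Sum>k | C k \<noteq> 0. (cmod (C k))\<^sup>2 * (1 / p) ^ CARD('n))"
  proof -
    have "measure lebesgue (grid_cube p k) = (1 / p) ^ CARD('n)" for k :: "int^'n"
      unfolding measure_def grid_cube_measure[OF assms(1)] by simp
    then show ?thesis by simp
  qed
  finally show ?thesis by (simp add: sum_distrib_left mult.commute)
qed

text \<open>Approximation is demanded on all sufficiently fine grids, not just on one: two functions
  can then be treated on the same grid, which makes the class closed under sums.\<close>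

definition step_approx :: "(real^'n \<Rightarrow> complex) \<Rightarrow> bool" where
  "step_approx g \<longleftrightarrow> g \<in> L2 lebesgue \<and> (\<forall>e>0. \<exists>p0. \<forall>p\<ge>p0. \<exists>C. finite {k. C k \<noteq> 0} \<and> sqint lebesgue (\<lambda>t. g t - step p C t) < e)"

lemma step_approx_add:
  assumes f: "step_approx f" and g: "step_approx g"
  shows "step_approx (\<lambda>t. f t + g t)"
  unfolding step_approx_def
proof (intro conjI allI impI)
  show "(\<lambda>t. f t + g t) \<in> L2 lebesgue" using f g by (auto simp: step_approx_def intro!: L2_add)
  fix e :: real assume e: "e > 0"
  then have e4: "e / 4 > 0" by simp
  from f e4 obtain p1 where p1: "\<And>p. p \<ge> p1 \<Longrightarrow> \<exists>C. finite {k. C k \<noteq> 0} \<and> sqint lebesgue (\<lambda>t. f t - step p C t) < e / 4"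
    unfolding step_approx_def by blast
  from g e4 obtain p2 where p2: "\<And>p. p \<ge> p2 \<Longrightarrow> \<exists>C. finite {k. C k \<noteq> 0} \<and> sqint lebesgue (\<lambda>t. g t - step p C t) < e / 4"
    unfolding step_approx_def by blast
  show "\<exists>p0. \<forall>p\<ge>p0. \<exists>C. finite {k. C k \<noteq> 0} \<and> sqint lebesgue (\<lambda>t. f t + g t - step p C t) < e"
  proof (intro exI[of _ "max 1 (max p1 p2)"] allI impI)
    fix p assume p: "p \<ge> max 1 (max p1 p2)"
    obtain C where C: "finite {k. C k \<noteq> 0}" "sqint lebesgue (\<lambda>t. f t - step p C t) < e / 4" using p1[of p] p by auto
    obtain D where D: "finite {k. D k \<noteq> 0}" "sqint lebesgue (\<lambda>t. g t - step p D t) < e / 4" using p2[of p] p by auto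
    have "finite {k. C k + D k \<noteq> 0}" by (rule finite_subset[OF _ finite_UnI[OF C(1) D(1)]]) auto
    moreover have "sqint lebesgue (\<lambda>t. f t + g t - step p (\<lambda>k. C k + D k) t) < e"
    proof -
      have "(\<lambda>t. f t + g t - step p (\<lambda>k. C k + D k) t) = (\<lambda>t. (f t - step p C t) + (g t - step p D t))"
        by (auto simp: step_def)
      moreover have "sqint lebesgue (\<lambda>t. (f t - step p C t) + (g t - step p D t)) \<le>
          (1 + 1) * sqint lebesgue (\<lambda>t. f t - step p C t) + (1 + 1 / 1) * sqint lebesgue (\<lambda>t. g t - step p D t)"
        using f g p C D by (intro sqint_add_le L2_diff step_L2) (auto simp: step_approx_def)
      ultimately show ?thesis using C D by simp
    qed
    ultimately show "\<exists>C. finite {k. C k \<noteq> 0} \<and> sqint lebesgue (\<lambda>t. f t + g t - step p C t) < e"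
      by (intro exI[of _ "\<lambda>k. C k + D k"] conjI)
  qed
qed

lemma step_approx_zero: "step_approx (\<lambda>t. 0)"
  unfolding step_approx_def by (auto simp: L2_zero step_def sqint_def intro!: exI[of _ "\<lambda>k. 0"])

lemma step_approx_scale:
  assumes f: "step_approx f" shows "step_approx (\<lambda>t. c * f t)"
proof (cases "c = 0")
  case True
  then show ?thesis using step_approx_zero by simp
next
  case False
  show ?thesis unfolding step_approx_def
  proof (intro conjI allI impI)
    show "(\<lambda>t. c * f t) \<in> L2 lebesgue" using f by (auto simp: step_approx_def intro!: L2_scale)
    fix e :: real assume e: "e > 0"
    then have "e / (cmod c)\<^sup>2 > 0" using False by simp
    with f obtain p0 where p0: "\<And>p. p \<ge> p0 \<Longrightarrow> \<exists>C. finite {k. C k \<noteq> 0} \<and> sqint lebesgue (\<lambda>t. f t - step p C t) < e / (cmod c)\<^sup>2"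
      unfolding step_approx_def by blast
    show "\<exists>p0. \<forall>p\<ge>p0. \<exists>C. finite {k. C k \<noteq> 0} \<and> sqint lebesgue (\<lambda>t. c * f t - step p C t) < e"
    proof (intro exI[of _ p0] allI impI)
      fix p assume "p \<ge> p0"
      from p0[OF this] obtain C where C: "finite {k. C k \<noteq> 0}" "sqint lebesgue (\<lambda>t. f t - step p C t) < e / (cmod c)\<^sup>2" by blast
      have "(\<lambda>t. c * f t - step p (\<lambda>k. c * C k) t) = (\<lambda>t. c * (f t - step p C t))"
        by (auto simp: step_def algebra_simps)
      then have "sqint lebesgue (\<lambda>t. c * f t - step p (\<lambda>k. c * C k) t) = (cmod c)\<^sup>2 * sqint lebesgue (\<lambda>t. f t - step p C t)"
        by (simp add: sqint_scale)
      also have "\<dots> < e" using C(2) False by (simp add: pos_less_divide_eq mult.commute)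
      finally show "\<exists>C. finite {k. C k \<noteq> 0} \<and> sqint lebesgue (\<lambda>t. c * f t - step p C t) < e"
        using C(1) False by (intro exI[of _ "\<lambda>k. c * C k"]) simp
    qed
  qed
qed

lemma step_approx_sum: "(\<And>i. i \<in> F \<Longrightarrow> step_approx (u i)) \<Longrightarrow> step_approx (\<lambda>t. \<Sum>i\<in>F. u i t)"
  by (induction F rule: infinite_finite_induct) (auto simp: step_approx_zero intro!: step_approx_add)

lemma step_approx_limit:
  assumes g: "g \<in> L2 lebesgue" and S: "\<And>n. step_approx (S n)" and lim: "(\<lambda>n. sqint lebesgue (\<lambda>t. g t - S n t)) \<longlonglongrightarrow> 0"
  shows "step_approx g"
  unfolding step_approx_def
proof (intro conjI allI impI g)
  fix e :: real assume e: "e > 0"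
  have "eventually (\<lambda>n. sqint lebesgue (\<lambda>t. g t - S n t) < e / 4) sequentially"
    using lim e by (intro order_tendstoD) auto
  then obtain n where n: "sqint lebesgue (\<lambda>t. g t - S n t) < e / 4" by (auto simp: eventually_sequentially)
  have e4: "e / 4 > 0" using e by simp
  from S[of n] e4 obtain p0 where p0: "\<And>p. p \<ge> p0 \<Longrightarrow> \<exists>C. finite {k. C k \<noteq> 0} \<and> sqint lebesgue (\<lambda>t. S n t - step p C t) < e / 4"
    unfolding step_approx_def by blast
  show "\<exists>p0. \<forall>p\<ge>p0. \<exists>C. finite {k. C k \<noteq> 0} \<and> sqint lebesgue (\<lambda>t. g t - step p C t) < e"
  proof (intro exI[of _ "max 1 p0"] allI impI)
    fix p assume p: "p \<ge> max 1 p0"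
    then obtain C where C: "finite {k. C k \<noteq> 0}" "sqint lebesgue (\<lambda>t. S n t - step p C t) < e / 4" using p0[of p] by auto
    have "sqint lebesgue (\<lambda>t. (g t - S n t) + (S n t - step p C t)) \<le>
          (1 + 1) * sqint lebesgue (\<lambda>t. g t - S n t) + (1 + 1 / 1) * sqint lebesgue (\<lambda>t. S n t - step p C t)"
      using g S[of n] p C by (intro sqint_add_le L2_diff step_L2) (auto simp: step_approx_def)
    then have "sqint lebesgue (\<lambda>t. g t - step p C t) < e" using C n by simp
    then show "\<exists>C. finite {k. C k \<noteq> 0} \<and> sqint lebesgue (\<lambda>t. g t - step p C t) < e" using C(1) by blast
  qed
qed

lemma gridpt_near:
  fixes s t :: "real^'n"
  assumes p: "p > 0" and eq: "gridpt p s = gridpt p t"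
  shows "dist s t \<le> CARD('n) / p"
proof -
  have "\<bar>(s - t) $ i\<bar> \<le> 1 / p" for i
  proof -
    have "\<lfloor>real p * s $ i\<rfloor> = \<lfloor>real p * t $ i\<rfloor>" using eq by (simp add: gridpt_def Finite_Cartesian_Product.vec_eq_iff)
    then have "\<bar>real p * s $ i - real p * t $ i\<bar> \<le> 1" by linarith
    then have "p * \<bar>s $ i - t $ i\<bar> \<le> 1" by (simp add: right_diff_distrib[symmetric] abs_mult)
    then show ?thesis using p by (simp add: field_simps)
  qed
  then have "(\<Sum>i\<in>UNIV. \<bar>(s - t) $ i\<bar>) \<le> (\<Sum>i\<in>(UNIV :: 'n set). 1 / p)" by (intro sum_mono)
  then show ?thesis using norm_le_l1_cart[of "s - t"] by (simp add: dist_norm)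
qed

lemma finite_gridpt_bounded:
  assumes "bounded (K :: (real^'n) set)"
  shows "finite (gridpt p ` K)"
proof -
  obtain b where b: "\<And>t. t \<in> K \<Longrightarrow> norm t \<le> b" using assms by (auto simp: bounded_iff)
  define m where "m = \<lceil>p * b\<rceil> + 1"
  have "gridpt p t \<in> {k. \<forall>i. k $ i \<in> {-m..m}}" if "t \<in> K" for t
  proof -
    have "\<lfloor>real p * t $ i\<rfloor> \<in> {-m..m}" for i
    proof -
      have "\<bar>real p * t $ i\<bar> \<le> p * b"
        using component_le_norm_cart[of t i] b[OF that] by (simp add: abs_mult mult_left_mono)
      then have "- (p * b) \<le> real p * t $ i" "real p * t $ i \<le> p * b" by linarith+
      then have "- m \<le> \<lfloor>real p * t $ i\<rfloor>" "\<lfloor>real p * t $ i\<rfloor> \<le> m" unfolding m_def by linarith+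
      then show ?thesis by simp
    qed
    then show ?thesis by (simp add: gridpt_def)
  qed
  moreover have "finite {k :: int^'n. \<forall>i. k $ i \<in> {-m..m}}"
  proof -
    have "{k :: int^'n. \<forall>i. k $ i \<in> {-m..m}} \<subseteq> vec_lambda ` (PiE UNIV (\<lambda>_. {-m..m}))"
    proof
      fix k :: "int^'n" assume "k \<in> {k. \<forall>i. k $ i \<in> {-m..m}}"
      then have "(\<lambda>i. k $ i) \<in> PiE UNIV (\<lambda>_. {-m..m})" by auto
      then show "k \<in> vec_lambda ` (PiE UNIV (\<lambda>_. {-m..m}))"
        by (intro image_eqI[of _ _ "\<lambda>i. k $ i"]) (auto simp: Finite_Cartesian_Product.vec_eq_iff)
    qed
    moreover have "finite (vec_lambda ` (PiE (UNIV :: 'n set) (\<lambda>_. {-m..m})))"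
      by (intro finite_imageI finite_PiE) auto
    ultimately show ?thesis by (rule finite_subset)
  qed
  ultimately show ?thesis by (intro finite_subset[of "gridpt p ` K"] image_subsetI)
qed

text \<open>Regularity gives a compact K inside A and an open U around A with small gaps. On a grid
  finer than the distance from K to the complement of U, the cubes meeting K stay in U, so their
  union differs from A only on U - A and A - K.\<close>

lemma step_approx_indicator:
  fixes A :: "(real^'n) set"
  assumes A: "A \<in> sets lebesgue" "bounded A"
  shows "step_approx (indicator A)"
  unfolding step_approx_def
proof (intro conjI allI impI)
  have Alm: "A \<in> lmeasurable" using A by (rule bounded_set_imp_lmeasurable[rotated])
  then show AL2: "indicator A \<in> L2 lebesgue" by (rule indicator_L2)
  fix e :: real assume e: "e > 0"
  obtain U where U: "open U" "A \<subseteq> U" "U - A \<in> lmeasurable" "emeasure lebesgue (U - A) < ennreal (e / 2)"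
    using sets_lebesgue_outer_open[OF A(1), of "e / 2"] e by auto
  obtain K where K: "closed K" "K \<subseteq> A" "A - K \<in> lmeasurable" "emeasure lebesgue (A - K) < ennreal (e / 2)"
    using sets_lebesgue_inner_closed[OF A(1), of "e / 2"] e by auto
  have "bounded K" by (rule bounded_subset[OF A(2) K(2)])
  then have cK: "compact K" using K(1) by (simp add: compact_eq_bounded_closed)
  have "K \<inter> - U = {}" using K U by blast
  then obtain \<rho> where \<rho>: "\<rho> > 0" "\<And>x y. x \<in> K \<Longrightarrow> y \<in> - U \<Longrightarrow> \<rho> \<le> dist x y"
    using separate_compact_closed[OF cK, of "- U"] U(1) by (auto simp: closed_Compl)
  have meas: "measure lebesgue (U - A) < e / 2" "measure lebesgue (A - K) < e / 2"
    using U(3,4) K(3,4) e by (simp_all add: emeasure_eq_measure2 ennreal_less_iff)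
  show "\<exists>p0. \<forall>p\<ge>p0. \<exists>C. finite {k. C k \<noteq> 0} \<and> sqint lebesgue (\<lambda>t. indicator A t - step p C t) < e"
  proof (intro exI[of _ "nat \<lceil>CARD('n) / \<rho>\<rceil> + 1"] allI impI)
    fix p assume p: "p \<ge> nat \<lceil>CARD('n) / \<rho>\<rceil> + 1"
    then have p0: "p > 0" by simp
    have "real p > CARD('n) / \<rho>" using p by linarith
    then have p\<rho>: "CARD('n) / p < \<rho>" using \<rho>(1) p0 by (simp add: field_simps)
    define C :: "int^'n \<Rightarrow> complex" where "C = indicator (gridpt p ` K)"
    have "{k. C k \<noteq> 0} \<subseteq> gridpt p ` K" by (auto simp: C_def indicator_def)
    then have finC: "finite {k. C k \<noteq> 0}" by (rule finite_subset[OF _ finite_gridpt_bounded[OF \<open>bounded K\<close>]])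
    have L: "U - A \<union> (A - K) \<in> lmeasurable" using U(3) K(3) by (rule fmeasurable.Un)
    have le: "(cmod (indicator A t - step p C t))\<^sup>2 \<le> (cmod (indicator (U - A \<union> (A - K)) t))\<^sup>2" for t
    proof -
      consider "t \<in> K" | "t \<in> U - A \<union> (A - K)" | "t \<notin> U" using K(2) by blast
      then show ?thesis
      proof cases
        case 1
        then have "C (gridpt p t) = 1" by (simp add: C_def)
        then show ?thesis using 1 K(2) by (auto simp: step_def)
      next
        case 2
        have "cmod (indicator A t - step p C t) \<le> 1"
          by (auto simp: step_def C_def indicator_def)
        then show ?thesis using 2 by (simp add: power_le_one)
      next
        case 3
        have "gridpt p t \<notin> gridpt p ` K"
        proof
          assume "gridpt p t \<in> gridpt p ` K"
          then obtain s where s: "s \<in> K" "gridpt p s = gridpt p t" by auto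
          then have "\<rho> \<le> dist s t" using \<rho>(2) 3 by simp
          then show False using gridpt_near[OF p0 s(2)] p\<rho> by linarith
        qed
        then show ?thesis using 3 U(2) by (auto simp: step_def C_def indicator_def)
      qed
    qed
    have "sqint lebesgue (\<lambda>t. indicator A t - step p C t) \<le> sqint lebesgue (indicator (U - A \<union> (A - K)))"
      unfolding sqint_def
      by (intro integral_mono le L2_integrable L2_diff AL2 step_L2 p0 finC indicator_L2 L)
    also have "\<dots> \<le> measure lebesgue (U - A) + measure lebesgue (A - K)"
      unfolding indicator_L2(2)[OF L] using U(3) K(3) by (intro measure_Un_le) auto
    also have "\<dots> < e" using meas by simp
    finally show "\<exists>C. finite {k. C k \<noteq> 0} \<and> sqint lebesgue (\<lambda>t. indicator A t - step p C t) < e"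
      using finC by blast
  qed
qed

text \<open>Simple functions bounded by 2 |g| and cut off to balls converge to \<open>g\<close> by
  dominated convergence; the dominating factor is (1 + 2)^2 = 9.\<close>

lemma step_approx_L2:
  fixes g :: "real^'n \<Rightarrow> complex"
  assumes g: "g \<in> L2 lebesgue"
  shows "step_approx g"
proof -
  have gm: "g \<in> borel_measurable lebesgue" by (rule L2_measurable[OF g])
  obtain s where s: "\<And>i. simple_function lebesgue (s i)" "\<And>x. (\<lambda>i. s i x) \<longlonglongrightarrow> g x"
    "\<And>i x. cmod (s i x) \<le> 2 * cmod (g x)"
    using borel_measurable_implies_sequence_metric[OF gm, of 0] by (auto simp: dist_norm)
  define S where "S = (\<lambda>n t. indicator (cball 0 (real n)) t * s n t)"
  have Sle: "cmod (S n t) \<le> 2 * cmod (g t)" for n t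
    using s(3)[of n t] by (auto simp: S_def indicator_def)
  have [measurable]: "s n \<in> borel_measurable lebesgue" for n
    using s(1)[of n] by (rule borel_measurable_simple_function)
  have "S n = (\<lambda>t. \<Sum>y\<in>s n ` UNIV. y * indicator (s n -` {y} \<inter> cball 0 (real n)) t)" for n
  proof
    fix t
    have "s n t = (\<Sum>y\<in>s n ` UNIV. indicator (s n -` {y}) t *\<^sub>R y)"
      using simple_function_indicator_representation_banach[OF s(1)[of n], of t]
      by (simp only: space_completion space_lborel space_borel UNIV_I Int_UNIV_right)
    then have "S n t = indicator (cball 0 (real n)) t * (\<Sum>y\<in>s n ` UNIV. indicator (s n -` {y}) t *\<^sub>R y)"
      by (simp only: S_def)
    then show "S n t = (\<Sum>y\<in>s n ` UNIV. y * indicator (s n -` {y} \<inter> cball 0 (real n)) t)"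
      unfolding sum_distrib_left by (simp only:) (rule sum.cong[OF refl], auto simp: indicator_def split: if_splits)
  qed
  moreover have "step_approx (\<lambda>t. \<Sum>y\<in>s n ` UNIV. y * indicator (s n -` {y} \<inter> cball 0 (real n)) t)" for n
  proof (intro step_approx_sum step_approx_scale step_approx_indicator)
    fix y
    have "s n -` {y} \<inter> space lebesgue \<in> sets lebesgue" by measurable
    then show "s n -` {y} \<inter> cball 0 (real n) \<in> sets lebesgue" by (intro sets.Int) auto
    show "bounded (s n -` {y} \<inter> cball 0 (real n))" by (rule bounded_subset[OF bounded_cball]) auto
  qed
  ultimately have SA: "step_approx (S n)" for n by simp
  have "(\<lambda>n. sqint lebesgue (\<lambda>t. g t - S n t)) \<longlonglongrightarrow> 0"
  proof (rule sqint_dominated[OF _ gm])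
    show "S n \<in> borel_measurable lebesgue" for n using SA[of n] by (auto simp: step_approx_def L2_def)
    show "integrable lebesgue (\<lambda>t. 9 * (cmod (g t))\<^sup>2)" using L2_integrable[OF g] by simp
    show "AE t in lebesgue. (\<lambda>n. S n t) \<longlonglongrightarrow> g t"
    proof (rule AE_I2)
      fix t
      have "eventually (\<lambda>n. s n t = S n t) sequentially"
        using eventually_ge_at_top[of "nat \<lceil>norm t\<rceil>"]
        by eventually_elim (auto simp: S_def indicator_def nat_ceiling_le_eq)
      then show "(\<lambda>n. S n t) \<longlonglongrightarrow> g t" using s(2)[of t] by (rule Lim_transform_eventually[rotated])
    qed
    show "AE t in lebesgue. (cmod (g t - S n t))\<^sup>2 \<le> 9 * (cmod (g t))\<^sup>2" for n
    proof (rule AE_I2)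
      fix t
      have "cmod (g t - S n t) \<le> 3 * cmod (g t)"
        using norm_triangle_ineq4[of "g t" "S n t"] Sle[of n t] by simp
      then have "(cmod (g t - S n t))\<^sup>2 \<le> (3 * cmod (g t))\<^sup>2" by (intro power_mono) auto
      then show "(cmod (g t - S n t))\<^sup>2 \<le> 9 * (cmod (g t))\<^sup>2" by (simp add: power_mult_distrib)
    qed
  qed
  then show ?thesis by (rule step_approx_limit[OF g SA])
qed

section \<open>Strong continuity of time-frequency shifts\<close>

lemma gridpt_eventually_const:
  fixes t :: "real^'n"
  assumes lim: "x \<longlonglongrightarrow> t" and nz: "\<And>i. real p * t $ i \<notin> \<int>"
  shows "eventually (\<lambda>n. gridpt p (x n) = gridpt p t) sequentially"
proof -
  have "eventually (\<lambda>n. \<lfloor>real p * x n $ i\<rfloor> = \<lfloor>real p * t $ i\<rfloor>) sequentially" for i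
    by (rule eventually_floor_eq) (intro tendsto_intros lim nz)+
  then have "eventually (\<lambda>n. \<forall>i. \<lfloor>real p * x n $ i\<rfloor> = \<lfloor>real p * t $ i\<rfloor>) sequentially"
    by (intro eventually_all_finite)
  then show ?thesis by eventually_elim (simp add: gridpt_def Finite_Cartesian_Product.vec_eq_iff)
qed

text \<open>A step function is locally constant off the faces of its grid, a null set, so the
  shifted functions converge pointwise almost everywhere; they are uniformly bounded and supported
  in one ball.\<close>

lemma time_freq_shift_step_continuous:
  fixes z :: "nat \<Rightarrow> (real^'n) \<times> (real^'n)"
  assumes p: "p > 0" and C: "finite {k. C k \<noteq> 0}" and lim: "z \<longlonglongrightarrow> w"
  shows "(\<lambda>n. sqint lebesgue (\<lambda>t. time_freq_shift w (step p C) t - time_freq_shift (z n) (step p C) t)) \<longlonglongrightarrow> 0"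
proof -
  note tfL2 = time_freq_shift_L2(1)[OF step_L2[OF p C]]
  define b where "b = (\<Sum>k | C k \<noteq> 0. cmod (C k))"
  have Cb: "cmod (C k) \<le> b" for k
  proof (cases "C k = 0")
    case True
    then show ?thesis by (simp add: b_def sum_nonneg)
  next
    case False
    then show ?thesis unfolding b_def using C by (intro member_le_sum) auto
  qed
  \<comment> \<open>A crude radius of the support: l1 bounds summed over all cubes with a nonzero
    coefficient.\<close>
  define r where "r = (\<Sum>k | C k \<noteq> 0. \<Sum>i\<in>UNIV. (\<bar>real_of_int (k $ i)\<bar> + 1) / p)"
  have supp: "norm t \<le> r" if "step p C t \<noteq> 0" for t
  proof -
    define k where "k = gridpt p t"
    have k: "C k \<noteq> 0" using that by (simp add: step_def k_def)
    have "\<bar>t $ i\<bar> \<le> (\<bar>real_of_int (k $ i)\<bar> + 1) / p" for i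
    proof -
      have "\<lfloor>real p * t $ i\<rfloor> = k $ i" by (simp add: k_def gridpt_def)
      then have "\<bar>real p * t $ i\<bar> \<le> \<bar>real_of_int (k $ i)\<bar> + 1" by linarith
      then show ?thesis using p by (simp add: abs_mult pos_le_divide_eq mult.commute)
    qed
    then have "norm t \<le> (\<Sum>i\<in>UNIV. (\<bar>real_of_int (k $ i)\<bar> + 1) / p)"
      by (intro order.trans[OF norm_le_l1_cart] sum_mono)
    also have "\<dots> \<le> r"
    proof -
      have "(\<Sum>i\<in>UNIV. (\<bar>real_of_int (k $ i)\<bar> + 1) / p) \<le> (\<Sum>k\<in>{k. C k \<noteq> 0}. \<Sum>i\<in>UNIV. (\<bar>real_of_int (k $ i)\<bar> + 1) / p)"
        using C k p by (intro member_le_sum[where f = "\<lambda>k. \<Sum>i\<in>UNIV. (\<bar>real_of_int (k $ i)\<bar> + 1) / p"] sum_nonneg) auto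
      then show ?thesis by (simp add: r_def)
    qed
    finally show ?thesis .
  qed
  have "convergent (\<lambda>n. snd (z n))" using tendsto_snd[OF lim] by (rule convergentI)
  then have "Bseq (\<lambda>n. snd (z n))" by (rule convergent_imp_Bseq)
  then obtain q where q: "\<And>n. norm (snd (z n)) \<le> q" unfolding Bseq_def by blast
  have lim2: "(\<lambda>n. snd (z n)) \<longlonglongrightarrow> snd w" by (rule tendsto_snd[OF lim])
  have qw: "norm (snd w) \<le> q"
    by (rule LIMSEQ_le_const2[OF tendsto_norm[OF lim2]]) (use q in auto)
  define R where "R = r + q"
  have suppR: "cmod (time_freq_shift v (step p C) t) \<le> b * indicator (cball 0 R) t" if "norm (snd v) \<le> q" for v t
  proof (cases "step p C (t - snd v) = 0")
    case True
    then show ?thesis using Cb[of 0] norm_ge_zero[of "C 0"] by (simp add: time_freq_shift_def indicator_def del: norm_ge_zero)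
  next
    case False
    have "norm t \<le> norm (t - snd v) + norm (snd v)" by (metis diff_add_cancel norm_triangle_ineq)
    then have "t \<in> cball 0 R" using supp[OF False] that by (simp add: R_def)
    moreover have "cmod (time_freq_shift v (step p C) t) \<le> b"
      using Cb by (simp add: time_freq_shift_def norm_mult step_def)
    ultimately show ?thesis by simp
  qed
  show ?thesis
  proof (rule sqint_dominated)
    show "time_freq_shift (z n) (step p C) \<in> borel_measurable lebesgue" for n by (rule L2_measurable[OF tfL2])
    show "time_freq_shift w (step p C) \<in> borel_measurable lebesgue" by (rule L2_measurable[OF tfL2])
    show "integrable lebesgue (\<lambda>t::real^'n. (2 * b)\<^sup>2 * indicator (cball 0 R) t)"
      by (intro integrable_mult_right integrable_indicator_lmeasurable) auto
    show "AE t in lebesgue. (cmod (time_freq_shift w (step p C) t - time_freq_shift (z n) (step p C) t))\<^sup>2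
        \<le> (2 * b)\<^sup>2 * indicator (cball 0 R) t" for n
    proof (rule AE_I2)
      fix t
      have "cmod (time_freq_shift w (step p C) t - time_freq_shift (z n) (step p C) t) \<le> 2 * b * indicator (cball 0 R) t"
        using norm_triangle_ineq4[of "time_freq_shift w (step p C) t" "time_freq_shift (z n) (step p C) t"]
          suppR[OF qw, of t] suppR[OF q, of n t] by simp
      then have "(cmod (time_freq_shift w (step p C) t - time_freq_shift (z n) (step p C) t))\<^sup>2 \<le> (2 * b * indicator (cball 0 R) t)\<^sup>2"
        by (intro power_mono) auto
      moreover have "(2 * b * indicator (cball 0 R) t)\<^sup>2 = (2 * b)\<^sup>2 * (indicator (cball 0 R) t :: real)"
        by (simp add: indicator_def)
      ultimately show "(cmod (time_freq_shift w (step p C) t - time_freq_shift (z n) (step p C) t))\<^sup>2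
        \<le> (2 * b)\<^sup>2 * indicator (cball 0 R) t" by (simp only:)
    qed
    have "AE t in lebesgue. \<forall>i. \<forall>m::int. t $ i \<noteq> snd w $ i + m / p"
    proof -
      have "AE t in lebesgue. t $ i \<noteq> snd w $ i + m / p" for i :: 'n and m :: int
      proof (rule AE_I')
        have "negligible {t :: real^'n. t \<bullet> axis i 1 = snd w $ i + m / p}"
          by (rule negligible_standard_hyperplane) (auto simp: Basis_vec_def)
        then show "{t. t $ i = snd w $ i + m / p} \<in> null_sets lebesgue"
          by (simp add: negligible_iff_null_sets inner_axis)
      qed simp
      then have "AE t in lebesgue. \<forall>m::int. t $ i \<noteq> snd w $ i + m / p" for i :: 'n by (simp add: AE_all_countable)
      then show ?thesis by (simp add: AE_all_countable)
    qed
    then show "AE t in lebesgue. (\<lambda>n. time_freq_shift (z n) (step p C) t) \<longlonglongrightarrow> time_freq_shift w (step p C) t"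
    proof eventually_elim
      case (elim t)
      have "real p * (t - snd w) $ i \<notin> \<int>" for i
      proof
        assume "real p * (t - snd w) $ i \<in> \<int>"
        then obtain m :: int where "real p * (t - snd w) $ i = m" by (auto elim: Ints_cases)
        then have "t $ i = snd w $ i + m / p" using p by (simp add: field_simps)
        then show False using elim by blast
      qed
      then have "eventually (\<lambda>n. gridpt p (t - snd (z n)) = gridpt p (t - snd w)) sequentially"
        by (intro gridpt_eventually_const tendsto_intros lim2)
      then have "eventually (\<lambda>n. exp (2 * complex_of_real pi * \<i> * complex_of_real (fst (z n) \<bullet> t)) * step p C (t - snd w) = time_freq_shift (z n) (step p C) t) sequentially"
        by eventually_elim (simp add: time_freq_shift_def step_def)
      moreover have "(\<lambda>n. exp (2 * complex_of_real pi * \<i> * complex_of_real (fst (z n) \<bullet> t)) * step p C (t - snd w)) \<longlonglongrightarrow> time_freq_shift w (step p C) t"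
        unfolding time_freq_shift_def by (intro tendsto_intros tendsto_fst[OF lim])
      ultimately show ?case by (rule Lim_transform_eventually[rotated])
    qed
  qed
qed

text \<open>Shifts are isometries, so replacing \<open>g\<close> by a step function costs the same
  at every point. Four times e / 16 is e / 4, and twice e / 4 + e / 4 is e.\<close>

lemma time_freq_shift_continuous:
  fixes g :: "real^'n \<Rightarrow> complex"
  assumes g: "g \<in> L2 lebesgue" and lim: "z \<longlonglongrightarrow> w"
  shows "(\<lambda>n. sqint lebesgue (\<lambda>t. time_freq_shift w g t - time_freq_shift (z n) g t)) \<longlonglongrightarrow> 0"
proof (rule tendstoI)
  fix e :: real assume e: "e > 0"
  have e16: "e / 16 > 0" using e by simp
  from step_approx_L2[OF g] e16 obtain p0 where "\<And>p. p \<ge> p0 \<Longrightarrow> \<exists>C. finite {k. C k \<noteq> 0} \<and> sqint lebesgue (\<lambda>t. g t - step p C t) < e / 16"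
    unfolding step_approx_def by blast
  from this[of "Suc p0"] obtain C where C: "finite {k. C k \<noteq> 0}" "sqint lebesgue (\<lambda>t. g t - step (Suc p0) C t) < e / 16" by auto
  define \<phi> where "\<phi> = step (Suc p0) C"
  have \<phi>: "\<phi> \<in> L2 lebesgue" unfolding \<phi>_def by (rule step_L2[OF _ C(1)]) simp
  define h where "h = (\<lambda>t. g t - \<phi> t)"
  have h: "h \<in> L2 lebesgue" unfolding h_def by (intro L2_diff g \<phi>)
  have hle: "sqint lebesgue h < e / 16" using C(2) by (simp add: h_def \<phi>_def)
  have "eventually (\<lambda>n. sqint lebesgue (\<lambda>t. time_freq_shift w \<phi> t - time_freq_shift (z n) \<phi> t) < e / 4) sequentially"
    using time_freq_shift_step_continuous[OF _ C(1) lim, of "Suc p0"] e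
    unfolding \<phi>_def by (intro order_tendstoD) auto
  then show "eventually (\<lambda>n. dist (sqint lebesgue (\<lambda>t. time_freq_shift w g t - time_freq_shift (z n) g t)) 0 < e) sequentially"
  proof eventually_elim
    case (elim n)
    define u where "u = (\<lambda>t. time_freq_shift w \<phi> t - time_freq_shift (z n) \<phi> t)"
    define v where "v = (\<lambda>t. time_freq_shift w h t + (-1) * time_freq_shift (z n) h t)"
    have u: "u \<in> L2 lebesgue" unfolding u_def by (intro L2_diff time_freq_shift_L2 \<phi>)
    have v: "v \<in> L2 lebesgue" unfolding v_def by (intro L2_add L2_scale time_freq_shift_L2 h)
    have "sqint lebesgue v \<le> (1 + 1) * sqint lebesgue (time_freq_shift w h) + (1 + 1 / 1) * sqint lebesgue (\<lambda>t. (-1) * time_freq_shift (z n) h t)"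
      unfolding v_def by (intro sqint_add_le L2_scale time_freq_shift_L2 h) simp
    also have "\<dots> = 4 * sqint lebesgue h"
      unfolding sqint_scale time_freq_shift_L2(2)[OF h] by simp
    finally have vle: "sqint lebesgue v < e / 4" using hle by simp
    have "sqint lebesgue (\<lambda>t. u t + v t) \<le> (1 + 1) * sqint lebesgue u + (1 + 1 / 1) * sqint lebesgue v"
      by (intro sqint_add_le u v) simp
    also have "\<dots> < e" using vle elim by (simp add: u_def)
    also have "(\<lambda>t. u t + v t) = (\<lambda>t. time_freq_shift w g t - time_freq_shift (z n) g t)"
      by (auto simp: u_def v_def h_def time_freq_shift_def algebra_simps)
    finally show ?case by (simp add: dist_real_def sqint_nonneg)
  qed
qed

section \<open>Bessel bound on a fine lattice\<close>

definition wave :: "real \<Rightarrow> complex" where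
  "wave x = exp (2 * complex_of_real pi * \<i> * complex_of_real x)"

lemma wave_add: "wave (x + y) = wave x * wave y"
  by (simp add: wave_def exp_add ring_distribs)

lemma wave_0 [simp]: "wave 0 = 1" by (simp add: wave_def)

lemma cnj_wave: "cnj (wave x) = wave (- x)"
  by (simp add: wave_def exp_cnj)

lemma cmod_wave [simp]: "cmod (wave x) = 1"
  by (simp add: wave_def)

lemma wave_int [simp]: "wave (real_of_int k) = 1"
proof -
  have "wave (real_of_int k) = exp (complex_of_real (real_of_int (2 * k) * pi) * \<i>)"
    by (simp add: wave_def algebra_simps)
  also have "\<dots> = 1" using exp_integer_2pi[of "of_int k"] by (simp add: algebra_simps)
  finally show ?thesis .
qed

lemma wave_sum: "finite A \<Longrightarrow> wave (\<Sum>i\<in>A. f i) = (\<Prod>i\<in>A. wave (f i))"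
  by (induction A rule: finite_induct) (auto simp: wave_add)

lemma continuous_on_wave [continuous_intros]: "continuous_on S f \<Longrightarrow> continuous_on S (\<lambda>x. wave (f x))"
  unfolding wave_def by (intro continuous_intros)

lemma integral_wave_interval:
  fixes k :: int
  assumes P: "P > 0"
  shows "integrable lborel (\<lambda>s. indicator {a..a + P} s *\<^sub>R wave (real_of_int k * s / P))"
    "(LINT s|lborel. indicator {a..a + P} s *\<^sub>R wave (real_of_int k * s / P)) = (if k = 0 then of_real P else 0)"
proof -
  define w where "w = 2 * complex_of_real pi * \<i> * of_int k / of_real P"
  have wave_w: "wave (real_of_int k * s / P) = exp (w * of_real s)" for s
    by (simp add: wave_def w_def mult.assoc)
  have cont: "continuous_on {a..a + P} (\<lambda>s. wave (real_of_int k * s / P))"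
    by (intro continuous_intros) (use P in auto)
  define F where "F = (\<lambda>s. if k = 0 then complex_of_real s else exp (w * of_real s) / w)"
  have w0: "w \<noteq> 0" if "k \<noteq> 0" using that P by (simp add: w_def)
  have deriv: "(F has_vector_derivative wave (real_of_int k * s / P)) (at s within {a..a + P})" for s
  proof (cases "k = 0")
    case True
    then show ?thesis unfolding F_def by (auto intro!: derivative_eq_intros)
  next
    case False
    have "((\<lambda>z. exp (w * z) / w) has_field_derivative exp (w * of_real s)) (at (of_real s))"
      using w0[OF False] by (auto intro!: derivative_eq_intros)
    then have "((\<lambda>s. exp (w * of_real s) / w) has_vector_derivative exp (w * of_real s)) (at s within {a..a + P})"
      by (rule has_vector_derivative_real_field)
    then show ?thesis unfolding F_def wave_w using False by simp
  qed
  have le: "a \<le> a + P" using P by simp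
  note * = has_bochner_integral_FTC_Icc[OF le deriv cont] integral_FTC_Icc[OF le deriv cont]
  show "integrable lborel (\<lambda>s. indicator {a..a + P} s *\<^sub>R wave (real_of_int k * s / P))"
    using *(1) by (rule integrable.intros)
  have "F (a + P) - F a = (if k = 0 then of_real P else 0)"
  proof (cases "k = 0")
    case False
    have "exp (w * of_real (a + P)) = wave (real_of_int k * a / P + real_of_int k)"
      unfolding wave_w[symmetric] using P by (simp add: add_divide_distrib algebra_simps)
    also have "\<dots> = exp (w * of_real a)" by (simp add: wave_add wave_w)
    finally show ?thesis using False by (simp add: F_def)
  qed (simp add: F_def)
  with *(2) show "(LINT s|lborel. indicator {a..a + P} s *\<^sub>R wave (real_of_int k * s / P)) = (if k = 0 then of_real P else 0)"
    by simp
qed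

definition side_cube :: "real^'n \<Rightarrow> real \<Rightarrow> (real^'n) set" where
  "side_cube x P = {t. \<forall>i. x $ i \<le> t $ i \<and> t $ i \<le> x $ i + P}"

lemma side_cube_measurable [measurable]: "side_cube x P \<in> sets borel"
  unfolding side_cube_def by measurable

definition of_int_vec :: "int^'n \<Rightarrow> real^'n" where
  "of_int_vec k = (\<chi> i. real_of_int (k $ i))"

text \<open>Indicator and exponential are both products over the coordinates, so the integral
  factors into integrals over one period.\<close>

lemma integral_wave_cube:
  fixes k :: "int^'n"
  assumes P: "P > 0"
  shows "(LINT t|lborel. indicator (side_cube x P) t *\<^sub>R wave (of_int_vec k \<bullet> t / P)) = (if k = 0 then of_real P ^ CARD('n) else 0)"
proof -
  let ?f = "\<lambda>t. indicator (side_cube x P) t *\<^sub>R wave (of_int_vec k \<bullet> t / P)"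
  \<comment> \<open>The floor recovers the integer coordinate of \<open>k\<close> from the real
    inner product with a basis vector.\<close>
  define h where "h = (\<lambda>(b::real^'n) s. indicator {x \<bullet> b..x \<bullet> b + P} s *\<^sub>R wave (real_of_int \<lfloor>of_int_vec k \<bullet> b\<rfloor> * s / P))"
  have kb: "real_of_int \<lfloor>of_int_vec k \<bullet> b\<rfloor> = of_int_vec k \<bullet> b" if "b \<in> Basis" for b
    using that by (auto simp: Basis_vec_def inner_axis of_int_vec_def)
  have [measurable]: "(\<lambda>t::real^'n. wave (of_int_vec k \<bullet> t / P)) \<in> borel_measurable borel"
    by (intro borel_measurable_continuous_onI continuous_intros) (use P in auto)
  have meas: "?f \<in> borel_measurable borel" by measurable
  have eq: "?f (\<Sum>b\<in>Basis. f b *\<^sub>R b) = (\<Prod>b\<in>Basis. h b (f b))" for f :: "real^'n \<Rightarrow> real"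
  proof -
    define t where "t = (\<Sum>b\<in>Basis. f b *\<^sub>R b)"
    have tb: "t \<bullet> b = f b" if "b \<in> Basis" for b using that by (simp add: t_def inner_sum_left_Basis)
    have "of_int_vec k \<bullet> t / P = (\<Sum>b\<in>Basis. real_of_int \<lfloor>of_int_vec k \<bullet> b\<rfloor> * f b / P)"
      unfolding t_def by (simp add: inner_sum_right sum_divide_distrib kb mult.commute)
    then have 1: "wave (of_int_vec k \<bullet> t / P) = (\<Prod>b\<in>Basis. wave (real_of_int \<lfloor>of_int_vec k \<bullet> b\<rfloor> * f b / P))"
      by (simp add: wave_sum)
    have "t \<in> side_cube x P \<longleftrightarrow> (\<forall>b\<in>Basis. f b \<in> {x \<bullet> b..x \<bullet> b + P})"
    proof -
      have "t \<in> side_cube x P \<longleftrightarrow> (\<forall>b\<in>Basis. x \<bullet> b \<le> t \<bullet> b \<and> t \<bullet> b \<le> x \<bullet> b + P)"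
        by (auto simp: side_cube_def Basis_vec_def inner_axis)
      then show ?thesis using tb by auto
    qed
    then have 2: "indicator (side_cube x P) t = (\<Prod>b\<in>Basis. indicator {x \<bullet> b..x \<bullet> b + P} (f b) :: real)"
      by (simp add: indicator_def prod_zero_iff)
    show ?thesis unfolding t_def[symmetric] 1 2 h_def
      by (simp add: scaleR_conv_of_real prod.distrib)
  qed
  interpret product_sigma_finite "\<lambda>_::real^'n. lborel :: real measure"
    by standard
  have "(LINT t|lborel. ?f t) = (LINT f|Pi\<^sub>M Basis (\<lambda>_. lborel). ?f (\<Sum>b\<in>Basis. f b *\<^sub>R b))"
    by (subst lborel_eq, subst integral_distr) (auto intro: meas)
  also have "\<dots> = (LINT f|Pi\<^sub>M Basis (\<lambda>_. lborel). (\<Prod>b\<in>Basis. h b (f b)))"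
    by (simp only: eq)
  also have "\<dots> = (\<Prod>b\<in>Basis. (LINT s|lborel. h b s))"
    unfolding h_def by (rule product_integral_prod) (auto intro: integral_wave_interval(1)[OF P])
  also have "\<dots> = (\<Prod>b\<in>(Basis::(real^'n) set). if \<lfloor>of_int_vec k \<bullet> b\<rfloor> = 0 then of_real P else 0)"
    unfolding h_def integral_wave_interval(2)[OF P] ..
  also have "\<dots> = (if k = 0 then of_real P ^ CARD('n) else 0)"
  proof (cases "k = 0")
    case True
    then have "of_int_vec k = 0" by (simp add: of_int_vec_def Finite_Cartesian_Product.vec_eq_iff)
    then show ?thesis using True by simp
  next
    case False
    then obtain i where i: "k $ i \<noteq> 0" by (auto simp: Finite_Cartesian_Product.vec_eq_iff)
    have "(axis i 1 :: real^'n) \<in> Basis" by (auto simp: Basis_vec_def)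
    moreover have "\<lfloor>of_int_vec k \<bullet> axis i 1\<rfloor> \<noteq> 0" using i by (simp add: inner_axis of_int_vec_def)
    ultimately show ?thesis using False P by (auto simp: prod_zero_iff)
  qed
  finally show ?thesis .
qed

lemma sum_cmod_power2_expand:
  "complex_of_real ((cmod (\<Sum>i\<in>A. u i))\<^sup>2) = (\<Sum>i\<in>A. \<Sum>j\<in>A. u i * cnj (u j))"
  by (simp only: complex_norm_square cnj_sum sum_product)

text \<open>Parseval: exponentials with frequencies in (1/P) Z^n are orthogonal on every cube of
  side \<open>P\<close>.\<close>

lemma trig_poly_cube:
  fixes c :: "int^'n \<Rightarrow> complex"
  assumes P: "P > 0" and A: "finite A"
  shows "integrable lebesgue (\<lambda>t. indicator (side_cube x P) t * (cmod (\<Sum>l\<in>A. c l * wave (of_int_vec l \<bullet> t / P)))\<^sup>2)"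
    "(LINT t|lebesgue. indicator (side_cube x P) t * (cmod (\<Sum>l\<in>A. c l * wave (of_int_vec l \<bullet> t / P)))\<^sup>2) =
       P ^ CARD('n) * (\<Sum>l\<in>A. (cmod (c l))\<^sup>2)"
proof -
  let ?D = "\<lambda>t. \<Sum>l\<in>A. c l * wave (of_int_vec l \<bullet> t / P)"
  let ?e = "\<lambda>k t. indicator (side_cube x P) t *\<^sub>R wave (of_int_vec k \<bullet> t / P)"
  have meas: "(\<lambda>t::real^'n. wave (of_int_vec k \<bullet> t / P)) \<in> borel_measurable borel" for k
    by (intro borel_measurable_continuous_onI continuous_intros) (use P in auto)
  note [measurable] = meas
  have int: "integrable lborel (?e k)" for k :: "int^'n"
  proof (rule integrableI_bounded_set[of "side_cube x P" _ _ 1])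
    have "side_cube x P \<subseteq> cbox x (\<chi> i. x $ i + P)" by (auto simp: side_cube_def mem_box_cart)
    then have "emeasure lborel (side_cube x P) \<le> emeasure lborel (cbox x (\<chi> i. x $ i + P))" by (intro emeasure_mono) auto
    also have "\<dots> < \<infinity>" by (rule emeasure_lborel_cbox_finite)
    finally show "emeasure lborel (side_cube x P) < \<infinity>" .
    show "side_cube x P \<in> sets lborel" by simp
  qed (auto simp: indicator_def)
  have sub: "of_int_vec l - of_int_vec m = of_int_vec (l - m)" for l m :: "int^'n"
    by (simp add: of_int_vec_def Finite_Cartesian_Product.vec_eq_iff)
  have eq: "complex_of_real (indicator (side_cube x P) t * (cmod (?D t))\<^sup>2) = (\<Sum>l\<in>A. \<Sum>m\<in>A. (c l * cnj (c m)) * ?e (l - m) t)" for t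
  proof -
    have ww: "wave (of_int_vec l \<bullet> t / P) * cnj (wave (of_int_vec m \<bullet> t / P)) = wave (of_int_vec (l - m) \<bullet> t / P)" for l m
      by (simp add: cnj_wave wave_add[symmetric] sub[symmetric] inner_diff_left diff_divide_distrib)
    have "(c l * wave (of_int_vec l \<bullet> t / P)) * cnj (c m * wave (of_int_vec m \<bullet> t / P)) =
        (c l * cnj (c m)) * wave (of_int_vec (l - m) \<bullet> t / P)" for l m
      unfolding ww[symmetric] by (simp add: mult_ac)
    then have "complex_of_real ((cmod (?D t))\<^sup>2) = (\<Sum>l\<in>A. \<Sum>m\<in>A. (c l * cnj (c m)) * wave (of_int_vec (l - m) \<bullet> t / P))"
      unfolding sum_cmod_power2_expand by (simp only:)
    then show ?thesis
      by (simp only: of_real_mult sum_distrib_left scaleR_conv_of_real mult.left_commute)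
  qed
  have intc: "integrable lborel (\<lambda>t. complex_of_real (indicator (side_cube x P) t * (cmod (?D t))\<^sup>2))"
    unfolding eq by (intro Bochner_Integration.integrable_sum integrable_mult_right int)
  then have intr: "integrable lborel (\<lambda>t. indicator (side_cube x P) t * (cmod (?D t))\<^sup>2)"
    by (subst (asm) complex_of_real_integrable_eq)
  then show "integrable lebesgue (\<lambda>t. indicator (side_cube x P) t * (cmod (?D t))\<^sup>2)"
    by (subst integrable_completion) auto
  have "complex_of_real (LINT t|lborel. indicator (side_cube x P) t * (cmod (?D t))\<^sup>2) =
      (LINT t|lborel. complex_of_real (indicator (side_cube x P) t * (cmod (?D t))\<^sup>2))"
    by (rule integral_complex_of_real[symmetric])
  also have "\<dots> = (\<Sum>l\<in>A. \<Sum>m\<in>A. (c l * cnj (c m)) * (LINT t|lborel. ?e (l - m) t))"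
    unfolding eq by (simp only: Bochner_Integration.integral_sum Bochner_Integration.integrable_sum integrable_mult_right int integral_mult_right_zero)
  also have "\<dots> = (\<Sum>l\<in>A. \<Sum>m\<in>A. if m = l then (c l * cnj (c l)) * of_real P ^ CARD('n) else 0)"
    unfolding integral_wave_cube[OF P] by (intro sum.cong refl) auto
  also have "\<dots> = (\<Sum>l\<in>A. (c l * cnj (c l)) * of_real P ^ CARD('n))"
    using A by (intro sum.cong refl) simp
  also have "\<dots> = complex_of_real (P ^ CARD('n) * (\<Sum>l\<in>A. (cmod (c l))\<^sup>2))"
    by (simp add: complex_norm_square[symmetric] sum_distrib_left mult.commute del: of_real_power) simp
  finally have "(LINT t|lborel. indicator (side_cube x P) t * (cmod (?D t))\<^sup>2) = P ^ CARD('n) * (\<Sum>l\<in>A. (cmod (c l))\<^sup>2)"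
    by (simp only: of_real_eq_iff)
  then show "(LINT t|lebesgue. indicator (side_cube x P) t * (cmod (?D t))\<^sup>2) = P ^ CARD('n) * (\<Sum>l\<in>A. (cmod (c l))\<^sup>2)"
    using intr by (subst integral_completion) auto
qed

definition tf_grid :: "nat \<Rightarrow> nat \<Rightarrow> (int^'n) \<times> (int^'n) \<Rightarrow> (real^'n) \<times> (real^'n)" where
  "tf_grid P p k = ((1 / P) *\<^sub>R of_int_vec (fst k), (1 / p) *\<^sub>R of_int_vec (snd k))"

lemma gridpt_shift:
  assumes "p > 0" shows "gridpt p (t - (1 / p) *\<^sub>R of_int_vec m) = gridpt p t - m"
proof -
  have "\<lfloor>real p * (t $ i - m $ i / p)\<rfloor> = \<lfloor>real p * t $ i\<rfloor> - m $ i" for i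
  proof -
    have "real p * (t $ i - m $ i / p) = real p * t $ i - of_int (m $ i)"
      using assms by (simp add: right_diff_distrib)
    then show ?thesis by simp
  qed
  then show ?thesis by (simp add: gridpt_def of_int_vec_def Finite_Cartesian_Product.vec_eq_iff)
qed

text \<open>Points are grouped by their translation m. Translating by a multiple of 1 / p only
  shifts the coefficients \<open>C\<close>, so the weights |C (g - m)|^2 at a given point add up to
  at most \<open>Q\<close>. Pointwise Cauchy-Schwarz over m leaves one trigonometric polynomial per
  m, on a cube of side \<open>P\<close>, where Parseval is exact.\<close>

lemma step_grid_bessel:
  fixes C :: "int^'n \<Rightarrow> complex" and F :: "((int^'n) \<times> (int^'n)) set"
  assumes p: "p > 0" and P: "P > 0" and C: "finite {k. C k \<noteq> 0}"
    and R: "\<And>k i. C k \<noteq> 0 \<Longrightarrow> - R \<le> k $ i \<and> k $ i < R" and PR: "2 * real_of_int R \<le> P * p"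
    and F: "finite F"
  shows "sqint lebesgue (\<lambda>t. \<Sum>k\<in>F. c k * time_freq_shift (tf_grid P p k) (step p C) t) \<le>
    (real P * real p) ^ CARD('n) * sqint lebesgue (step p C) * (\<Sum>k\<in>F. (cmod (c k))\<^sup>2)"
proof -
  define Ms where "Ms = snd ` F"
  define Ls where "Ls = (\<lambda>m. {l. (l, m) \<in> F})"
  have finM: "finite Ms" using F by (simp add: Ms_def)
  have finL: "finite (Ls m)" for m
    by (rule finite_subset[of _ "fst ` F"]) (use F in \<open>force simp: Ls_def\<close>)+
  have FS: "F = (\<lambda>(m, l). (l, m)) ` (SIGMA m:Ms. Ls m)"
    by (force simp: Ms_def Ls_def)
  have sumF: "(\<Sum>k\<in>F. f k) = (\<Sum>m\<in>Ms. \<Sum>l\<in>Ls m. f (l, m))" for f :: "_ \<Rightarrow> 'b::comm_monoid_add"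
    by (subst FS, subst sum.reindex) (auto simp: inj_on_def sum.Sigma finM finL case_prod_unfold)
  define D where "D = (\<lambda>m t. \<Sum>l\<in>Ls m. c (l, m) * wave (of_int_vec l \<bullet> t / P))"
  \<comment> \<open>Lower corner of a cube of side \<open>P\<close> around the support of the
    translate by m / p; the support fits because its side 2 R / p is at most P by
    \<open>PR\<close>.\<close>
  define x where "x = (\<lambda>m. (1 / p) *\<^sub>R of_int_vec m + (\<chi> i. - R / p) :: real^'n)"
  define Q where "Q = (\<Sum>k | C k \<noteq> 0. (cmod (C k))\<^sup>2)"
  have expand: "(\<Sum>k\<in>F. c k * time_freq_shift (tf_grid P p k) (step p C) t) = (\<Sum>m\<in>Ms. C (gridpt p t - m) * D m t)" for t
    unfolding sumF
  proof (rule sum.cong[OF refl])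
    fix m
    have "c (l, m) * time_freq_shift (tf_grid P p (l, m)) (step p C) t = C (gridpt p t - m) * (c (l, m) * wave (of_int_vec l \<bullet> t / P))" for l
      using gridpt_shift[OF p, of t m] by (simp add: time_freq_shift_def tf_grid_def wave_def step_def mult_ac)
    then show "(\<Sum>l\<in>Ls m. c (l, m) * time_freq_shift (tf_grid P p (l, m)) (step p C) t) = C (gridpt p t - m) * D m t"
      by (simp only: D_def sum_distrib_left)
  qed
  have inside: "t \<in> side_cube (x m) P" if "C (gridpt p t - m) \<noteq> 0" for t m
  proof -
    have "x m $ i \<le> t $ i \<and> t $ i \<le> x m $ i + P" for i
    proof -
      have "- R \<le> \<lfloor>real p * t $ i\<rfloor> - m $ i" "\<lfloor>real p * t $ i\<rfloor> - m $ i < R"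
        using R[OF that, of i] by (auto simp: gridpt_def)
      then have "real_of_int (m $ i) - R \<le> real p * t $ i" "real p * t $ i \<le> real_of_int (m $ i) + R" by linarith+
      then have "(real_of_int (m $ i) - R) / p \<le> t $ i" "t $ i \<le> (real_of_int (m $ i) + R) / p"
        using p by (simp_all add: pos_divide_le_eq pos_le_divide_eq mult.commute)
      moreover have "x m $ i = (real_of_int (m $ i) - R) / p"
        by (simp add: x_def of_int_vec_def diff_divide_distrib)
      moreover have "(real_of_int (m $ i) + R) / p \<le> (real_of_int (m $ i) - R) / p + P"
      proof -
        have "(real_of_int (m $ i) + R) / p = (real_of_int (m $ i) - R) / p + 2 * R / p"
          by (simp add: add_divide_distrib diff_divide_distrib)
        also have "2 * R / p \<le> P" using PR p by (simp add: pos_divide_le_eq)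
        finally show ?thesis by simp
      qed
      ultimately show ?thesis by linarith
    qed
    then show ?thesis by (simp add: side_cube_def)
  qed
  have Qle: "(\<Sum>m\<in>Ms. (cmod (C (g - m)))\<^sup>2) \<le> Q" for g
  proof -
    have "(\<Sum>m\<in>Ms. (cmod (C (g - m)))\<^sup>2) = (\<Sum>k\<in>(\<lambda>m. g - m) ` Ms. (cmod (C k))\<^sup>2)"
      by (subst sum.reindex) (auto simp: inj_on_def)
    also have "\<dots> = (\<Sum>k\<in>(\<lambda>m. g - m) ` Ms \<inter> {k. C k \<noteq> 0}. (cmod (C k))\<^sup>2)"
      using finM by (intro sum.mono_neutral_right) auto
    also have "\<dots> \<le> Q" unfolding Q_def using C by (intro sum_mono2) auto
    finally show ?thesis .
  qed
  have Q0: "Q \<ge> 0" unfolding Q_def by (simp add: sum_nonneg)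
  have le: "(cmod (\<Sum>k\<in>F. c k * time_freq_shift (tf_grid P p k) (step p C) t))\<^sup>2 \<le>
      Q * (\<Sum>m\<in>Ms. indicator (side_cube (x m) P) t * (cmod (D m t))\<^sup>2)" for t
  proof -
    have "cmod (\<Sum>m\<in>Ms. C (gridpt p t - m) * D m t) \<le> (\<Sum>m\<in>Ms. cmod (C (gridpt p t - m)) * (indicator (side_cube (x m) P) t * cmod (D m t)))"
    proof (rule order.trans[OF norm_sum sum_mono])
      fix m
      show "cmod (C (gridpt p t - m) * D m t) \<le> cmod (C (gridpt p t - m)) * (indicator (side_cube (x m) P) t * cmod (D m t))"
        using inside[of t m] by (cases "C (gridpt p t - m) = 0") (auto simp: norm_mult)
    qed
    then have "(cmod (\<Sum>m\<in>Ms. C (gridpt p t - m) * D m t))\<^sup>2 \<le> (\<Sum>m\<in>Ms. cmod (C (gridpt p t - m)) * (indicator (side_cube (x m) P) t * cmod (D m t)))\<^sup>2"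
      by (intro power_mono) auto
    also have "\<dots> \<le> (\<Sum>m\<in>Ms. (cmod (C (gridpt p t - m)))\<^sup>2) * (\<Sum>m\<in>Ms. (indicator (side_cube (x m) P) t * cmod (D m t))\<^sup>2)"
      by (rule Cauchy_Schwarz_ineq_sum)
    also have "\<dots> \<le> Q * (\<Sum>m\<in>Ms. (indicator (side_cube (x m) P) t * cmod (D m t))\<^sup>2)"
      by (intro mult_right_mono Qle sum_nonneg) simp
    also have "(\<Sum>m\<in>Ms. (indicator (side_cube (x m) P) t * cmod (D m t))\<^sup>2) = (\<Sum>m\<in>Ms. indicator (side_cube (x m) P) t * (cmod (D m t))\<^sup>2)"
      by (intro sum.cong) (auto simp: indicator_def)
    finally show ?thesis unfolding expand .
  qed
  note trig = trig_poly_cube[of "real P", OF _ finL]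
  have intD: "integrable lebesgue (\<lambda>t. indicator (side_cube (x m) P) t * (cmod (D m t))\<^sup>2)" for m
    unfolding D_def using P by (intro trig(1)) simp
  have "sqint lebesgue (\<lambda>t. \<Sum>k\<in>F. c k * time_freq_shift (tf_grid P p k) (step p C) t) \<le>
      (LINT t|lebesgue. Q * (\<Sum>m\<in>Ms. indicator (side_cube (x m) P) t * (cmod (D m t))\<^sup>2))"
    unfolding sqint_def
    by (intro integral_mono le L2_integrable L2_sum L2_scale time_freq_shift_L2 step_L2 p C integrable_mult_right Bochner_Integration.integrable_sum intD)
  also have "\<dots> = Q * (\<Sum>m\<in>Ms. real P ^ CARD('n) * (\<Sum>l\<in>Ls m. (cmod (c (l, m)))\<^sup>2))"
    using P intD unfolding D_def by (simp add: Bochner_Integration.integral_sum trig(2))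
  also have "\<dots> = Q * real P ^ CARD('n) * (\<Sum>k\<in>F. (cmod (c k))\<^sup>2)"
    unfolding sumF by (simp add: sum_distrib_left mult.assoc)
  also have "Q = real p ^ CARD('n) * sqint lebesgue (step p C)"
    unfolding sqint_step[OF p C] Q_def using p by (simp add: power_one_over)
  finally show ?thesis by (simp add: power_mult_distrib mult_ac)
qed

section \<open>Two-sided selection\<close>

lemma quad_form_scale: "quad_form S (\<lambda>i j. of_real a * M i j) c = a * quad_form S M c"
proof -
  have "sesq S c (mat_app S (\<lambda>i j. of_real a * M i j) c) = of_real a * sesq S c (mat_app S M c)"
    unfolding sesq_def mat_app_def sum_distrib_left by (intro sum.cong refl) (simp only: mult_ac)
  then show ?thesis by (simp add: quad_form_def)
qed

lemma quad_form_id_minus: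
  assumes "finite S"
  shows "quad_form S (\<lambda>i j. (if i = j then 1 else 0) - of_real a * M i j) c = sq_norm S c - a * quad_form S M c"
proof -
  have "mat_app S (\<lambda>i j. (if i = j then 1 else 0) - of_real a * M i j) c i = c i - mat_app S (\<lambda>i j. of_real a * M i j) c i"
    if "i \<in> S" for i
  proof -
    have "(\<Sum>j\<in>S. (if i = j then 1 else 0) * c j) = (\<Sum>j\<in>S. if i = j then c j else 0)"
      by (intro sum.cong) auto
    also have "\<dots> = c i" using assms that by simp
    finally show ?thesis by (simp add: mat_app_def left_diff_distrib sum_subtractf)
  qed
  then have "sesq S c (mat_app S (\<lambda>i j. (if i = j then 1 else 0) - of_real a * M i j) c) =
      sesq S c c - sesq S c (mat_app S (\<lambda>i j. of_real a * M i j) c)"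
    by (simp add: sesq_def right_diff_distrib sum_subtractf)
  then show ?thesis
    using quad_form_scale[of S a M c] by (simp add: quad_form_def sq_norm_eq_sesq)
qed

text \<open>Multiplied out, the bound of the second selection is below 1 exactly when (s2 + 1) / s1
  * (1 + t) < 1 / D, which is \<open>cond\<close>.\<close>

lemma selection_constants:
  fixes \<gamma> V t D A :: real and s1 s2 :: nat
  assumes pos: "\<gamma> > 0" "V > 0" "t > 0"
    and D: "D = (1 + t)\<^sup>2 * (1 / t + (real s1 + 1) / V)"
    and cond: "(real s2 + 1) / real s1 * (1 + t) * D < 1"
    and A: "A = \<gamma> * D * (1 - (1 + t) * ((1 - 1 / D) + (real s2 + 1) / real s1 * t) / (t + (1 - 1 / D)))"
  shows "D \<ge> 1" "A > 0"
proof -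
  have "1 / t * (1 + t)\<^sup>2 \<ge> 1"
    using pos by (simp add: power2_eq_square field_simps)
  moreover have "(1 + t)\<^sup>2 * ((real s1 + 1) / V) \<ge> 0" using pos by simp
  ultimately have D1: "D \<ge> 1" unfolding D distrib_left by (simp add: mult.commute)
  have \<alpha>0: "0 \<le> 1 - 1 / D" "0 < t + (1 - 1 / D)" using D1 pos by (auto simp: add_pos_nonneg)
  define q where "q = (real s2 + 1) / real s1"
  have "q * (1 + t) < 1 / D" using cond D1 by (simp add: q_def field_simps)
  then have "(1 + t) * ((1 - 1 / D) + q * t) < t + (1 - 1 / D)"
  proof -
    have "t * (q * (1 + t)) < t * (1 / D)" using \<open>q * (1 + t) < 1 / D\<close> pos by (intro mult_strict_left_mono) auto
    then show ?thesis by (simp add: algebra_simps add_divide_distrib)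
  qed
  then have \<beta>2: "(1 + t) * ((1 - 1 / D) + q * t) / (t + (1 - 1 / D)) < 1" using \<alpha>0 by simp
  then show "A > 0" unfolding A using pos D1 by (simp add: q_def)
  show "D \<ge> 1" by (rule D1)
qed

text \<open>\<open>N\<close> counts lattice points per unit of cell volume and also bounds, up to 1
  + t, the norm of \<open>G\<close> relative to its diagonal. That the same number plays both roles
  makes \<open>D\<close> independent of it.\<close>

theorem two_sided_selector:
  fixes I :: "'i set" and grp :: "'i \<Rightarrow> 'k" and \<gamma> N V t :: real
  assumes finI: "finite I" and herm: "herm_on I G" and psd: "\<And>c. 0 \<le> quad_form I G c"
    and bound: "\<And>c. quad_form I G c \<le> \<gamma> * N * (1 + t) * sq_norm I c"
    and diag: "\<And>i. i \<in> I \<Longrightarrow> Re (G i i) = \<gamma>"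
    and finK: "finite K" and grp: "grp ` I \<subseteq> K"
    and r: "\<And>k. k \<in> K \<Longrightarrow> card {i \<in> I. grp i = k} = r" and rNV: "real r = N * V"
    and s: "s1 < r" "s2 < s1" and pos: "\<gamma> > 0" "N > 0" "V > 0" "t > 0"
    and D: "D = (1 + t)\<^sup>2 * (1 / t + (real s1 + 1) / V)"
    and cond: "(real s2 + 1) / real s1 * (1 + t) * D < 1"
    and A: "A = \<gamma> * D * (1 - (1 + t) * ((1 - 1 / D) + (real s2 + 1) / real s1 * t) / (t + (1 - 1 / D)))"
  shows "\<exists>S\<subseteq>I. (\<forall>k\<in>K. card {i \<in> S. grp i = k} = s2) \<and>
      (\<forall>c. A * sq_norm S c \<le> quad_form S G c \<and> quad_form S G c \<le> \<gamma> * D * sq_norm S c)"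
proof -
  note D1 = selection_constants(1)[OF pos(1,3,4) D cond A]
  have \<alpha>0: "0 \<le> 1 - 1 / D" using D1 by simp
  \<comment> \<open>This scaling makes \<open>G\<close> a contraction with diagonal 1 / (N (1 + t)),
    which is at most 1 / N.\<close>
  define a where "a = 1 / (\<gamma> * N * (1 + t))"
  have a: "a > 0" using pos by (simp add: a_def)
  obtain S1 where S1: "S1 \<subseteq> I" "\<And>k. k \<in> K \<Longrightarrow> card {i \<in> S1. grp i = k} = s1"
    "\<And>c. quad_form S1 (\<lambda>i j. of_real a * G i j) c \<le> (1 + t) * (1 / N + (real s1 + 1) / real r * t) / (t + 1 / N) * sq_norm S1 c"
  proof (rule selector[OF finI _ _ _ finK grp r s(1), of "\<lambda>i j. of_real a * G i j" "1 / N" t])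
    show "herm_on I (\<lambda>i j. of_real a * G i j)"
      unfolding herm_on_def
    proof (intro ballI)
      fix i j assume "i \<in> I" "j \<in> I"
      with herm have "G j i = cnj (G i j)" unfolding herm_on_def by blast
      then show "of_real a * G j i = cnj (of_real a * G i j)" by simp
    qed
    show "0 \<le> quad_form I (\<lambda>i j. of_real a * G i j) c" for c
      unfolding quad_form_scale using a psd by simp
    show "quad_form I (\<lambda>i j. of_real a * G i j) c \<le> sq_norm I c" for c
    proof -
      have "a * quad_form I G c \<le> a * (\<gamma> * N * (1 + t) * sq_norm I c)" using a bound by (intro mult_left_mono) auto
      also have "\<dots> = sq_norm I c" using pos by (simp add: a_def)
      finally show ?thesis unfolding quad_form_scale .
    qed
    show "Re (of_real a * G i i) \<le> 1 / N" if "i \<in> I" for i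
    proof -
      have "Re (of_real a * G i i) = 1 / (N * (1 + t))" using diag[OF that] pos by (simp add: a_def)
      also have "\<dots> \<le> 1 / N" using pos by (intro divide_left_mono) auto
      finally show ?thesis .
    qed
  qed (use pos in auto)
  have bound1: "quad_form S1 G c \<le> \<gamma> * D * sq_norm S1 c" for c
  proof -
    \<comment> \<open>Dropping 1 / N from the denominator leaves a pure factor 1 / N, as r = N V; it
      cancels against \<gamma> N (1 + t), and what remains is \<open>\<gamma> * D\<close>.\<close>
    have "(1 + t) * (1 / N + (real s1 + 1) / real r * t) / (t + 1 / N) \<le> (1 + t) * (1 / N + (real s1 + 1) / real r * t) / t"
      using pos by (intro divide_left_mono mult_nonneg_nonneg add_nonneg_nonneg mult_pos_pos add_pos_pos) auto
    also have "\<dots> = (1 + t) * (1 / t + (real s1 + 1) / V) / N"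
      unfolding rNV using pos by (simp add: field_simps)
    finally have "a * quad_form S1 G c \<le> (1 + t) * (1 / t + (real s1 + 1) / V) / N * sq_norm S1 c"
      using S1(3)[of c] mult_right_mono[OF _ sq_norm_nonneg] unfolding quad_form_scale by (meson order.trans)
    then have "(\<gamma> * N * (1 + t)) * (a * quad_form S1 G c) \<le> (\<gamma> * N * (1 + t)) * ((1 + t) * (1 / t + (real s1 + 1) / V) / N * sq_norm S1 c)"
      using pos by (intro mult_left_mono) auto
    then show ?thesis unfolding a_def D using pos by (simp add: power2_eq_square mult_ac)
  qed
  have finS1: "finite S1" using S1(1) finI by (rule finite_subset)
  have psd1: "0 \<le> quad_form S1 G c" for c
    using psd quad_form_restrict[OF finI S1(1)] by metis
  \<comment> \<open>Selecting from \<open>1 - G / (\<gamma>D)\<close> turns its upper bound into a lower bound for \<open>G\<close>.\<close>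
  define b where "b = 1 / (\<gamma> * D)"
  have b: "b > 0" using pos D1 by (simp add: b_def)
  let ?M = "\<lambda>i j. (if i = j then 1 else 0) - of_real b * G i j"
  obtain S where S: "S \<subseteq> S1" "\<And>k. k \<in> K \<Longrightarrow> card {i \<in> S. grp i = k} = s2"
    "\<And>c. quad_form S ?M c \<le> (1 + t) * ((1 - 1 / D) + (real s2 + 1) / real s1 * t) / (t + (1 - 1 / D)) * sq_norm S c"
  proof (rule selector[OF finS1 _ _ _ finK _ S1(2) s(2), of ?M "1 - 1 / D" t])
    show "herm_on S1 ?M" 
      unfolding herm_on_def
    proof (intro ballI)
      fix i j assume "i \<in> S1" "j \<in> S1"
      with herm_on_subset[OF herm S1(1)] have "G j i = cnj (G i j)" unfolding herm_on_def by blast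
      then show "?M j i = cnj (?M i j)" by (simp add: eq_commute[of j i])
    qed
    show "0 \<le> quad_form S1 ?M c" for c
    proof -
      have "b * quad_form S1 G c \<le> b * (\<gamma> * D * sq_norm S1 c)" using b bound1 by (intro mult_left_mono) auto
      also have "\<dots> = sq_norm S1 c" using pos D1 by (simp add: b_def)
      finally show ?thesis unfolding quad_form_id_minus[OF finS1] by simp
    qed
    show "quad_form S1 ?M c \<le> sq_norm S1 c" for c
      unfolding quad_form_id_minus[OF finS1] using b psd1 by simp
    show "Re (?M i i) \<le> 1 - 1 / D" if "i \<in> S1" for i
      using diag[of i] that S1(1) pos D1 by (auto simp: b_def)
    show "grp ` S1 \<subseteq> K" using S1(1) grp by blast
  qed (use pos \<alpha>0 in auto)
  have finS: "finite S" using S(1) finS1 by (rule finite_subset)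
  show "\<exists>S\<subseteq>I. (\<forall>k\<in>K. card {i \<in> S. grp i = k} = s2) \<and>
      (\<forall>c. A * sq_norm S c \<le> quad_form S G c \<and> quad_form S G c \<le> \<gamma> * D * sq_norm S c)"
  proof (intro exI[of _ S] conjI ballI allI)
    show "S \<subseteq> I" using S(1) S1(1) by (rule order.trans)
    fix c
    let ?\<beta> = "(1 + t) * ((1 - 1 / D) + (real s2 + 1) / real s1 * t) / (t + (1 - 1 / D))"
    have "sq_norm S c - b * quad_form S G c \<le> ?\<beta> * sq_norm S c"
      using S(3)[of c] unfolding quad_form_id_minus[OF finS] .
    then have "(1 - ?\<beta>) * sq_norm S c \<le> b * quad_form S G c" by (simp add: left_diff_distrib)
    then have "\<gamma> * D * ((1 - ?\<beta>) * sq_norm S c) \<le> \<gamma> * D * (b * quad_form S G c)"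
      using pos D1 by (intro mult_left_mono) auto
    moreover have "\<gamma> * D * (b * quad_form S G c) = quad_form S G c"
      using pos D1 by (simp add: b_def)
    ultimately show "A * sq_norm S c \<le> quad_form S G c" unfolding A by (simp only: mult.assoc)
    have "quad_form S1 G (\<lambda>i. if i \<in> S then c i else 0) \<le> \<gamma> * D * sq_norm S1 (\<lambda>i. if i \<in> S then c i else 0)"
      by (rule bound1)
    then show "quad_form S G c \<le> \<gamma> * D * sq_norm S c"
      unfolding quad_form_restrict(1)[OF finS1 S(1), of G c] quad_form_restrict(2)[OF finS1 S(1)] .
  qed (rule S(2))
qed

section \<open>Gram matrices and cells\<close>

definition gram :: "'a measure \<Rightarrow> ('i \<Rightarrow> 'a \<Rightarrow> complex) \<Rightarrow> 'i \<Rightarrow> 'i \<Rightarrow> complex" where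
  "gram M u i j = (LINT t|M. cnj (u i t) * u j t)"

lemma L2_prod_integrable:
  assumes f: "f \<in> L2 M" and g: "g \<in> L2 M"
  shows "integrable M (\<lambda>t. cnj (f t) * g t)"
proof (rule Bochner_Integration.integrable_bound)
  note [measurable] = L2_measurable[OF f] L2_measurable[OF g]
  show "integrable M (\<lambda>t. (cmod (f t))\<^sup>2 + (cmod (g t))\<^sup>2)"
    using L2_integrable[OF f] L2_integrable[OF g] by auto
  show "AE t in M. norm (cnj (f t) * g t) \<le> norm ((cmod (f t))\<^sup>2 + (cmod (g t))\<^sup>2)"
  proof (rule AE_I2)
    fix t
    have "0 \<le> (cmod (f t) - cmod (g t))\<^sup>2" by simp
    then have "2 * (cmod (f t) * cmod (g t)) \<le> (cmod (f t))\<^sup>2 + (cmod (g t))\<^sup>2"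
      by (simp add: power2_eq_square algebra_simps)
    moreover have "0 \<le> cmod (f t) * cmod (g t)" by simp
    ultimately have "cmod (f t) * cmod (g t) \<le> (cmod (f t))\<^sup>2 + (cmod (g t))\<^sup>2" by linarith
    then show "norm (cnj (f t) * g t) \<le> norm ((cmod (f t))\<^sup>2 + (cmod (g t))\<^sup>2)"
      by (simp add: norm_mult)
  qed
  show "(\<lambda>t. cnj (f t) * g t) \<in> borel_measurable M"
    by (intro borel_measurable_times measurable_compose[OF L2_measurable[OF f] borel_measurable_continuous_onI]
        continuous_on_cnj continuous_on_id L2_measurable[OF g])
qed

lemma gram_herm: "herm_on I (gram M u)"
  unfolding herm_on_def gram_def
proof (intro ballI)
  fix i j
  have "(\<lambda>t. cnj (u j t) * u i t) = (\<lambda>t. cnj (cnj (u i t) * u j t))" by (simp add: mult.commute)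
  then show "(LINT t|M. cnj (u j t) * u i t) = cnj (LINT t|M. cnj (u i t) * u j t)"
    by (simp only: Bochner_Integration.integral_cnj)
qed

lemma gram_diag: "gram M u i i = of_real (sqint M (u i))"
proof -
  have "(\<lambda>t. cnj (u i t) * u i t) = (\<lambda>t. complex_of_real ((cmod (u i t))\<^sup>2))"
    by (simp only: complex_norm_square mult.commute)
  then show ?thesis unfolding gram_def sqint_def by (simp only: integral_complex_of_real)
qed

lemma quad_form_gram:
  assumes u: "\<And>i. i \<in> F \<Longrightarrow> u i \<in> L2 M"
  shows "quad_form F (gram M u) c = sqint M (\<lambda>t. \<Sum>i\<in>F. c i * u i t)"
proof -
  have int: "integrable M (\<lambda>t. cnj (u i t) * u j t)" if "i \<in> F" "j \<in> F" for i j
    by (intro L2_prod_integrable u that)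
  have eq: "complex_of_real ((cmod (\<Sum>i\<in>F. c i * u i t))\<^sup>2) =
      (\<Sum>i\<in>F. \<Sum>j\<in>F. (cnj (c i) * c j) * (cnj (u i t) * u j t))" for t
  proof -
    have "complex_of_real ((cmod (\<Sum>i\<in>F. c i * u i t))\<^sup>2) =
        (\<Sum>j\<in>F. \<Sum>i\<in>F. (c j * u j t) * cnj (c i * u i t))" by (rule sum_cmod_power2_expand)
    also have "\<dots> = (\<Sum>i\<in>F. \<Sum>j\<in>F. (c j * u j t) * cnj (c i * u i t))" by (rule sum.swap)
    finally show ?thesis by (simp add: mult_ac)
  qed
  have "complex_of_real (sqint M (\<lambda>t. \<Sum>i\<in>F. c i * u i t)) =
      (LINT t|M. complex_of_real ((cmod (\<Sum>i\<in>F. c i * u i t))\<^sup>2))"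
    unfolding sqint_def by (rule integral_complex_of_real[symmetric])
  also have "\<dots> = (\<Sum>i\<in>F. LINT t|M. (\<Sum>j\<in>F. (cnj (c i) * c j) * (cnj (u i t) * u j t)))"
    unfolding eq
    by (rule Bochner_Integration.integral_sum) (intro Bochner_Integration.integrable_sum integrable_mult_right int)
  also have "\<dots> = (\<Sum>i\<in>F. \<Sum>j\<in>F. (cnj (c i) * c j) * (LINT t|M. cnj (u i t) * u j t))"
  proof (rule sum.cong[OF refl])
    fix i assume i: "i \<in> F"
    have "(LINT t|M. (\<Sum>j\<in>F. (cnj (c i) * c j) * (cnj (u i t) * u j t))) =
        (\<Sum>j\<in>F. LINT t|M. (cnj (c i) * c j) * (cnj (u i t) * u j t))"
      by (rule Bochner_Integration.integral_sum) (intro integrable_mult_right int i)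
    then show "(LINT t|M. (\<Sum>j\<in>F. (cnj (c i) * c j) * (cnj (u i t) * u j t))) =
        (\<Sum>j\<in>F. (cnj (c i) * c j) * (LINT t|M. cnj (u i t) * u j t))" by simp
  qed
  also have "\<dots> = sesq F c (mat_app F (gram M u) c)"
    unfolding sesq_def mat_app_def gram_def sum_distrib_left
    by (intro sum.cong refl) (simp only: mult_ac)
  finally show ?thesis unfolding quad_form_def by (metis Re_complex_of_real)
qed

section \<open>Cells and the lattice points in them\<close>

definition cell :: "nat \<Rightarrow> (int^'n) \<times> (int^'n) \<Rightarrow> ((real^'n) \<times> (real^'n)) set" where
  "cell L \<kappa> = side_cube (real L *\<^sub>R of_int_vec (fst \<kappa>)) (real L) \<times> side_cube (real L *\<^sub>R of_int_vec (snd \<kappa>)) (real L)"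

definition vdiv :: "nat \<Rightarrow> int^'n \<Rightarrow> int^'n" where
  "vdiv q l = (\<chi> i. l $ i div int q)"

lemma card_vdiv:
  fixes \<kappa> :: "int^'n"
  assumes q: "q > 0"
  shows "finite {l. vdiv q l = \<kappa>}" "card {l. vdiv q l = \<kappa>} = q ^ CARD('n)"
proof -
  let ?B = "\<lambda>i. {\<kappa> $ i * int q..<\<kappa> $ i * int q + int q}"
  have iff: "x div int q = k \<longleftrightarrow> x \<in> {k * int q..<k * int q + int q}" for x k
  proof
    assume "x div int q = k"
    then have "x = k * int q + x mod int q" using div_mult_mod_eq[of x "int q"] by simp
    moreover have "0 \<le> x mod int q" "x mod int q < int q" using q by simp_all
    ultimately show "x \<in> {k * int q..<k * int q + int q}" by simp
  next
    assume "x \<in> {k * int q..<k * int q + int q}"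
    then have "x = int q * k + (x - k * int q)" "0 \<le> x - k * int q" "x - k * int q < int q" by auto
    then show "x div int q = k" using int_div_pos_eq by blast
  qed
  have eq: "{l. vdiv q l = \<kappa>} = vec_lambda ` (PiE UNIV ?B)"
  proof (intro equalityI subsetI)
    fix l assume "l \<in> {l. vdiv q l = \<kappa>}"
    then have "l $ i div int q = \<kappa> $ i" for i by (auto simp: vdiv_def)
    then have "vec_nth l \<in> PiE UNIV ?B" using iff by blast
    moreover have "l = vec_lambda (vec_nth l)" by simp
    ultimately show "l \<in> vec_lambda ` (PiE UNIV ?B)" by blast
  next
    fix l :: "int^'n" assume "l \<in> vec_lambda ` (PiE UNIV ?B)"
    then obtain h where h: "l = vec_lambda h" "h \<in> PiE UNIV ?B" by blast
    then have "h i \<in> ?B i" for i by blast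
    then have "h i div int q = \<kappa> $ i" for i using iff by blast
    then show "l \<in> {l. vdiv q l = \<kappa>}" by (simp add: vdiv_def h(1))
  qed
  have inj: "inj_on vec_lambda (PiE UNIV ?B)" by (rule inj_onI) (metis vec_lambda_inverse UNIV_I)
  show "finite {l. vdiv q l = \<kappa>}" unfolding eq by (intro finite_imageI finite_PiE) auto
  show "card {l. vdiv q l = \<kappa>} = q ^ CARD('n)"
    unfolding eq card_image[OF inj] by (subst card_PiE) auto
qed

lemma vdiv_cube:
  assumes L: "L > 0" and P: "P > 0"
  shows "(1 / real P) *\<^sub>R of_int_vec l \<in> side_cube (real L *\<^sub>R of_int_vec (vdiv (L * P) l)) (real L)"
proof -
  have "real L * of_int (l $ i div int (L * P)) \<le> of_int (l $ i) / real P \<and>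
      of_int (l $ i) / real P \<le> real L * of_int (l $ i div int (L * P)) + real L" for i
  proof -
    define q where "q = int (L * P)"
    have q: "q > 0" using L P by (simp add: q_def)
    have "(l $ i div q) * q \<le> l $ i" using div_mult_mod_eq[of "l $ i" q] pos_mod_sign[OF q, of "l $ i"] by linarith
    moreover have "l $ i \<le> (l $ i div q) * q + q" using div_mult_mod_eq[of "l $ i" q] pos_mod_bound[OF q, of "l $ i"] by linarith
    ultimately have "real_of_int (l $ i div q) * q \<le> l $ i" "real_of_int (l $ i) \<le> real_of_int (l $ i div q) * q + q"
      by (metis of_int_le_iff of_int_mult, metis of_int_le_iff of_int_mult of_int_add)
    moreover have "real_of_int q = real L * real P" by (simp add: q_def)
    ultimately show ?thesis using P unfolding q_def[symmetric]
      by (simp add: pos_divide_le_eq pos_le_divide_eq algebra_simps)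
  qed
  then show ?thesis by (simp add: side_cube_def of_int_vec_def vdiv_def)
qed

text \<open>Closed cells share faces, but integer division assigns every lattice index to exactly
  one cell, so the counts per cell are exact.\<close>

definition grid_cell :: "nat \<Rightarrow> nat \<Rightarrow> nat \<Rightarrow> (int^'n) \<times> (int^'n) \<Rightarrow> (int^'n) \<times> (int^'n)" where
  "grid_cell L P p k = (vdiv (L * P) (fst k), vdiv (L * p) (snd k))"

lemma tf_grid_cell:
  assumes "L > 0" "P > 0" "p > 0"
  shows "tf_grid P p k \<in> cell L (grid_cell L P p k)"
  unfolding tf_grid_def cell_def grid_cell_def using vdiv_cube assms by auto

lemma card_grid_cell:
  fixes \<kappa> :: "(int^'n) \<times> (int^'n)"
  assumes "L > 0" "P > 0" "p > 0"
  shows "finite {k. grid_cell L P p k = \<kappa>}"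
    "card {k. grid_cell L P p k = \<kappa>} = (P * p) ^ CARD('n) * L ^ (2 * CARD('n))"
proof -
  have eq: "{k. grid_cell L P p k = \<kappa>} = {l. vdiv (L * P) l = fst \<kappa>} \<times> {l. vdiv (L * p) l = snd \<kappa>}"
    by (auto simp: grid_cell_def)
  have LP: "L * P > 0" "L * p > 0" using assms by auto
  note * = card_vdiv[OF LP(1), of "fst \<kappa>"] card_vdiv[OF LP(2), of "snd \<kappa>"]
  show "finite {k. grid_cell L P p k = \<kappa>}" unfolding eq using * by blast
  show "card {k. grid_cell L P p k = \<kappa>} = (P * p) ^ CARD('n) * L ^ (2 * CARD('n))"
    unfolding eq card_cartesian_product * mult_2 power_add power_mult_distrib by (simp only: mult_ac)
qed

text \<open>With V = L^n the tested quantity is (s2 + 1) / V times (1 + t)^3 times 1 / (t d) + 1 + 1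
  / (d V). The constants bound these factors by 1 - \<epsilon> / 2, 1 + \<epsilon> / 4 and 1 +
  \<epsilon> / 4, whose product is below 1.\<close>

lemma parameter_choice:
  fixes \<epsilon> :: real and n :: nat
  assumes \<epsilon>: "0 < \<epsilon>" "\<epsilon> < 1" and n: "n > 0"
  obtains L d s2 :: nat and t :: real where "L > 0" "d > 0" "t > 0" "s2 < d * L ^ n"
    "(1 - \<epsilon>) * real L ^ n \<le> real s2"
    "(real s2 + 1) / real (d * L ^ n) * (1 + t) * ((1 + t)\<^sup>2 * (1 / t + (real (d * L ^ n) + 1) / real L ^ n)) < 1"
proof -
  \<comment> \<open>Since t <= 1, (1 + t)^3 <= 1 + 7 t, and 7 / 28 = 1 / 4.\<close>
  define t where "t = \<epsilon> / 28"
  \<comment> \<open>Makes 1 / (t d) at most \<epsilon> / 8; the term 1 / (d V) is no larger.\<close>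
  define d where "d = nat \<lceil>8 / (t * \<epsilon>)\<rceil>"
  \<comment> \<open>Makes V at least 4 / \<epsilon>, so that rounding up \<open>s2\<close> and
    adding 1 cost at most (\<epsilon> / 2) V.\<close>
  define L where "L = nat \<lceil>4 / \<epsilon>\<rceil>"
  define V where "V = real L ^ n"
  define s2 where "s2 = nat \<lceil>(1 - \<epsilon>) * V\<rceil>"
  have t: "t > 0" "t \<le> 1" using \<epsilon> by (auto simp: t_def)
  have d: "real d \<ge> 8 / (t * \<epsilon>)" unfolding d_def by (rule real_nat_ceiling_ge)
  have "8 / (t * \<epsilon>) > 0" using t \<epsilon> by simp
  with d have d0: "real d > 0" by linarith
  have L: "real L \<ge> 4 / \<epsilon>" unfolding L_def by (rule real_nat_ceiling_ge)
  have "4 / \<epsilon> > 1" using \<epsilon> by (simp add: pos_less_divide_eq)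
  with L have L1: "real L \<ge> 1" by linarith
  have "V \<ge> real L ^ 1" unfolding V_def using L1 n by (intro power_increasing) auto
  then have V: "V \<ge> 4 / \<epsilon>" "V \<ge> 1" using L L1 by auto
  have s2: "(1 - \<epsilon>) * V \<le> real s2" unfolding s2_def by (rule real_nat_ceiling_ge)
  have "0 \<le> (1 - \<epsilon>) * V" using \<epsilon> V by simp
  then have "real s2 \<le> (1 - \<epsilon>) * V + 1" unfolding s2_def by linarith
  moreover have "2 \<le> \<epsilon> / 2 * V" using V \<epsilon> by (simp add: pos_divide_le_eq mult.commute)
  ultimately have s2': "real s2 + 1 \<le> (1 - \<epsilon> / 2) * V" by (simp add: algebra_simps)
  have dV: "real (d * L ^ n) = real d * V" by (simp add: V_def)
  have "(1 - \<epsilon> / 2) * V \<le> 1 * V" using V \<epsilon> by (intro mult_right_mono) auto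
  also have "\<dots> \<le> real d * V" using V d0 by (intro mult_right_mono) auto
  finally have "real s2 < real (d * L ^ n)" using s2' dV by linarith
  then have lt: "s2 < d * L ^ n" by linarith
  have t3: "(1 + t) ^ 3 \<le> 1 + \<epsilon> / 4"
  proof -
    have "t ^ 2 \<le> t" "t ^ 3 \<le> t" using t by (auto simp: power_le_one_iff power2_eq_square power3_eq_cube mult_le_one intro: mult_left_le order.trans)
    moreover have "(1 + t) ^ 3 = 1 + 3 * t + 3 * t ^ 2 + t ^ 3"
      by (simp add: power3_eq_cube algebra_simps power2_eq_square)
    moreover have "7 * t = \<epsilon> / 4" by (simp add: t_def)
    ultimately show ?thesis by linarith
  qed
  have X: "1 / (t * d) + 1 + 1 / (d * V) \<le> 1 + \<epsilon> / 4"
  proof -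
    have td: "8 / \<epsilon> \<le> t * d" using d t \<epsilon> by (simp add: field_simps)
    then have "1 / (t * d) \<le> \<epsilon> / 8" using \<epsilon> t d0 by (simp add: field_simps)
    moreover have "1 / (d * V) \<le> 1 / (t * d)"
      using t d0 V by (intro divide_left_mono) (auto simp: mult.commute[of t] intro!: mult_left_mono)
    ultimately show ?thesis by linarith
  qed
  have "(real s2 + 1) / real (d * L ^ n) * (1 + t) * ((1 + t)\<^sup>2 * (1 / t + (real (d * L ^ n) + 1) / real L ^ n)) =
      (real s2 + 1) / V * (1 + t) ^ 3 * (1 / (t * d) + 1 + 1 / (d * V))"
    unfolding dV V_def[symmetric] using d0 t V
    by (simp add: power3_eq_cube power2_eq_square divide_simps) (simp add: algebra_simps)
  also have "\<dots> \<le> (1 - \<epsilon> / 2) * (1 + \<epsilon> / 4) * (1 + \<epsilon> / 4)"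
    using s2' t3 X V t d0 \<epsilon> by (intro mult_mono) (auto simp: pos_divide_le_eq intro!: add_nonneg_nonneg)
  also have "\<dots> = 1 - \<epsilon> * \<epsilon> * (3 / 16 + \<epsilon> / 32)" by (simp add: algebra_simps)
  also have "\<dots> < 1" using \<epsilon> by simp
  finally have "(real s2 + 1) / real (d * L ^ n) * (1 + t) * ((1 + t)\<^sup>2 * (1 / t + (real (d * L ^ n) + 1) / real L ^ n)) < 1" .
  then show ?thesis
    using that[of L d t s2] L1 d0 t(1) lt s2 by (simp add: V_def)
qed

lemma time_freq_shift_add:
  "time_freq_shift z (\<lambda>t. f t + h t) t = time_freq_shift z f t + time_freq_shift z h t"
  by (simp add: time_freq_shift_def algebra_simps)

text \<open>The remainder \<open>h\<close> of the step approximation has only the crude bound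
  proportional to the number of points. As this number is at most N v, the error carries the same
  factor N as the main term, so closeness depending on \<open>v\<close> alone suffices and can be
  fixed before the grid.\<close>

lemma time_freq_grid_bessel:
  fixes g :: "real^'n \<Rightarrow> complex" and t v :: real and d :: nat
  assumes g: "g \<in> L2 lebesgue" and pos: "sqint lebesgue g > 0" "t > 0" "v \<ge> 0"
  obtains P p :: nat where "P > 0" "p > 0" "d < (P * p) ^ CARD('n)"
    "\<And>F c. finite F \<Longrightarrow> real (card F) \<le> real ((P * p) ^ CARD('n)) * v \<Longrightarrow>
      sqint lebesgue (\<lambda>s. \<Sum>k\<in>F. c k * time_freq_shift (tf_grid P p k) g s) \<le>
        sqint lebesgue g * real ((P * p) ^ CARD('n)) * (1 + t) * (\<Sum>k\<in>F. (cmod (c k))\<^sup>2)"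
proof -
  define \<gamma> where "\<gamma> = sqint lebesgue g"
  \<comment> \<open>As \<delta> <= 1, (1 + \<delta>)^2 <= 1 + 3 \<delta> <= 1 + t / 2, half of the
    permitted excess.\<close>
  define \<delta> where "\<delta> = min 1 (t / 6)"
  have \<delta>: "\<delta> > 0" "\<delta> \<le> 1" "6 * \<delta> \<le> t" using pos by (auto simp: \<delta>_def)
  have \<delta>2: "(1 + \<delta>) * (1 + \<delta>) \<le> 1 + t / 2"
  proof -
    have "\<delta> * \<delta> \<le> \<delta>" using \<delta> by (intro mult_left_le) auto
    then show ?thesis using \<delta>(3) by (simp add: algebra_simps)
  qed
  \<comment> \<open>\<open>W\<close> collects all factors in front of
    \<open>sqint lebesgue h\<close>; \<open>e\<close> is then chosen with W e = \<gamma> t / 2, the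
    other half of the excess.\<close>
  define W where "W = (1 + \<delta>) * (1 + 1 / \<delta>) + (1 + 1 / \<delta>) * v"
  have W: "W > 0" unfolding W_def using \<delta> pos by (intro add_pos_nonneg mult_pos_pos mult_nonneg_nonneg) (auto simp: add_pos_pos)
  define e where "e = \<gamma> * t / (2 * W)"
  have e: "e > 0" unfolding e_def \<gamma>_def using pos W by simp
  from step_approx_L2[OF g] e obtain p0 where p0: "\<And>p. p \<ge> p0 \<Longrightarrow> \<exists>C. finite {k. C k \<noteq> 0} \<and> sqint lebesgue (\<lambda>s. g s - step p C s) < e"
    unfolding step_approx_def by blast
  define p where "p = Suc p0"
  have p: "p > 0" by (simp add: p_def)
  from p0[of p] obtain C where C: "finite {k. C k \<noteq> 0}" "sqint lebesgue (\<lambda>s. g s - step p C s) < e"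
    by (auto simp: p_def)
  define R where "R = (\<Sum>k | C k \<noteq> 0. \<Sum>i\<in>UNIV. \<bar>k $ i\<bar>) + 1"
  have R: "- R \<le> k $ i \<and> k $ i < R" if "C k \<noteq> 0" for k i
  proof -
    have "\<bar>k $ i\<bar> \<le> (\<Sum>i\<in>UNIV. \<bar>k $ i\<bar>)" by (rule member_le_sum) auto
    also have "\<dots> \<le> (\<Sum>k | C k \<noteq> 0. \<Sum>i\<in>UNIV. \<bar>k $ i\<bar>)"
      using C(1) that by (intro member_le_sum[where f = "\<lambda>k. \<Sum>i\<in>UNIV. \<bar>k $ i\<bar>"] sum_nonneg) auto
    finally show ?thesis by (simp add: R_def abs_le_iff)
  qed
  \<comment> \<open>Large enough for the support of the step function to fit into a cube of side
    \<open>P\<close>, and for (P p)^n to exceed \<open>d\<close>.\<close>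
  define P where "P = nat (2 * R) + d + 1"
  have P: "P > 0" by (simp add: P_def)
  have PR: "2 * real_of_int R \<le> real P * real p"
  proof -
    have "2 * R \<le> int P" by (simp add: P_def)
    also have "\<dots> \<le> int P * int p" using p mult_left_mono[of 1 "int p" "int P"] by simp
    finally have "real_of_int (2 * R) \<le> real_of_int (int P * int p)" by (simp only: of_int_le_iff)
    then show ?thesis by simp
  qed
  have dP: "d < (P * p) ^ CARD('n)"
  proof -
    have "d < P" by (simp add: P_def)
    also have "P \<le> (P * p) ^ 1" using p by simp
    also have "\<dots> \<le> (P * p) ^ CARD('n)" using P p by (intro power_increasing) (auto simp: Suc_leI)
    finally show ?thesis .
  qed
  define \<phi> where "\<phi> = step p C"
  define h where "h = (\<lambda>s. g s - \<phi> s)"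
  have \<phi>: "\<phi> \<in> L2 lebesgue" unfolding \<phi>_def by (rule step_L2[OF p C(1)])
  have h: "h \<in> L2 lebesgue" unfolding h_def by (intro L2_diff g \<phi>)
  have he: "sqint lebesgue h < e" using C(2) by (simp add: h_def \<phi>_def)
  have \<phi>g: "sqint lebesgue \<phi> \<le> (1 + \<delta>) * \<gamma> + (1 + 1 / \<delta>) * sqint lebesgue h"
  proof -
    have "sqint lebesgue (\<lambda>s. g s + (-1) * h s) \<le> (1 + \<delta>) * sqint lebesgue g + (1 + 1 / \<delta>) * sqint lebesgue (\<lambda>s. (-1) * h s)"
      by (intro sqint_add_le g L2_scale h \<delta>)
    moreover have "(\<lambda>s. g s + (-1) * h s) = \<phi>" by (simp add: h_def)
    ultimately show ?thesis unfolding sqint_scale by (simp add: \<gamma>_def)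
  qed
  define N where "N = real ((P * p) ^ CARD('n))"
  have N0: "N \<ge> 0" by (simp add: N_def)
  show thesis
  proof (rule that[OF P p dP])
    fix F :: "((int^'n) \<times> (int^'n)) set" and c
    assume F: "finite F" and cF: "real (card F) \<le> real ((P * p) ^ CARD('n)) * v"
    define Q where "Q = (\<Sum>k\<in>F. (cmod (c k))\<^sup>2)"
    have Q0: "Q \<ge> 0" by (simp add: Q_def sum_nonneg)
    let ?S = "\<lambda>f s. \<Sum>k\<in>F. c k * time_freq_shift (tf_grid P p k) f s"
    have "time_freq_shift z g s = time_freq_shift z \<phi> s + time_freq_shift z h s" for z s
      unfolding time_freq_shift_add[symmetric] by (simp add: h_def)
    then have split: "?S g = (\<lambda>s. ?S \<phi> s + ?S h s)"
      by (simp only: distrib_left sum.distrib)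
    have b1: "sqint lebesgue (?S \<phi>) \<le> N * sqint lebesgue \<phi> * Q"
      unfolding \<phi>_def Q_def using step_grid_bessel[OF p P C(1) R PR F, of c] by (simp add: N_def)
    have b2: "sqint lebesgue (?S h) \<le> N * v * sqint lebesgue h * Q"
    proof -
      have "sqint lebesgue (?S h) \<le> Q * (\<Sum>k\<in>F. sqint lebesgue (time_freq_shift (tf_grid P p k) h))"
        unfolding Q_def by (intro sqint_sum_le time_freq_shift_L2 h)
      also have "\<dots> = Q * (real (card F) * sqint lebesgue h)" by (simp add: time_freq_shift_L2(2)[OF h])
      also have "\<dots> \<le> Q * (N * v * sqint lebesgue h)"
        using cF unfolding N_def by (intro mult_left_mono mult_right_mono Q0 sqint_nonneg) auto
      finally show ?thesis by (simp only: mult_ac)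
    qed
    have "sqint lebesgue (?S g) \<le> (1 + \<delta>) * sqint lebesgue (?S \<phi>) + (1 + 1 / \<delta>) * sqint lebesgue (?S h)"
      unfolding split by (intro sqint_add_le L2_sum L2_scale time_freq_shift_L2 \<phi> h \<delta>)
    also have "\<dots> \<le> (1 + \<delta>) * (N * sqint lebesgue \<phi> * Q) + (1 + 1 / \<delta>) * (N * v * sqint lebesgue h * Q)"
      using b1 b2 \<delta> by (intro add_mono mult_left_mono) auto
    also have "\<dots> = N * Q * ((1 + \<delta>) * sqint lebesgue \<phi> + (1 + 1 / \<delta>) * v * sqint lebesgue h)"
      by (simp only: distrib_left mult_ac)
    also have "\<dots> \<le> N * Q * (\<gamma> * (1 + t))"
    proof (intro mult_left_mono)
      have "(1 + \<delta>) * sqint lebesgue \<phi> \<le> (1 + \<delta>) * ((1 + \<delta>) * \<gamma> + (1 + 1 / \<delta>) * sqint lebesgue h)"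
        using \<phi>g \<delta> by (intro mult_left_mono) auto
      then have "(1 + \<delta>) * sqint lebesgue \<phi> + (1 + 1 / \<delta>) * v * sqint lebesgue h \<le>
          ((1 + \<delta>) * (1 + \<delta>)) * \<gamma> + W * sqint lebesgue h"
        by (simp add: W_def algebra_simps)
      also have "\<dots> \<le> (1 + t / 2) * \<gamma> + W * e"
        using \<delta>2 he W pos by (intro add_mono mult_right_mono mult_left_mono) (auto simp: \<gamma>_def)
      also have "W * e = \<gamma> * t / 2" using W by (simp add: e_def)
      finally show "(1 + \<delta>) * sqint lebesgue \<phi> + (1 + 1 / \<delta>) * v * sqint lebesgue h \<le> \<gamma> * (1 + t)"
        by (simp add: algebra_simps)
    qed (use N0 Q0 in simp)
    finally show "sqint lebesgue (?S g) \<le> sqint lebesgue g * real ((P * p) ^ CARD('n)) * (1 + t) * (\<Sum>k\<in>F. (cmod (c k))\<^sup>2)"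
      unfolding N_def[symmetric] Q_def[symmetric] \<gamma>_def by (simp only: mult_ac)
  qed
qed

text \<open>Points are labelled by a cell and a number below \<open>s2\<close>, so that
  configurations for different \<open>K\<close> can be compared label by label in the limit. The
  lattice depends on \<open>K\<close>, the constants do not.\<close>

lemma finite_stage:
  fixes g :: "real^'n \<Rightarrow> complex" and K :: "((int^'n) \<times> (int^'n)) set"
  assumes g: "g \<in> L2 lebesgue" and \<gamma>: "sqint lebesgue g = \<gamma>" "\<gamma> > 0"
    and LD: "L > 0" "d > 0" "t > 0" and s1: "s1 = d * L ^ (2 * CARD('n))" and s2: "s2 < s1"
    and D: "D = (1 + t)\<^sup>2 * (1 / t + (real s1 + 1) / real L ^ (2 * CARD('n)))"
    and cond: "(real s2 + 1) / real s1 * (1 + t) * D < 1"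
    and A: "A = \<gamma> * D * (1 - (1 + t) * ((1 - 1 / D) + (real s2 + 1) / real s1 * t) / (t + (1 - 1 / D)))"
    and K: "finite K"
  shows "\<exists>x. (\<forall>\<kappa>\<in>K. \<forall>j<s2. x (\<kappa>, j) \<in> cell L \<kappa>) \<and>
    (\<forall>c. A * (\<Sum>i\<in>K \<times> {..<s2}. (cmod (c i))\<^sup>2) \<le> sqint lebesgue (\<lambda>s. \<Sum>i\<in>K \<times> {..<s2}. c i * time_freq_shift (x i) g s) \<and>
      sqint lebesgue (\<lambda>s. \<Sum>i\<in>K \<times> {..<s2}. c i * time_freq_shift (x i) g s) \<le> \<gamma> * D * (\<Sum>i\<in>K \<times> {..<s2}. (cmod (c i))\<^sup>2))"
proof -
  define V where "V = L ^ (2 * CARD('n))"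
  have V: "V > 0" using LD by (simp add: V_def)
  obtain P p :: nat where Pp: "P > 0" "p > 0" "d < (P * p) ^ CARD('n)" and
    bessel: "\<And>F c. finite F \<Longrightarrow> real (card F) \<le> real ((P * p) ^ CARD('n)) * (real V * real (card K)) \<Longrightarrow>
      sqint lebesgue (\<lambda>s. \<Sum>k\<in>F. c k * time_freq_shift (tf_grid P p k) g s) \<le>
        sqint lebesgue g * real ((P * p) ^ CARD('n)) * (1 + t) * (\<Sum>k\<in>F. (cmod (c k))\<^sup>2)"
    using time_freq_grid_bessel[OF g _ LD(3), of "real V * real (card K)" d] \<gamma> by auto
  define N where "N = (P * p) ^ CARD('n)"
  define I where "I = {k. grid_cell L P p k \<in> K}"
  have IU: "I = (\<Union>\<kappa>\<in>K. {k. grid_cell L P p k = \<kappa>})" by (auto simp: I_def)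
  note cgc = card_grid_cell[OF LD(1) Pp(1,2)]
  have finI: "finite I" unfolding IU using K cgc(1) by blast
  have "card I = (\<Sum>\<kappa>\<in>K. card {k. grid_cell L P p k = \<kappa>})"
    unfolding IU using K cgc(1) by (intro card_UN_disjoint) auto
  then have cardI: "card I = card K * (N * V)" by (simp add: cgc(2) N_def V_def)
  define u where "u = (\<lambda>k. time_freq_shift (tf_grid P p k) g)"
  have u: "u k \<in> L2 lebesgue" "sqint lebesgue (u k) = \<gamma>" for k
    unfolding u_def using time_freq_shift_L2[OF g] \<gamma> by auto
  note qf = quad_form_gram[of _ u lebesgue, OF u(1)]
  have psd: "0 \<le> quad_form I (gram lebesgue u) c" for c unfolding qf by (rule sqint_nonneg)
  have bound: "quad_form I (gram lebesgue u) c \<le> \<gamma> * real N * (1 + t) * sq_norm I c" for c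
    unfolding qf unfolding u_def sq_norm_def \<gamma>(1)[symmetric] N_def
    by (rule bessel[OF finI]) (simp add: cardI N_def)
  have diag: "Re (gram lebesgue u i i) = \<gamma>" for i by (simp add: gram_diag u(2))
  have grp: "grid_cell L P p ` I \<subseteq> K" by (auto simp: I_def)
  have r: "card {k \<in> I. grid_cell L P p k = \<kappa>} = N * V" if "\<kappa> \<in> K" for \<kappa>
  proof -
    have "{k \<in> I. grid_cell L P p k = \<kappa>} = {k. grid_cell L P p k = \<kappa>}" using that by (auto simp: I_def)
    then show ?thesis by (simp add: cgc(2) N_def V_def)
  qed
  have N: "N > 0" using Pp by (simp add: N_def)
  \<comment> \<open>Here d < N enters: s1 = d V is below the number N V of lattice points per
    cell.\<close>
  have s1r: "s1 < N * V" unfolding s1 V_def[symmetric] using Pp(3) V by (simp add: N_def)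
  have D': "D = (1 + t)\<^sup>2 * (1 / t + (real s1 + 1) / real V)" by (simp add: D V_def)
  have NV: "real (N * V) = real N * real V" by simp
  obtain S where S: "S \<subseteq> I" "\<And>\<kappa>. \<kappa> \<in> K \<Longrightarrow> card {k \<in> S. grid_cell L P p k = \<kappa>} = s2"
    "\<And>c. A * sq_norm S c \<le> quad_form S (gram lebesgue u) c" "\<And>c. quad_form S (gram lebesgue u) c \<le> \<gamma> * D * sq_norm S c"
    using two_sided_selector[OF finI gram_herm psd bound diag K grp r NV s1r s2 \<gamma>(2) _ _ LD(3) D' cond A] N V
    by auto
  have finS: "finite S" using S(1) finI by (rule finite_subset)
  have "\<exists>e. bij_betw e {..<s2} {k \<in> S. grid_cell L P p k = \<kappa>}" if "\<kappa> \<in> K" for \<kappa>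
    using ex_bij_betw_nat_finite[of "{k \<in> S. grid_cell L P p k = \<kappa>}"] finS S(2)[OF that]
    by (auto simp: atLeast0LessThan)
  then have "\<exists>e. \<forall>\<kappa>\<in>K. bij_betw (e \<kappa>) {..<s2} {k \<in> S. grid_cell L P p k = \<kappa>}" by (intro bchoice ballI)
  then obtain e where e: "\<And>\<kappa>. \<kappa> \<in> K \<Longrightarrow> bij_betw (e \<kappa>) {..<s2} {k \<in> S. grid_cell L P p k = \<kappa>}" by blast
  define q where "q = (\<lambda>i. e (fst i) (snd i))"
  have qin: "q i \<in> S \<and> grid_cell L P p (q i) = fst i" if "i \<in> K \<times> {..<s2}" for i
    using bij_betwE[OF e[of "fst i"]] that by (auto simp: q_def)
  have bij: "bij_betw q (K \<times> {..<s2}) S"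
  proof (rule bij_betw_imageI)
    show "inj_on q (K \<times> {..<s2})"
    proof (rule inj_onI)
      fix i j assume ij: "i \<in> K \<times> {..<s2}" "j \<in> K \<times> {..<s2}" "q i = q j"
      then have fst: "fst i = fst j" using qin by metis
      moreover have "snd i = snd j"
        using ij fst bij_betw_imp_inj_on[OF e[of "fst i"]] by (auto simp: q_def dest: inj_onD)
      ultimately show "i = j" by (rule prod_eqI)
    qed
    show "q ` (K \<times> {..<s2}) = S"
    proof (intro equalityI subsetI)
      fix k assume k: "k \<in> S"
      define \<kappa> where "\<kappa> = grid_cell L P p k"
      have \<kappa>: "\<kappa> \<in> K" using k S(1) by (auto simp: \<kappa>_def I_def)
      have "k \<in> e \<kappa> ` {..<s2}" using bij_betw_imp_surj_on[OF e[OF \<kappa>]] k by (auto simp: \<kappa>_def)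
      then obtain j where "j < s2" "k = q (\<kappa>, j)" by (auto simp: q_def)
      then show "k \<in> q ` (K \<times> {..<s2})" using \<kappa> by auto
    qed (use qin in auto)
  qed
  define x where "x = (\<lambda>i. tf_grid P p (q i))"
  show ?thesis
  proof (intro exI[of _ x] conjI ballI allI impI)
    fix \<kappa> j assume "\<kappa> \<in> K" "j < s2"
    then have "grid_cell L P p (q (\<kappa>, j)) = \<kappa>" using qin[of "(\<kappa>, j)"] by simp
    then show "x (\<kappa>, j) \<in> cell L \<kappa>"
      using tf_grid_cell[OF LD(1) Pp(1,2), of "q (\<kappa>, j)"] by (simp add: x_def)
  next
    fix c :: "((int^'n) \<times> (int^'n)) \<times> nat \<Rightarrow> complex"
    define c' where "c' = c \<circ> the_inv_into (K \<times> {..<s2}) q"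
    have c': "c' (q i) = c i" if "i \<in> K \<times> {..<s2}" for i
      unfolding c'_def using the_inv_into_f_f[OF bij_betw_imp_inj_on[OF bij] that] by simp
    have re: "(\<Sum>k\<in>S. f k) = (\<Sum>i\<in>K \<times> {..<s2}. f (q i))" for f :: "_ \<Rightarrow> 'b::comm_monoid_add"
      by (rule sum.reindex_bij_betw[OF bij, symmetric])
    have 1: "sq_norm S c' = (\<Sum>i\<in>K \<times> {..<s2}. (cmod (c i))\<^sup>2)"
      unfolding sq_norm_def re by (intro sum.cong refl) (simp only: c')
    have 2: "quad_form S (gram lebesgue u) c' = sqint lebesgue (\<lambda>s. \<Sum>i\<in>K \<times> {..<s2}. c i * time_freq_shift (x i) g s)"
    proof -
      have "(\<Sum>i\<in>K \<times> {..<s2}. c' (q i) * u (q i) s) = (\<Sum>i\<in>K \<times> {..<s2}. c i * time_freq_shift (x i) g s)" for s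
        by (intro sum.cong refl) (simp only: c' u_def x_def)
      then show ?thesis unfolding qf re by (simp only:)
    qed
    show "A * (\<Sum>i\<in>K \<times> {..<s2}. (cmod (c i))\<^sup>2) \<le> sqint lebesgue (\<lambda>s. \<Sum>i\<in>K \<times> {..<s2}. c i * time_freq_shift (x i) g s)"
      "sqint lebesgue (\<lambda>s. \<Sum>i\<in>K \<times> {..<s2}. c i * time_freq_shift (x i) g s) \<le> \<gamma> * D * (\<Sum>i\<in>K \<times> {..<s2}. (cmod (c i))\<^sup>2)"
      using S(3,4)[of c'] unfolding 1 2 by auto
  qed
qed

section \<open>Limit configuration and density\<close>

lemma side_cube_eq_cbox: "side_cube x P = cbox x (\<chi> i. x $ i + P)"
  by (auto simp: side_cube_def mem_box_cart)

lemma side_cube_dist: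
  fixes x :: "real^'n" and P :: real
  assumes "a \<in> side_cube x P" "b \<in> side_cube x P"
  shows "dist a b \<le> CARD('n) * P"
proof -
  have "\<bar>(a - b) $ i\<bar> \<le> P" for i
    using assms unfolding side_cube_def by (simp add: abs_le_iff) (smt (verit))
  then have "norm (a - b) \<le> (\<Sum>i\<in>(UNIV :: 'n set). P)"
    by (intro order.trans[OF norm_le_l1_cart] sum_mono)
  then show ?thesis by (simp add: dist_norm)
qed

definition corner :: "nat \<Rightarrow> (int^'n) \<times> (int^'n) \<Rightarrow> (real^'n) \<times> (real^'n)" where
  "corner L \<kappa> = (real L *\<^sub>R of_int_vec (fst \<kappa>), real L *\<^sub>R of_int_vec (snd \<kappa>))"

lemma corner_in_cell: "corner L \<kappa> \<in> cell L \<kappa>"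
  by (simp add: corner_def cell_def side_cube_def)

lemma closed_cell: "closed (cell L \<kappa>)"
  unfolding cell_def side_cube_eq_cbox by (intro closed_Times closed_cbox)

lemma cell_dist:
  fixes \<kappa> :: "(int^'n) \<times> (int^'n)"
  assumes "a \<in> cell L \<kappa>" "b \<in> cell L \<kappa>"
  shows "dist a b \<le> 2 * CARD('n) * L"
proof -
  have "dist a b \<le> dist (fst a) (fst b) + dist (snd a) (snd b)"
    unfolding dist_norm by (metis norm_Pair_le fst_diff snd_diff prod.collapse)
  moreover have "dist (fst a) (fst b) \<le> CARD('n) * real L" "dist (snd a) (snd b) \<le> CARD('n) * real L"
    using assms by (auto simp: cell_def intro!: side_cube_dist)
  ultimately show ?thesis by simp
qed

lemma cells_cover:
  fixes w :: "(real^'n) \<times> (real^'n)"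
  assumes L: "L > 0" shows "\<exists>\<kappa>. w \<in> cell L \<kappa>"
proof -
  have "x \<in> side_cube (real L *\<^sub>R of_int_vec (\<chi> i. \<lfloor>x $ i / L\<rfloor>)) (real L)" for x :: "real^'n"
  proof -
    have "real L * of_int \<lfloor>x $ i / L\<rfloor> \<le> x $ i \<and> x $ i \<le> real L * of_int \<lfloor>x $ i / L\<rfloor> + real L" for i
    proof -
      have "real L * real_of_int \<lfloor>x $ i / L\<rfloor> \<le> real L * (x $ i / L)" "real L * (x $ i / L) \<le> real L * (real_of_int \<lfloor>x $ i / L\<rfloor> + 1)"
        by (intro mult_left_mono; linarith)+
      then show ?thesis using L by (simp add: distrib_left)
    qed
    then show ?thesis by (simp add: side_cube_def of_int_vec_def)
  qed
  then have "w \<in> cell L (\<chi> i. \<lfloor>fst w $ i / L\<rfloor>, \<chi> i. \<lfloor>snd w $ i / L\<rfloor>)"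
    by (cases w) (simp add: cell_def)
  then show ?thesis by blast
qed

lemma emeasure_cell:
  fixes \<kappa> :: "(int^'n) \<times> (int^'n)"
  shows "emeasure lborel (cell L \<kappa>) = ennreal (real L ^ (2 * CARD('n)))"
proof -
  have cube: "emeasure lborel (side_cube x (real L)) = ennreal (real L ^ CARD('n))" for x :: "real^'n"
  proof -
    have "emeasure lborel (side_cube x (real L)) = ennreal (\<Prod>b\<in>Basis. ((\<chi> i. x $ i + real L) - x) \<bullet> b)"
      unfolding side_cube_eq_cbox
      by (rule emeasure_lborel_cbox) (auto simp: Basis_vec_def inner_axis)
    also have "(\<Prod>b\<in>Basis. ((\<chi> i. x $ i + real L) - x) \<bullet> b) = (\<Prod>b\<in>(Basis::(real^'n) set). real L)"
      by (rule prod.cong) (auto simp: Basis_vec_def inner_axis)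
    finally show ?thesis by simp
  qed
  have "emeasure lborel (cell L \<kappa>) =
      emeasure (lborel \<Otimes>\<^sub>M lborel) (side_cube (real L *\<^sub>R of_int_vec (fst \<kappa>)) (real L) \<times> side_cube (real L *\<^sub>R of_int_vec (snd \<kappa>)) (real L))"
    unfolding cell_def lborel_prod ..
  also have "\<dots> = ennreal (real L ^ CARD('n)) * ennreal (real L ^ CARD('n))"
    by (subst lborel.emeasure_pair_measure_Times) (auto simp: cube)
  also have "\<dots> = ennreal (real L ^ (2 * CARD('n)))"
    by (simp add: ennreal_mult[symmetric] mult_2 power_add)
  finally show ?thesis .
qed

text \<open>The positions of each label lie in one compact cell, so a diagonal subsequence converges
  at all labels. Finite inequalities survive by continuity of the shifts; the factors 2 come from
  the triangle inequality with weight 1 and do no harm to a Riesz sequence.\<close>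

lemma limit_configuration:
  fixes g :: "real^'n \<Rightarrow> complex"
  assumes g: "g \<in> L2 lebesgue"
    and stage: "\<And>K :: ((int^'n) \<times> (int^'n)) set. finite K \<Longrightarrow> \<exists>x. (\<forall>\<kappa>\<in>K. \<forall>j<s. x (\<kappa>, j) \<in> cell L \<kappa>) \<and>
      (\<forall>c. A * (\<Sum>i\<in>K \<times> {..<s}. (cmod (c i))\<^sup>2) \<le> sqint lebesgue (\<lambda>t. \<Sum>i\<in>K \<times> {..<s}. c i * time_freq_shift (x i) g t) \<and>
        sqint lebesgue (\<lambda>t. \<Sum>i\<in>K \<times> {..<s}. c i * time_freq_shift (x i) g t) \<le> B * (\<Sum>i\<in>K \<times> {..<s}. (cmod (c i))\<^sup>2))"
  obtains y :: "((int^'n) \<times> (int^'n)) \<times> nat \<Rightarrow> (real^'n) \<times> (real^'n)" where "\<And>i. y i \<in> cell L (fst i)"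
    "\<And>F c. finite F \<Longrightarrow> F \<subseteq> UNIV \<times> {..<s} \<Longrightarrow>
      A * (\<Sum>i\<in>F. (cmod (c i))\<^sup>2) \<le> 2 * sqint lebesgue (\<lambda>t. \<Sum>i\<in>F. c i * time_freq_shift (y i) g t)"
    "\<And>F c. finite F \<Longrightarrow> F \<subseteq> UNIV \<times> {..<s} \<Longrightarrow>
      sqint lebesgue (\<lambda>t. \<Sum>i\<in>F. c i * time_freq_shift (y i) g t) \<le> 2 * B * (\<Sum>i\<in>F. (cmod (c i))\<^sup>2)"
proof -
  define K where "K = (\<lambda>n. {\<kappa> :: (int^'n) \<times> (int^'n). to_nat \<kappa> < n})"
  have finK: "finite (K n)" for n
    unfolding K_def by (rule finite_subset[of _ "from_nat ` {..<n}"]) (auto intro: image_eqI[where f = from_nat, OF from_nat_to_nat[symmetric]])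
  define stg where "stg = (\<lambda>n x. (\<forall>\<kappa>\<in>K n. \<forall>j<s. x (\<kappa>, j) \<in> cell L \<kappa>) \<and>
      (\<forall>c. A * (\<Sum>i\<in>K n \<times> {..<s}. (cmod (c i))\<^sup>2) \<le> sqint lebesgue (\<lambda>t. \<Sum>i\<in>K n \<times> {..<s}. c i * time_freq_shift (x i) g t) \<and>
        sqint lebesgue (\<lambda>t. \<Sum>i\<in>K n \<times> {..<s}. c i * time_freq_shift (x i) g t) \<le> B * (\<Sum>i\<in>K n \<times> {..<s}. (cmod (c i))\<^sup>2)))"
  have "\<forall>n. \<exists>x. stg n x" unfolding stg_def using stage[OF finK] by blast
  then obtain x where x: "\<And>n. stg n (x n)" by metis
  \<comment> \<open>Labels outside the stage get the corner of their cell, which keeps every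
    sequence in its cell.\<close>
  define z where "z = (\<lambda>n i. if i \<in> K n \<times> {..<s} then x n i else corner L (fst i))"
  have zc: "z n i \<in> cell L (fst i)" for n i
    using x[of n] corner_in_cell[of L "fst i"] unfolding stg_def z_def by (cases i) auto
  have zb: "norm (z n i - corner L (fst i)) \<le> 2 * CARD('n) * L" for n i
    using cell_dist[OF zc[of n i] corner_in_cell] by (simp add: dist_norm)
  \<comment> \<open>Subtracting the corners gives one bound valid for all labels, as the diagonal
    argument requires.\<close>
  obtain k where k: "strict_mono (k :: nat \<Rightarrow> nat)" "\<And>i. \<exists>l. (\<lambda>n. z (k n) i - corner L (fst i)) \<longlonglongrightarrow> l"
    using function_convergent_subsequence[of UNIV "\<lambda>n i. z n i - corner L (fst i)" "2 * CARD('n) * L"] zb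
    by (auto simp: countableI_type)
  from k(2) obtain l where l: "\<And>i. (\<lambda>n. z (k n) i - corner L (fst i)) \<longlonglongrightarrow> l i" by metis
  define y where "y = (\<lambda>i. l i + corner L (fst i))"
  have lim: "(\<lambda>n. z (k n) i) \<longlonglongrightarrow> y i" for i
    using tendsto_add[OF l[of i] tendsto_const[of "corner L (fst i)"]] by (simp add: y_def)
  have yc: "y i \<in> cell L (fst i)" for i
    by (rule closed_sequentially[OF closed_cell _ lim]) (rule zc)
  have bounds: "A * (\<Sum>i\<in>F. (cmod (c i))\<^sup>2) \<le> 2 * sqint lebesgue (\<lambda>t. \<Sum>i\<in>F. c i * time_freq_shift (y i) g t) \<and>
      sqint lebesgue (\<lambda>t. \<Sum>i\<in>F. c i * time_freq_shift (y i) g t) \<le> 2 * B * (\<Sum>i\<in>F. (cmod (c i))\<^sup>2)"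
    if F: "finite F" "F \<subseteq> UNIV \<times> {..<s}" for F c
  proof -
    define Q where "Q = (\<Sum>i\<in>F. (cmod (c i))\<^sup>2)"
    define S where "S = (\<lambda>t. \<Sum>i\<in>F. c i * time_freq_shift (y i) g t)"
    define T where "T = (\<lambda>n t. \<Sum>i\<in>F. c i * time_freq_shift (z (k n) i) g t)"
    define E where "E = (\<lambda>n. Q * (\<Sum>i\<in>F. sqint lebesgue (\<lambda>t. time_freq_shift (y i) g t - time_freq_shift (z (k n) i) g t)))"
    have E0: "E \<longlonglongrightarrow> 0"
    proof -
      have "E \<longlonglongrightarrow> Q * (\<Sum>i\<in>F. 0)"
        unfolding E_def by (intro tendsto_intros time_freq_shift_continuous g lim)
      then show ?thesis by simp
    qed
    have S: "S \<in> L2 lebesgue" and T: "T n \<in> L2 lebesgue" for n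
      unfolding S_def T_def by (intro L2_sum L2_scale time_freq_shift_L2 g)+
    have diff: "sqint lebesgue (\<lambda>t. S t - T n t) \<le> E n" for n
    proof -
      have "(\<lambda>t. S t - T n t) = (\<lambda>t. \<Sum>i\<in>F. c i * (time_freq_shift (y i) g t - time_freq_shift (z (k n) i) g t))"
        by (simp add: S_def T_def sum_subtractf right_diff_distrib)
      then show ?thesis
        unfolding E_def Q_def by (simp only:) (intro sqint_sum_le L2_diff time_freq_shift_L2 g)
    qed
    have diffL2: "(\<lambda>t. S t - T n t) \<in> L2 lebesgue" for n by (intro L2_diff S T)
    have ST: "sqint lebesgue S \<le> 2 * sqint lebesgue (T n) + 2 * E n" for n
      using sqint_add_le[OF T[of n] diffL2[of n], of 1] diff[of n] by simp
    have TS: "sqint lebesgue (T n) \<le> 2 * sqint lebesgue S + 2 * E n" for n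
    proof -
      have "sqint lebesgue (\<lambda>t. (-1) * (S t - T n t)) = sqint lebesgue (\<lambda>t. S t - T n t)"
        unfolding sqint_scale by simp
      then show ?thesis
        using sqint_add_le[OF S L2_scale[OF diffL2[of n], of "-1"], of 1] diff[of n] by simp
    qed
    have ev: "eventually (\<lambda>n. A * Q \<le> sqint lebesgue (T n) \<and> sqint lebesgue (T n) \<le> B * Q) sequentially"
    proof -
      \<comment> \<open>From index \<open>m\<close> on, the stages contain every cell occurring in
        \<open>F\<close>.\<close>
      define m where "m = Suc (\<Sum>i\<in>F. to_nat (fst i))"
      have "eventually (\<lambda>n. n \<ge> m) sequentially" by (rule eventually_ge_at_top)
      then show ?thesis
      proof eventually_elim
        case (elim n)
        let ?I = "K (k n) \<times> {..<s}"
        have FI: "F \<subseteq> ?I"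
        proof
          fix i assume i: "i \<in> F"
          have "to_nat (fst i) \<le> (\<Sum>i\<in>F. to_nat (fst i))" using F(1) i by (intro member_le_sum) auto
          also have "\<dots> < n" using elim by (simp add: m_def)
          also have "n \<le> k n" by (rule seq_suble[OF k(1)])
          finally show "i \<in> ?I" using i F(2) by (cases i) (auto simp: K_def)
        qed
        have finI: "finite ?I" using finK by simp
        define c0 where "c0 = (\<lambda>i. if i \<in> F then c i else 0)"
        have 1: "(\<Sum>i\<in>?I. (cmod (c0 i))\<^sup>2) = Q"
          unfolding Q_def c0_def using FI finI by (intro sum.mono_neutral_cong_right) auto
        have 2: "(\<Sum>i\<in>?I. c0 i * time_freq_shift (x (k n) i) g t) = T n t" for t
          unfolding T_def c0_def using FI finI by (intro sum.mono_neutral_cong_right) (auto simp: z_def)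
        show ?case using x[of "k n"] unfolding stg_def by (metis (no_types, lifting) 1 2 sum.cong ext)
      qed
    qed
    have "A * Q \<le> 2 * sqint lebesgue S"
    proof (rule tendsto_lowerbound)
      show "(\<lambda>n. 2 * sqint lebesgue S + 2 * E n) \<longlonglongrightarrow> 2 * sqint lebesgue S"
        using tendsto_add[OF tendsto_const tendsto_mult[OF tendsto_const E0], of "2 * sqint lebesgue S" 2] by simp
      show "eventually (\<lambda>n. A * Q \<le> 2 * sqint lebesgue S + 2 * E n) sequentially"
        using ev by eventually_elim (use TS in \<open>blast intro: order.trans\<close>)
    qed simp
    moreover have "sqint lebesgue S \<le> 2 * B * Q"
    proof (rule tendsto_lowerbound)
      show "(\<lambda>n. 2 * B * Q + 2 * E n) \<longlonglongrightarrow> 2 * B * Q"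
        using tendsto_add[OF tendsto_const tendsto_mult[OF tendsto_const E0], of "2 * B * Q" 2] by simp
      show "eventually (\<lambda>n. sqint lebesgue S \<le> 2 * B * Q + 2 * E n) sequentially"
        using ev
      proof eventually_elim
        case (elim n)
        then show ?case using ST[of n] by simp
      qed
    qed simp
    ultimately show ?thesis by (simp add: S_def Q_def)
  qed
  show thesis
  proof (rule that[of y])
    show "y i \<in> cell L (fst i)" for i by (rule yc)
  qed (use bounds in blast)+
qed

text \<open>Cells meeting the ball of radius r - d lie in the ball of radius r and cover the smaller
  ball. Each holds s points, which are distinct by injectivity even on shared faces, and the volume
  ratio ((r - d) / r)^m tends to 1.\<close>

lemma lower_density_of_cells:
  fixes y :: "((int^'n) \<times> (int^'n)) \<times> nat \<Rightarrow> (real^'n) \<times> (real^'n)"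
  assumes L: "L > 0" and y: "\<And>i. y i \<in> cell L (fst i)" and inj: "inj_on y (UNIV \<times> {..<s})"
  shows "lower_beurling_density (y ` (UNIV \<times> {..<s})) \<ge> ennreal (real s / real L ^ (2 * CARD('n)))"
proof -
  define \<Lambda> where "\<Lambda> = y ` (UNIV \<times> {..<s})"
  define d where "d = 2 * CARD('n) * real L + 1"
  define V where "V = real L ^ (2 * CARD('n))"
  define m where "m = DIM((real^'n) \<times> (real^'n))"
  define v where "v = unit_ball_vol (real m)"
  have V: "V > 0" using L by (simp add: V_def)
  have v: "v > 0" unfolding v_def by simp
  have vol: "emeasure lebesgue (ball (z :: (real^'n) \<times> (real^'n)) r) = ennreal (v * r ^ m)" if "r \<ge> 0" for z r
    using emeasure_ball[OF that, of z] by (simp add: v_def m_def)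
  have count: "ennreal (s / V) * emeasure lebesgue (ball z (r - d)) \<le> emeasure (count_space UNIV) (\<Lambda> \<inter> ball z r)"
    for z r
  proof (cases "s = 0")
    case True
    then show ?thesis by simp
  next
    case s: False
    define \<K> where "\<K> = {\<kappa>. cell L \<kappa> \<subseteq> ball z r}"
    have sub: "y ` (\<K> \<times> {..<s}) \<subseteq> \<Lambda> \<inter> ball z r"
      using y unfolding \<Lambda>_def \<K>_def by fastforce
    have injK: "inj_on y (\<K> \<times> {..<s})" by (rule inj_on_subset[OF inj]) auto
    have le: "emeasure (count_space UNIV) (y ` (\<K> \<times> {..<s})) \<le> emeasure (count_space UNIV) (\<Lambda> \<inter> ball z r)"
      using sub by (intro emeasure_mono) auto
    show ?thesis
    \<comment> \<open>Infinitely many cells would make the count infinite and the inequality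
      trivial.\<close>
    proof (cases "finite \<K>")
      case False
      have "infinite (y ` (\<K> \<times> {..<s}))"
        using False s infinite_imp_nonempty[OF False] by (simp add: finite_image_iff[OF injK] finite_cartesian_product_iff lessThan_empty_iff)
      then have "emeasure (count_space UNIV) (y ` (\<K> \<times> {..<s})) = \<infinity>" by simp
      with le show ?thesis by (simp add: top_unique)
    next
      case True
      have "ball z (r - d) \<subseteq> (\<Union>\<kappa>\<in>\<K>. cell L \<kappa>)"
      proof
        fix w assume w: "w \<in> ball z (r - d)"
        obtain \<kappa> where \<kappa>: "w \<in> cell L \<kappa>" using cells_cover[OF L] by blast
        have "cell L \<kappa> \<subseteq> ball z r"
        proof
          fix a assume "a \<in> cell L \<kappa>"
          then have "dist w a \<le> 2 * CARD('n) * real L" using cell_dist[OF \<kappa>] by simp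
          then show "a \<in> ball z r" using w dist_triangle[of z a w] by (simp add: d_def)
        qed
        then show "w \<in> (\<Union>\<kappa>\<in>\<K>. cell L \<kappa>)" using \<kappa> unfolding \<K>_def by blast
      qed
      then have "emeasure lborel (ball z (r - d)) \<le> emeasure lborel (\<Union>\<kappa>\<in>\<K>. cell L \<kappa>)"
        using True by (intro emeasure_mono) (auto intro!: sets.finite_UN borel_closed closed_cell)
      also have "\<dots> \<le> (\<Sum>\<kappa>\<in>\<K>. emeasure lborel (cell L \<kappa>))"
        using True by (intro emeasure_subadditive_finite) (auto intro!: borel_closed closed_cell)
      also have "\<dots> = ennreal (card \<K> * V)"
        using V by (simp add: emeasure_cell V_def[symmetric] ennreal_of_nat_eq_real_of_nat ennreal_mult)
      finally have "emeasure lebesgue (ball z (r - d)) \<le> ennreal (card \<K> * V)" by simp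
      then have "ennreal (s / V) * emeasure lebesgue (ball z (r - d)) \<le> ennreal (s / V) * ennreal (card \<K> * V)"
        by (intro mult_left_mono) auto
      also have "\<dots> = ennreal (real (card (y ` (\<K> \<times> {..<s}))))"
        using V by (simp add: ennreal_mult[symmetric] card_image[OF injK] card_cartesian_product mult.commute)
      also have "\<dots> = emeasure (count_space UNIV) (y ` (\<K> \<times> {..<s}))"
        using True by (simp add: emeasure_count_space ennreal_of_nat_eq_real_of_nat)
      finally show ?thesis using le by (rule order.trans)
    qed
  qed
  define h where "h = (\<lambda>r. ennreal (s / V * ((r - d) / r) ^ m))"
  have "eventually (\<lambda>r. h r \<le> (INF z. emeasure (count_space UNIV) (\<Lambda> \<inter> ball z r) / emeasure lebesgue (ball z r))) at_top"
    using eventually_gt_at_top[of "max 0 d"]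
  proof eventually_elim
    case (elim r)
    show ?case
    proof (rule INF_greatest)
      fix z :: "(real^'n) \<times> (real^'n)"
      have r: "r > 0" "r - d \<ge> 0" using elim by auto
      have "h r = ennreal (s / V * (v * (r - d) ^ m) / (v * r ^ m))"
        using v by (simp add: h_def power_divide)
      also have "\<dots> = ennreal (s / V * (v * (r - d) ^ m)) / ennreal (v * r ^ m)"
        using v V r by (intro divide_ennreal[symmetric]) auto
      also have "ennreal (s / V * (v * (r - d) ^ m)) = ennreal (s / V) * emeasure lebesgue (ball z (r - d))"
        unfolding vol[OF r(2)] using r V v by (intro ennreal_mult) auto
      also have "ennreal (v * r ^ m) = emeasure lebesgue (ball z r)"
        using r by (intro vol[symmetric]) simp
      also have "ennreal (s / V) * emeasure lebesgue (ball z (r - d)) / emeasure lebesgue (ball z r) \<le>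
          emeasure (count_space UNIV) (\<Lambda> \<inter> ball z r) / emeasure lebesgue (ball z r)"
        by (intro divide_right_mono_ennreal count)
      finally show "h r \<le> emeasure (count_space UNIV) (\<Lambda> \<inter> ball z r) / emeasure lebesgue (ball z r)" .
    qed
  qed
  then have "Liminf at_top h \<le> lower_beurling_density \<Lambda>"
    unfolding lower_beurling_density_def by (rule Liminf_mono)
  moreover have "Liminf at_top h = ennreal (s / V)"
  proof (rule lim_imp_Liminf)
    have "((\<lambda>r. (r - d) / r) \<longlongrightarrow> 1) at_top" by real_asymp
    then have "((\<lambda>r. s / V * ((r - d) / r) ^ m) \<longlongrightarrow> s / V * 1 ^ m) at_top" by (intro tendsto_intros)
    then show "(h \<longlongrightarrow> ennreal (s / V)) at_top" unfolding h_def by (intro tendsto_ennrealI) simp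
  qed simp
  ultimately show ?thesis by (simp add: \<Lambda>_def V_def)
qed

theorem theorem1p5:
  fixes g :: "real^'n \<Rightarrow> complex" and \<epsilon> :: real
  assumes "g \<in> L2 lebesgue"
    and "\<not> (AE t in lebesgue. g t = 0)"
    and "\<epsilon> > 0"
  shows "\<exists>\<Lambda> :: ((real^'n) \<times> (real^'n)) set.
           countable \<Lambda> \<and>
           lower_beurling_density \<Lambda> \<ge> ennreal (1 - \<epsilon>) \<and>
           riesz_sequence lebesgue (\<lambda>l. time_freq_shift l g) \<Lambda>"
proof -
  note g = assms(1)
  define \<gamma> where "\<gamma> = sqint lebesgue g"
  have "\<gamma> \<noteq> 0"
  proof
    assume "\<gamma> = 0"
    then have "AE t in lebesgue. (cmod (g t))\<^sup>2 = 0"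
      unfolding \<gamma>_def sqint_def by (subst (asm) integral_nonneg_eq_0_iff_AE) (auto intro: L2_integrable g)
    then show False using assms(2) by simp
  qed
  then have \<gamma>: "\<gamma> > 0" using sqint_nonneg[of lebesgue g] by (simp add: \<gamma>_def)
  \<comment> \<open>The parameters require a value below 1; for large \<open>\<epsilon>\<close> the
    choice 1 / 2 serves.\<close>
  define \<eta> where "\<eta> = min \<epsilon> (1 / 2)"
  have \<eta>: "0 < \<eta>" "\<eta> < 1" "\<eta> \<le> \<epsilon>" using assms(3) by (auto simp: \<eta>_def)
  define n where "n = 2 * CARD('n)"
  obtain L d s :: nat and t :: real where par: "L > 0" "d > 0" "t > 0" "s < d * L ^ n"
    "(1 - \<eta>) * real L ^ n \<le> real s"
    "(real s + 1) / real (d * L ^ n) * (1 + t) * ((1 + t)\<^sup>2 * (1 / t + (real (d * L ^ n) + 1) / real L ^ n)) < 1"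
    by (rule parameter_choice[OF \<eta>(1,2), of n]) (simp add: n_def, rule that)
  define D where "D = (1 + t)\<^sup>2 * (1 / t + (real (d * L ^ n) + 1) / real L ^ n)"
  define A where "A = \<gamma> * D * (1 - (1 + t) * ((1 - 1 / D) + (real s + 1) / real (d * L ^ n) * t) / (t + (1 - 1 / D)))"
  note params = par(4) D_def par(6)[folded D_def] A_def
  have D: "D > 0" unfolding D_def using par by (intro mult_pos_pos add_pos_nonneg) auto
  have A: "A > 0"
    by (rule selection_constants(2)[OF \<gamma> _ par(3) params(2-4)]) (use par(1) in simp)
  obtain y :: "((int^'n) \<times> (int^'n)) \<times> nat \<Rightarrow> (real^'n) \<times> (real^'n)" where y: "\<And>i. y i \<in> cell L (fst i)"
    and lower: "\<And>F c. finite F \<Longrightarrow> F \<subseteq> UNIV \<times> {..<s} \<Longrightarrow>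
      A * (\<Sum>i\<in>F. (cmod (c i))\<^sup>2) \<le> 2 * sqint lebesgue (\<lambda>t. \<Sum>i\<in>F. c i * time_freq_shift (y i) g t)"
    and upper: "\<And>F c. finite F \<Longrightarrow> F \<subseteq> UNIV \<times> {..<s} \<Longrightarrow>
      sqint lebesgue (\<lambda>t. \<Sum>i\<in>F. c i * time_freq_shift (y i) g t) \<le> 2 * (\<gamma> * D) * (\<Sum>i\<in>F. (cmod (c i))\<^sup>2)"
    by (rule limit_configuration[OF g finite_stage[OF g \<gamma>_def[symmetric] \<gamma> par(1-3) refl params[unfolded n_def]]]) blast+
  let ?I = "(UNIV :: ((int^'n) \<times> (int^'n)) set) \<times> {..<s}"
  \<comment> \<open>A limit could merge two labels. Coefficients 1 and -1 would then give the zero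
    function, against the lower bound.\<close>
  have inj: "inj_on y ?I"
  proof (rule inj_onI, rule ccontr)
    fix i j assume ij: "i \<in> ?I" "j \<in> ?I" "y i = y j" "i \<noteq> j"
    define c where "c = (\<lambda>k. if k = i then 1 else - 1 :: complex)"
    have "A * (\<Sum>k\<in>{i, j}. (cmod (c k))\<^sup>2) \<le> 2 * sqint lebesgue (\<lambda>t. \<Sum>k\<in>{i, j}. c k * time_freq_shift (y k) g t)"
      using ij by (intro lower) auto
    also have "(\<lambda>t. \<Sum>k\<in>{i, j}. c k * time_freq_shift (y k) g t) = (\<lambda>t. 0)"
      using ij by (auto simp: c_def)
    also have "2 * sqint lebesgue (\<lambda>t::real^'n. 0) = 0" by (simp add: sqint_def)
    finally show False using A ij by (simp add: c_def mult_le_0_iff)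
  qed
  define \<Lambda> where "\<Lambda> = y ` ?I"
  have "countable \<Lambda>" unfolding \<Lambda>_def by (intro countable_image countableI_type)
  moreover have "lower_beurling_density \<Lambda> \<ge> ennreal (1 - \<epsilon>)"
  proof -
    have "1 - \<epsilon> \<le> 1 - \<eta>" using \<eta> by simp
    also have "\<dots> \<le> real s / real L ^ n" using par(1,5) by (simp add: pos_le_divide_eq)
    finally have "ennreal (1 - \<epsilon>) \<le> ennreal (real s / real L ^ n)" by (rule ennreal_leI)
    then show ?thesis using lower_density_of_cells[OF par(1) y inj] unfolding \<Lambda>_def n_def by (rule order.trans)
  qed
  moreover have "riesz_sequence lebesgue (\<lambda>l. time_freq_shift l g) \<Lambda>"
  proof (rule riesz_sequenceI[where A = "A / 2" and B = "2 * (\<gamma> * D)"])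
    have pull: "\<exists>F'. finite F' \<and> F' \<subseteq> ?I \<and> F = y ` F'" if "finite F" "F \<subseteq> \<Lambda>" for F
      using that unfolding \<Lambda>_def by (meson finite_subset_image)
    fix F and c :: "(real^'n) \<times> (real^'n) \<Rightarrow> complex" assume F: "finite F" "F \<subseteq> \<Lambda>"
    obtain F' where F': "finite F'" "F' \<subseteq> ?I" "F = y ` F'" using pull[OF F] by blast
    have re: "(\<Sum>l\<in>F. f l) = (\<Sum>i\<in>F'. f (y i))" for f :: "_ \<Rightarrow> 'b::comm_monoid_add"
      unfolding F'(3) by (subst sum.reindex) (auto intro: inj_on_subset[OF inj F'(2)])
    show "A / 2 * (\<Sum>l\<in>F. (cmod (c l))\<^sup>2) \<le> sqint lebesgue (\<lambda>t. \<Sum>l\<in>F. c l * time_freq_shift l g t)"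
      using lower[OF F'(1,2), of "c \<circ> y"] unfolding re by simp
    show "sqint lebesgue (\<lambda>t. \<Sum>l\<in>F. c l * time_freq_shift l g t) \<le> 2 * (\<gamma> * D) * (\<Sum>l\<in>F. (cmod (c l))\<^sup>2)"
      using upper[OF F'(1,2), of "c \<circ> y"] unfolding re by simp
  qed (use A D \<gamma> \<open>countable \<Lambda>\<close> time_freq_shift_L2(1)[OF g] in auto)
  ultimately show ?thesis by blast
qed

end
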